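(* Assume $\mathrm{char}(\mathbb F)=p>0$ and $0\neq h\in R=\mathbb F[x]$. Then $\mathsf{HH}^1(A_h)=\mathrm{Der}_{\mathbb F}(A_h)/\mathrm{Inder}_{\mathbb F}(A_h)$ is a free $\mathsf Z(A_h)$-module if and only if $\frac{h}{\pi_h}\in\mathbb F^*$. When $\frac{h}{\pi_h}\in\mathbb F^*$, then $$\mathrm{Der}_{\mathbb F}(A_h)=\mathsf Z(A_h)D_{\breve q}\oplus\mathsf Z(A_h)\breve F\oplus\mathrm{Inder}_{\mathbb F}(A_h),$$ so that $\mathsf{HH}^1(A_h)$ is a free $\mathsf Z(A_h)$-module of rank $2$ with $\mathsf Z(A_h)$-basis $\{D_{\breve q},\breve F\}$.
   Context: $\mathbb F$ is a field of characteristic $p>0$, $R=\mathbb F[x]$, $0\ne h\in R$. The Weyl algebra $A_1$ is the unital associative $\mathbb F$-algebra with generators $x,y$ and relation $yx-xy=1$. $A_h$ is the unital associative $\mathbb F$-algebra with generators $x,\hat y$ and relation $\hat yx-x\hat y=h$; it is identified with the subalgebra of $A_1$ generated by $x$ and $\hat y=yh$. The center of $A_h$ is $\mathsf Z(A_h)=\mathbb F[x^p,\mathsf z_h]$ with $\mathsf z_h=h^py^p$. $\pi_h\in R$ is the unique monic polynomial such that for all $r\in R$: $h\mid h'r\iff\pi_h\mid r$ (so, up to a nonzero scalar, $\pi_h=h/\gcd(h,h')$; $\pi_h=1$ if $h'=0$). For $r\in R$, $D_r$ is the derivation of $A_h$ with $D_r(x)=0$, $D_r(\hat y)=r$. $\varrho_h$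 is the unique monic polynomial of maximal degree in $\mathbb F[x^p]$ dividing $h$ (it also divides $h'$). Write $h^{p-1}=\sum_{i=0}^{p-1}\overline h_ix^i$ with $\overline h_i\in\mathbb F[x^p]$, let $\overline h$ be the greatest common divisor in $\mathbb F[x^p]$ of the $\overline h_i$, choose $\breve q_i\in\mathbb F[x^p]$ with $\overline h=\sum_i\breve q_i\overline h_i$, and put $\breve q=-\sum_{i=0}^{p-1}\breve q_ix^{p-1-i}$. $E_x\in\mathrm{Der}_{\mathbb F}(A_1)$ is given by $E_x(x)=y^{p-1}$, $E_x(y)=0$, and $\breve F=\mathsf z_hD_{\frac{h'}{\varrho_h}}-\frac{h^p}{\varrho_h}E_x$, a derivation of $A_h$. Derivations and their images in $\mathsf{HH}^1(A_h)$ are denoted by the same symbol. *)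

theory Defs
  imports
    "HOL-Computational_Algebra.Computational_Algebra"
    "HOL-Library.Poly_Mapping"
    "HOL-Library.FuncSet"
    "HOL-Algebra.Module"
    "HOL-Algebra.AbelCoset"
begin

text \<open>The free monoid on \<open>'g\<close>, written additively so that finitely supported functions on it
  form, with the convolution product of \<^theory>\<open>HOL-Library.Poly_Mapping\<close>, the free
  associative algebra on \<open>'g\<close>.\<close>

datatype 'g free_monoid = Word (letters: "'g list")

instantiation free_monoid :: (type) monoid_add
begin

definition zero_free_monoid :: "'a free_monoid" where
  "0 = Word []"

definition plus_free_monoid :: "'a free_monoid \<Rightarrow> 'a free_monoid \<Rightarrow> 'a free_monoid" where
  "u + v = Word (letters u @ letters v)"

instance
  by standard (simp_all add: zero_free_monoid_def plus_free_monoid_def)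

end

lemma letters_zero [simp]: "letters 0 = []"
  by (simp add: zero_free_monoid_def)

lemma letters_plus [simp]: "letters (u + v) = letters u @ letters v"
  by (simp add: plus_free_monoid_def)

inductive_set two_sided_ideal :: "'r::ring_1 set \<Rightarrow> 'r set" for S where
  zero: "0 \<in> two_sided_ideal S"
| base: "s \<in> S \<Longrightarrow> s \<in> two_sided_ideal S"
| add: "a \<in> two_sided_ideal S \<Longrightarrow> b \<in> two_sided_ideal S \<Longrightarrow> a + b \<in> two_sided_ideal S"
| mult: "a \<in> two_sided_ideal S \<Longrightarrow> r * a * s \<in> two_sided_ideal S"

lemma two_sided_ideal_uminus: "a \<in> two_sided_ideal S \<Longrightarrow> - a \<in> two_sided_ideal S"
  using two_sided_ideal.mult[of a S "-1" 1] by simp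

lemma two_sided_ideal_lmult: "a \<in> two_sided_ideal S \<Longrightarrow> r * a \<in> two_sided_ideal S"
  using two_sided_ideal.mult[of a S r 1] by simp

lemma two_sided_ideal_rmult: "a \<in> two_sided_ideal S \<Longrightarrow> a * r \<in> two_sided_ideal S"
  using two_sided_ideal.mult[of a S 1 r] by simp

datatype weyl_gen = GX | GY

type_synonym 'a weyl_free = "weyl_gen free_monoid \<Rightarrow>\<^sub>0 'a"

definition free_gen :: "weyl_gen \<Rightarrow> 'a::field weyl_free" where
  "free_gen g = Poly_Mapping.single (Word [g]) 1"

definition weyl_ideal :: "'a::field weyl_free set" where
  "weyl_ideal = two_sided_ideal {free_gen GY * free_gen GX - free_gen GX * free_gen GY - 1}"

definition weyl_rel :: "'a::field weyl_free \<Rightarrow> 'a weyl_free \<Rightarrow> bool" where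
  "weyl_rel f g \<longleftrightarrow> f - g \<in> weyl_ideal"

text \<open>The action of the free algebra on polynomials (\<open>x\<close> by multiplication, \<open>y\<close> by
  differentiation) is only needed to see that the quotient is not the zero ring.\<close>

fun gen_act :: "weyl_gen \<Rightarrow> 'a::field poly \<Rightarrow> 'a poly" where
  "gen_act GX q = [:0, 1:] * q"
| "gen_act GY q = pderiv q"

definition free_act :: "'a::field weyl_free \<Rightarrow> 'a poly \<Rightarrow> 'a poly" where
  "free_act f q =
    (\<Sum>w\<in>Poly_Mapping.keys f. Polynomial.smult (Poly_Mapping.lookup f w) (foldr gen_act (letters w) q))"

lemma gen_act_add: "gen_act g (p + q) = gen_act g p + gen_act g q"
  by (cases g) (simp_all add: algebra_simps pderiv_add)

lemma gen_act_smult: "gen_act g (Polynomial.smult c q) = Polynomial.smult c (gen_act g q)"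
  by (cases g) (simp_all add: pderiv_smult)

lemma word_act_add:
  "foldr gen_act ws (p + q) = foldr gen_act ws p + foldr gen_act ws q"
  by (induction ws) (simp_all add: gen_act_add)

lemma word_act_smult: "foldr gen_act ws (Polynomial.smult c q) = Polynomial.smult c (foldr gen_act ws q)"
  by (induction ws) (simp_all add: gen_act_smult)

lemma free_act_superset:
  assumes "finite S" "Poly_Mapping.keys f \<subseteq> S"
  shows "free_act f q = (\<Sum>w\<in>S. Polynomial.smult (Poly_Mapping.lookup f w) (foldr gen_act (letters w) q))"
  unfolding free_act_def using assms
  by (intro sum.mono_neutral_left) (auto simp: in_keys_iff)

lemma free_act_zero [simp]: "free_act 0 q = 0"
  by (simp add: free_act_def)

lemma free_act_add: "free_act (f + g) q = free_act f q + free_act g q"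
proof -
  let ?S = "Poly_Mapping.keys f \<union> Poly_Mapping.keys g"
  have "Poly_Mapping.keys (f + g) \<subseteq> ?S"
    by (rule Poly_Mapping.keys_add)
  then show ?thesis
    by (simp add: free_act_superset[of ?S] lookup_add smult_add_left sum.distrib)
qed

lemma free_act_single:
  "free_act (Poly_Mapping.single w c) q = Polynomial.smult c (foldr gen_act (letters w) q)"
  by (simp add: free_act_superset[of "{w}"])

lemma free_act_plus_right: "free_act f (p + q) = free_act f p + free_act f q"
  by (simp add: free_act_def word_act_add smult_add_right sum.distrib)

lemma free_act_zero_right [simp]: "free_act f 0 = 0"
  by (metis add_cancel_right_right free_act_plus_right)

lemma weyl_free_induct [case_names zero single add]:
  fixes f :: "'a::field weyl_free"
  assumes "P 0" "\<And>w c. P (Poly_Mapping.single w c)" "\<And>f g. P f \<Longrightarrow> P g \<Longrightarrow> P (f + g)"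
  shows "P f"
proof (induction f rule: update_induct)
  case const
  show ?case by (rule assms(1))
next
  case (update f a b)
  have "Poly_Mapping.update a b f = f + Poly_Mapping.single a b"
    using update(1)
    by (intro poly_mapping_eqI) (auto simp: lookup_update lookup_add lookup_single in_keys_iff when_def)
  then show ?case
    using assms(2,3) update(3) by simp
qed

lemma free_act_mult: "free_act (f * g) q = free_act f (free_act g q)"
proof (induction f rule: weyl_free_induct)
  case zero
  show ?case by simp
next
  case (single w c)
  show ?case
  proof (induction g rule: weyl_free_induct)
    case zero
    show ?case by simp
  next
    case (single v d)
    show ?case
      by (simp add: mult_single free_act_single word_act_smult)
  next
    case (add f g)
    then show ?case
      by (simp add: algebra_simps free_act_add free_act_plus_right)
  qed
next
  case (add f g)
  then show ?case
    by (simp add: algebra_simps free_act_add)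
qed

lemma free_act_weyl_ideal:
  assumes "f \<in> weyl_ideal"
  shows "free_act f q = 0"
  using assms unfolding weyl_ideal_def
proof (induction f arbitrary: q rule: two_sided_ideal.induct)
  case (base s)
  have diff: "free_act (f - g) q = free_act f q - free_act g q" for f g :: "'a weyl_free"
    using free_act_add[of "f - g" g q] by simp
  have one: "free_act 1 q = q"
    using free_act_single[of 0 1 q] by simp
  have "free_act s q = pderiv ([:0, 1:] * q) - [:0, 1:] * pderiv q - q"
    using base by (simp add: diff one free_act_mult) (simp add: free_gen_def free_act_single)
  also have "\<dots> = 0"
    by (simp add: pderiv_mult pderiv_pCons)
  finally show ?case .
next
  case (mult a r s)
  show ?case
    by (simp add: free_act_mult mult.IH)
qed (simp_all add: free_act_add)

lemma one_notin_weyl_ideal: "1 \<notin> weyl_ideal"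
proof
  assume "1 \<in> (weyl_ideal :: 'a weyl_free set)"
  then have "free_act (1 :: 'a weyl_free) 1 = 0"
    by (rule free_act_weyl_ideal)
  then show False
    using free_act_single[of 0 "1 :: 'a" 1] by simp
qed

lemma equivp_weyl_rel: "equivp (weyl_rel :: 'a::field weyl_free \<Rightarrow> _)"
proof (rule equivpI)
  show "reflp (weyl_rel :: 'a weyl_free \<Rightarrow> _)"
    by (rule reflpI) (simp add: weyl_rel_def weyl_ideal_def two_sided_ideal.zero)
  show "symp (weyl_rel :: 'a weyl_free \<Rightarrow> _)"
  proof (rule sympI)
    fix f g :: "'a weyl_free"
    assume "weyl_rel f g"
    then show "weyl_rel g f"
      using two_sided_ideal_uminus[of "f - g"] by (simp add: weyl_rel_def weyl_ideal_def)
  qed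
  show "transp (weyl_rel :: 'a weyl_free \<Rightarrow> _)"
  proof (rule transpI)
    fix f g k :: "'a weyl_free"
    assume "weyl_rel f g" "weyl_rel g k"
    then show "weyl_rel f k"
      using two_sided_ideal.add[of "f - g" _ "g - k"] by (simp add: weyl_rel_def weyl_ideal_def)
  qed
qed

quotient_type (overloaded) 'a weyl = "'a::field weyl_free" / weyl_rel
  by (rule equivp_weyl_rel)

instantiation weyl :: (field) ring_1
begin

lift_definition zero_weyl :: "'a weyl" is 0 .

lift_definition one_weyl :: "'a weyl" is 1 .

lift_definition uminus_weyl :: "'a weyl \<Rightarrow> 'a weyl" is uminus
proof -
  fix f g :: "'a weyl_free"
  assume "weyl_rel f g"
  then show "weyl_rel (- f) (- g)"
    using two_sided_ideal_uminus[of "f - g"]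
    by (simp add: weyl_rel_def weyl_ideal_def algebra_simps)
qed

lift_definition plus_weyl :: "'a weyl \<Rightarrow> 'a weyl \<Rightarrow> 'a weyl" is plus
proof -
  fix f g f' g' :: "'a weyl_free"
  assume "weyl_rel f g" "weyl_rel f' g'"
  then show "weyl_rel (f + f') (g + g')"
    using two_sided_ideal.add[of "f - g" _ "f' - g'"]
    by (simp add: weyl_rel_def weyl_ideal_def algebra_simps)
qed

lift_definition minus_weyl :: "'a weyl \<Rightarrow> 'a weyl \<Rightarrow> 'a weyl" is minus
proof -
  fix f g f' g' :: "'a weyl_free"
  assume "weyl_rel f g" "weyl_rel f' g'"
  then show "weyl_rel (f - f') (g - g')"
    using two_sided_ideal.add[of "f - g" _ "- (f' - g')"] two_sided_ideal_uminus[of "f' - g'"]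
    by (simp add: weyl_rel_def weyl_ideal_def algebra_simps)
qed

lift_definition times_weyl :: "'a weyl \<Rightarrow> 'a weyl \<Rightarrow> 'a weyl" is times
proof -
  fix f g f' g' :: "'a weyl_free"
  assume "weyl_rel f g" "weyl_rel f' g'"
  then have "(f - g) * f' + g * (f' - g') \<in> weyl_ideal"
    unfolding weyl_rel_def weyl_ideal_def
    by (intro two_sided_ideal.add two_sided_ideal_lmult two_sided_ideal_rmult)
  then show "weyl_rel (f * f') (g * g')"
    by (simp add: weyl_rel_def algebra_simps)
qed

instance
proof
  fix a b c :: "'a weyl"
  have refl: "weyl_rel f f" for f :: "'a weyl_free"
    by (simp add: weyl_rel_def weyl_ideal_def two_sided_ideal.zero)
  show "a + b + c = a + (b + c)" by transfer (simp add: refl add.assoc)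
  show "a + b = b + a" by transfer (simp add: refl add.commute)
  show "0 + a = a" by transfer (simp add: refl)
  show "- a + a = 0" by transfer (simp add: refl)
  show "a - b = a + - b" by transfer (simp add: refl)
  show "a * b * c = a * (b * c)" by transfer (simp add: refl mult.assoc)
  show "1 * a = a" by transfer (simp add: refl)
  show "a * 1 = a" by transfer (simp add: refl)
  show "(a + b) * c = a * c + b * c" by transfer (simp add: refl distrib_right)
  show "a * (b + c) = a * b + a * c" by transfer (simp add: refl distrib_left)
  show "(0 :: 'a weyl) \<noteq> 1"
    by transfer (use one_notin_weyl_ideal two_sided_ideal_uminus in
      \<open>fastforce simp: weyl_rel_def weyl_ideal_def\<close>)
qed

end

lift_definition weyl_x :: "'a::field weyl" is "free_gen GX" .

lift_definition weyl_y :: "'a::field weyl" is "free_gen GY" .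

lift_definition weyl_const :: "'a::field \<Rightarrow> 'a weyl" is "\<lambda>c. Poly_Mapping.single 0 c" .

definition weyl_of_poly :: "'a::field poly \<Rightarrow> 'a weyl" where
  "weyl_of_poly r = (\<Sum>i\<le>degree r. weyl_const (coeff r i) * weyl_x ^ i)"

inductive_set weyl_subalgebra :: "'a::field weyl set \<Rightarrow> 'a weyl set" for S where
  const: "weyl_const c \<in> weyl_subalgebra S"
| base: "s \<in> S \<Longrightarrow> s \<in> weyl_subalgebra S"
| add: "a \<in> weyl_subalgebra S \<Longrightarrow> b \<in> weyl_subalgebra S \<Longrightarrow> a + b \<in> weyl_subalgebra S"
| mult: "a \<in> weyl_subalgebra S \<Longrightarrow> b \<in> weyl_subalgebra S \<Longrightarrow> a * b \<in> weyl_subalgebra S"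

text \<open>\<open>A_h\<close>, with generators \<open>x, yhat\<close> and relation \<open>yhat x - x yhat = h\<close>, is identified with
  its image in the Weyl algebra under \<open>yhat \<mapsto> y h\<close>.\<close>

definition yhat :: "'a::field poly \<Rightarrow> 'a weyl" where
  "yhat h = weyl_y * weyl_of_poly h"

definition Ah :: "'a::field poly \<Rightarrow> 'a weyl set" where
  "Ah h = weyl_subalgebra {weyl_x, yhat h}"

text \<open>In this 

  represented by functions on the whole type that are \<^term>\<open>undefined\<close> outside \<open>B\<close>.\<close>

definition center :: "'a::field weyl set \<Rightarrow> 'a weyl set" where
  "center B = {z \<in> B. \<forall>b\<in>B. z * b = b * z}"

definition center_ring :: "'a::field weyl set \<Rightarrow> 'a weyl ring" where
  "center_ring B = \<lparr>carrier = center B, mult = (*), one = 1, zero = 0, add = (+)\<rparr>"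

definition Der :: "'a::field weyl set \<Rightarrow> ('a weyl \<Rightarrow> 'a weyl) set" where
  "Der B = {D \<in> B \<rightarrow>\<^sub>E B.
     (\<forall>a\<in>B. \<forall>b\<in>B. D (a + b) = D a + D b) \<and>
     (\<forall>c. \<forall>a\<in>B. D (weyl_const c * a) = weyl_const c * D a) \<and>
     (\<forall>a\<in>B. \<forall>b\<in>B. D (a * b) = D a * b + a * D b)}"

definition Inder :: "'a::field weyl set \<Rightarrow> ('a weyl \<Rightarrow> 'a weyl) set" where
  "Inder B = (\<lambda>b. \<lambda>a\<in>B. b * a - a * b) ` B"

text \<open>The fields \<^const>\<open>mult\<close> and \<^const>\<open>one\<close> of a module record are irrelevant for
  \<^locale>\<open>module\<close>.\<close>

definition Der_module :: "'a::field weyl set \<Rightarrow> ('a weyl, 'a weyl \<Rightarrow> 'a weyl) module" where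
  "Der_module B = \<lparr>carrier = Der B, mult = undefined, one = undefined,
     zero = (\<lambda>a\<in>B. 0), add = (\<lambda>D E. \<lambda>a\<in>B. D a + E a),
     smult = (\<lambda>z D. \<lambda>a\<in>B. z * D a)\<rparr>"

definition quotient_module :: "('r, 'm) module \<Rightarrow> 'm set \<Rightarrow> ('r, 'm set) module" where
  "quotient_module M N = \<lparr>carrier = a_rcosets\<^bsub>M\<^esub> N, mult = undefined, one = undefined,
     zero = N, add = set_add M,
     smult = (\<lambda>r C. \<Union>m\<in>C. N +>\<^bsub>M\<^esub> (r \<odot>\<^bsub>M\<^esub> m))\<rparr>"

definition HH1 :: "'a::field weyl set \<Rightarrow> ('a weyl, ('a weyl \<Rightarrow> 'a weyl) set) module" where
  "HH1 B = quotient_module (Der_module B) (Inder B)"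

definition HH1_class :: "'a::field weyl set \<Rightarrow> ('a weyl \<Rightarrow> 'a weyl) \<Rightarrow> ('a weyl \<Rightarrow> 'a weyl) set" where
  "HH1_class B D = Inder B +>\<^bsub>Der_module B\<^esub> D"

definition module_basis :: "('r, 'k) ring_scheme \<Rightarrow> ('r, 'm, 'l) module_scheme \<Rightarrow> 'm set \<Rightarrow> bool" where
  "module_basis R M X \<longleftrightarrow> X \<subseteq> carrier M \<and>
     (\<forall>m\<in>carrier M. \<exists>S f. finite S \<and> S \<subseteq> X \<and> f \<in> S \<rightarrow> carrier R \<and>
        m = (\<Oplus>\<^bsub>M\<^esub>b\<in>S. f b \<odot>\<^bsub>M\<^esub> b)) \<and>
     (\<forall>S f. finite S \<and> S \<subseteq> X \<and> f \<in> S \<rightarrow> carrier R \<and>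
        (\<Oplus>\<^bsub>M\<^esub>b\<in>S. f b \<odot>\<^bsub>M\<^esub> b) = \<zero>\<^bsub>M\<^esub> \<longrightarrow> (\<forall>b\<in>S. f b = \<zero>\<^bsub>R\<^esub>))"

definition free_module :: "('r, 'k) ring_scheme \<Rightarrow> ('r, 'm, 'l) module_scheme \<Rightarrow> bool" where
  "free_module R M \<longleftrightarrow> module R M \<and> (\<exists>X. module_basis R M X)"

definition cyclic_submodule :: "('r, 'k) ring_scheme \<Rightarrow> ('r, 'm, 'l) module_scheme \<Rightarrow> 'm \<Rightarrow> 'm set" where
  "cyclic_submodule R M m = (\<lambda>r. r \<odot>\<^bsub>M\<^esub> m) ` carrier R"

definition direct_sum3 ::
  "('r, 'k) ring_scheme \<Rightarrow> ('r, 'm, 'l) module_scheme \<Rightarrow> 'm set \<Rightarrow> 'm set \<Rightarrow> 'm set \<Rightarrow> bool" where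
  "direct_sum3 R M U V W \<longleftrightarrow>
     submodule U R M \<and> submodule V R M \<and> submodule W R M \<and>
     (\<forall>m\<in>carrier M. \<exists>!t. t \<in> U \<times> V \<times> W \<and>
        m = (case t of (u, v, w) \<Rightarrow> u \<oplus>\<^bsub>M\<^esub> v \<oplus>\<^bsub>M\<^esub> w))"

text \<open>The subring \<open>F[x^p]\<close> of \<open>F[x]\<close>, where \<open>p\<close> is the characteristic.\<close>

definition Rp :: "'a::field poly set" where
  "Rp = range (\<lambda>g. pcompose g (monom 1 CHAR('a)))"

definition pi_poly :: "'a::field poly \<Rightarrow> 'a poly" where
  "pi_poly h = (THE q. lead_coeff q = 1 \<and> (\<forall>r. h dvd pderiv h * r \<longleftrightarrow> q dvd r))"

definition rho_poly :: "'a::field poly \<Rightarrow> 'a poly" where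
  "rho_poly h = (THE g. lead_coeff g = 1 \<and> g \<in> Rp \<and> g dvd h \<and>
     (\<forall>f\<in>Rp. f dvd h \<longrightarrow> degree f \<le> degree g))"

definition dvd_Rp :: "'a::field poly \<Rightarrow> 'a poly \<Rightarrow> bool" where
  "dvd_Rp f g \<longleftrightarrow> (\<exists>k\<in>Rp. g = f * k)"

definition gcd_Rp :: "'a::field poly set \<Rightarrow> 'a poly \<Rightarrow> bool" where
  "gcd_Rp G d \<longleftrightarrow> d \<in> Rp \<and> (\<forall>g\<in>G. dvd_Rp d g) \<and> (\<forall>e\<in>Rp. (\<forall>g\<in>G. dvd_Rp e g) \<longrightarrow> dvd_Rp e d)"

text \<open>The polynomial \<open>q\<close> constructed from \<open>h\<close> depends on the choice of a greatest common divisor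
  (up to a unit) and of Bezout coefficients, hence a predicate.\<close>

definition is_q_breve :: "'a::field poly \<Rightarrow> 'a poly \<Rightarrow> bool" where
  "is_q_breve h q \<longleftrightarrow> (\<exists>hs d qs.
     (\<forall>i<CHAR('a). hs i \<in> Rp) \<and>
     h ^ (CHAR('a) - 1) = (\<Sum>i<CHAR('a). hs i * [:0, 1:] ^ i) \<and>
     gcd_Rp (hs ` {..<CHAR('a)}) d \<and>
     (\<forall>i<CHAR('a). qs i \<in> Rp) \<and>
     d = (\<Sum>i<CHAR('a). qs i * hs i) \<and>
     q = - (\<Sum>i<CHAR('a). qs i * [:0, 1:] ^ (CHAR('a) - 1 - i)))"

definition D_poly :: "'a::field poly \<Rightarrow> 'a poly \<Rightarrow> 'a weyl \<Rightarrow> 'a weyl" where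
  "D_poly h r = (THE D. D \<in> Der (Ah h) \<and> D weyl_x = 0 \<and> D (yhat h) = weyl_of_poly r)"

definition E_x :: "'a::field weyl \<Rightarrow> 'a weyl" where
  "E_x = (THE E. E \<in> Der UNIV \<and> E weyl_x = weyl_y ^ (CHAR('a) - 1) \<and> E weyl_y = 0)"

definition z_elt :: "'a::field poly \<Rightarrow> 'a weyl" where
  "z_elt h = weyl_of_poly (h ^ CHAR('a)) * weyl_y ^ CHAR('a)"

definition F_breve :: "'a::field poly \<Rightarrow> 'a weyl \<Rightarrow> 'a weyl" where
  "F_breve h = (\<lambda>a\<in>Ah h. z_elt h * D_poly h (pderiv h div rho_poly h) a
     - weyl_of_poly (h ^ CHAR('a) div rho_poly h) * E_x a)"

end

theory Submission
  imports Defs "HOL-Library.Product_Plus"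
begin

text \<open>
  Write \<open>R = F[x]\<close>.  Everything is done in coordinates: the Weyl algebra \<open>A\<^sub>1\<close> is free over \<open>R\<close> on
  the powers of \<open>y\<close>, \<open>A\<^sub>h\<close> consists of the elements whose coefficient at \<open>y\<^sup>i\<close> is divisible by \<open>h\<^sup>i\<close>
  (\<open>Ah_iff\<close>), \<open>[-, x]\<close> is differentiation with respect to \<open>y\<close>, and \<open>[y, -]\<close> differentiates the
  coefficients.  The condition that \<open>h / \<pi>\<close> is a nonzero constant means that \<open>h\<close> is separable, that
  is, coprime to \<open>h'\<close>.

  Let \<open>h\<close> be separable and \<open>D\<close> a derivation of \<open>A\<^sub>h\<close>.  The ring \<open>A\<^sub>h / (h)\<close> is commutative and \<open>D\<close>
  applied to \<open>[yhat, x] = h\<close> gives \<open>h' D(x) = 0\<close> there; so \<open>D(x)\<close> lies in \<open>h A\<^sub>h\<close>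
  (\<open>Der_x_in_hAh\<close>).  The factor \<open>h\<close> is just what is needed to integrate \<open>D(x)\<close> with respect to \<open>y\<close>
  inside \<open>A\<^sub>h\<close>, except at the powers \<open>y\<^sup>j\<close> with \<open>p dvd j + 1\<close>.  Subtracting an inner derivation
  leaves \<open>D(x) = w h\<^sup>p y\<^sup>p\<^sup>-\<^sup>1\<close> with \<open>w\<close> in the centralizer of \<open>x\<close>, and the same relation forces \<open>w\<close> to
  be central (\<open>top_part_central\<close>).  Since \<open>F(x) = - h\<^sup>p y\<^sup>p\<^sup>-\<^sup>1\<close>, adding \<open>w F\<close> makes \<open>D\<close> kill \<open>x\<close>.
  Then \<open>D\<close> is given by \<open>D(yhat)\<close>, an element of \<open>R[y\<^sup>p]\<close>, which inner derivations killing \<open>x\<close>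
  change by \<open>h\<close> times derivatives.  It remains to see \<open>R = h R' + F[x\<^sup>p] q\<close>, where \<open>R'\<close> is the
  set of all derivatives (\<open>poly_decomposition\<close>).  For this consider the trace, that is, the
  \<open>(p - 1)\<close>-st derivative of \<open>r h\<^sup>p\<^sup>-\<^sup>1\<close>, which is linear over \<open>F[x\<^sup>p]\<close>: its kernel is \<open>h R'\<close>
  (\<open>trace_h_zero_imp\<close>), and \<open>q\<close> is made such that its trace is, up to a unit, the greatest common
  divisor of the coefficients of \<open>h\<^sup>p\<^sup>-\<^sup>1\<close>, which is a constant for separable \<open>h\<close>
  (\<open>trace_h_q_breve\<close>).  Uniqueness follows from the same invariants: the terms of the value at \<open>x\<close>
  in \<open>y\<^sup>j\<close> with \<open>p dvd j + 1\<close>, and the trace of the value at \<open>yhat\<close>.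

  If \<open>g = h / \<pi>\<close> is not a constant, the operators \<open>[w / g, -]\<close> with \<open>w\<close> in \<open>R\<close> still map
  \<open>A\<^sub>h\<close> to itself, and \<open>g\<^sup>p\<close> times such a derivation is inner.  They cannot be inner both for
  \<open>w = 1\<close> and for \<open>w = x\<close>, because inner derivations take values in \<open>h A\<^sub>h\<close>
  and \<open>h\<close> would divide \<open>\<pi>\<close>.  So \<open>HH\<^sup>1\<close>
  has torsion over the domain \<open>Z(A\<^sub>h)\<close> and is not free (\<open>free_imp_unit\<close>).
\<close>

section \<open>Polynomials in positive characteristic\<close>

lemma poly_ideal_principal:
  fixes I :: "'a::field poly set"
  assumes zero: "0 \<in> I"
    and add: "\<And>a b. a \<in> I \<Longrightarrow> b \<in> I \<Longrightarrow> a + b \<in> I"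
    and mult: "\<And>a r. a \<in> I \<Longrightarrow> r * a \<in> I"
  shows "\<exists>g\<in>I. \<forall>r. r \<in> I \<longleftrightarrow> g dvd r"
proof (cases "I \<subseteq> {0}")
  case True
  then show ?thesis
    using zero by (intro bexI[of _ 0]) auto
next
  case False
  then obtain f where f: "f \<in> I - {0}" by auto
  define g where "g = arg_min Polynomial.degree (\<lambda>f. f \<in> I - {0})"
  have g: "g \<in> I" "g \<noteq> 0"
    unfolding g_def using arg_min_natI[of "\<lambda>f. f \<in> I - {0}", OF f] by auto
  have le: "Polynomial.degree g \<le> Polynomial.degree r" if "r \<in> I" "r \<noteq> 0" for r
    unfolding g_def using that by (intro arg_min_nat_le) auto
  have "g dvd r" if "r \<in> I" for r
  proof -
    have "r + (- (r div g)) * g \<in> I"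
      using that g(1) by (intro add mult)
    moreover have "r + (- (r div g)) * g = r mod g"
      by (simp add: minus_div_mult_eq_mod)
    ultimately have "r mod g \<in> I" by simp
    then have "r mod g = 0"
      using le[of "r mod g"] degree_mod_less[OF g(2), of r] by force
    then show ?thesis by auto
  qed
  moreover have "r \<in> I" if "g dvd r" for r
    using that mult[OF g(1)] by (auto simp: mult.commute elim!: dvdE)
  ultimately show ?thesis using g(1) by blast
qed

text \<open>Coprimality of \<open>h\<close> and \<open>h'\<close>, as the Bezout identity that inverts \<open>h'\<close> modulo \<open>h\<close>.\<close>

definition separable :: "'a::field poly \<Rightarrow> bool" where
  "separable h \<longleftrightarrow> (\<exists>u v. u * h + v * pderiv h = 1)"

lemma bezout_finite:
  fixes f :: "nat \<Rightarrow> 'a::field poly"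
  shows "\<exists>c. \<forall>i<n. (\<Sum>i<n. c i * f i) dvd f i"
proof -
  let ?I = "{\<Sum>i<n. c i * f i | c. True}"
  have "0 \<in> ?I"
    by (auto intro: exI[of _ "\<lambda>_. 0"])
  moreover have "a + b \<in> ?I" if ab: "a \<in> ?I" "b \<in> ?I" for a b
  proof -
    from ab obtain c d where "a = (\<Sum>i<n. c i * f i)" "b = (\<Sum>i<n. d i * f i)" by auto
    then have "a + b = (\<Sum>i<n. (c i + d i) * f i)"
      by (simp add: distrib_right sum.distrib)
    then show ?thesis by (auto intro!: exI[of _ "\<lambda>i. c i + d i"])
  qed
  moreover have "r * a \<in> ?I" if a: "a \<in> ?I" for a r
  proof -
    from a obtain c where "a = (\<Sum>i<n. c i * f i)" by auto
    then have "r * a = (\<Sum>i<n. (r * c i) * f i)"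
      by (simp add: sum_distrib_left mult.assoc)
    then show ?thesis by (auto intro!: exI[of _ "\<lambda>i. r * c i"])
  qed
  ultimately have "\<exists>d\<in>?I. \<forall>r. r \<in> ?I \<longleftrightarrow> d dvd r"
    by (rule poly_ideal_principal)
  then obtain c where c: "\<And>r. r \<in> ?I \<longleftrightarrow> (\<Sum>i<n. c i * f i) dvd r"
    by blast
  have "f i \<in> ?I" if "i < n" for i
  proof -
    have "(\<Sum>j<n. (if j = i then 1 else 0) * f j) = (\<Sum>j<n. if j = i then f j else 0)"
      by (intro sum.cong) auto
    then have "f i = (\<Sum>j<n. (if j = i then 1 else 0) * f j)"
      using that by simp
    then show ?thesis by (auto intro!: exI[of _ "\<lambda>j. if j = i then 1 else 0"])
  qed
  then show ?thesis
    using c by blast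
qed

lemma monic_dvd_antisym:
  fixes f g :: "'a::field poly"
  assumes "f dvd g" "g dvd f" "lead_coeff f = 1" "lead_coeff g = 1"
  shows "f = g"
proof -
  obtain k where k: "g = f * k" using assms(1) ..
  have "Polynomial.degree f = Polynomial.degree g"
    using assms by (intro antisym dvd_imp_degree_le) auto
  then have "Polynomial.degree k = 0"
    using k assms(3,4) by (subst (asm) k, subst (asm) degree_mult_eq) auto
  then obtain c where "k = [:c:]" by (rule degree_eq_zeroE)
  with k assms(3,4) show ?thesis
    by (cases "c = 0") auto
qed

text \<open>The \<open>r\<close> with \<open>h dvd h' r\<close> form an ideal containing \<open>h\<close>, so its monic generator exists and
  is unique.\<close>

lemma pi_poly_spec:
  fixes h :: "'a::field poly"
  assumes "h \<noteq> 0"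
  shows "h dvd pderiv h * r \<longleftrightarrow> pi_poly h dvd r"
proof -
  let ?I = "{r. h dvd pderiv h * r}"
  have "0 \<in> ?I" by simp
  moreover have "a + b \<in> ?I" if "a \<in> ?I" "b \<in> ?I" for a b
    using that by (simp add: distrib_left)
  moreover have "r * a \<in> ?I" if "a \<in> ?I" for a r
    using that by (simp add: mult.left_commute)
  ultimately have "\<exists>g\<in>?I. \<forall>r. r \<in> ?I \<longleftrightarrow> g dvd r"
    by (rule poly_ideal_principal)
  then obtain g where g: "g \<in> ?I" "\<And>r. r \<in> ?I \<longleftrightarrow> g dvd r"
    by blast
  have g0: "g \<noteq> 0"
    using g(2)[of h] assms by auto
  define q where "q = Polynomial.smult (inverse (lead_coeff g)) g"
  have q: "lead_coeff q = 1" "\<And>r. h dvd pderiv h * r \<longleftrightarrow> q dvd r"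
    using g(2) g0 by (auto simp: q_def smult_dvd_iff)
  have "lead_coeff (pi_poly h) = 1 \<and> (\<forall>r. h dvd pderiv h * r \<longleftrightarrow> pi_poly h dvd r)"
    unfolding pi_poly_def
  proof (rule theI[of _ q])
    show "lead_coeff q = 1 \<and> (\<forall>r. (h dvd pderiv h * r) = (q dvd r))"
      using q by blast
  next
    fix s
    assume s: "lead_coeff s = 1 \<and> (\<forall>r. (h dvd pderiv h * r) = (s dvd r))"
    have "s dvd q"
      using s q(2)[of q] dvd_refl[of q] by simp
    moreover have "q dvd s"
      using s q(2)[of s] dvd_refl[of s] by simp
    ultimately show "s = q"
      using s q(1) monic_dvd_antisym[of s q] by simp
  qed
  then show ?thesis by blast
qed

lemma nonzero_const_iff_dvd_one:
  "(\<exists>c. c \<noteq> 0 \<and> f = [:c:]) \<longleftrightarrow> f dvd (1 :: 'a::field poly)"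
proof
  assume "\<exists>c. c \<noteq> 0 \<and> f = [:c:]"
  then show "f dvd 1"
    by (auto simp: is_unit_const_poly_iff dvd_field_iff)
next
  assume "f dvd 1"
  then obtain c where "f = [:c:]" "c dvd 1"
    using is_unit_polyE by blast
  then show "\<exists>c. c \<noteq> 0 \<and> f = [:c:]" by auto
qed

text \<open>If \<open>\<pi>\<close> and \<open>h\<close> are associated, \<open>h'\<close> can be cancelled modulo \<open>h\<close>.  Cancelling it in
  \<open>h dvd h' (h / e)\<close>, where \<open>e\<close> generates the ideal \<open>(h, h')\<close>, shows that \<open>e\<close> is a unit.\<close>

lemma separable_if_unit_quotient:
  fixes h :: "'a::field poly"
  assumes "h \<noteq> 0" "h div pi_poly h dvd 1"
  shows "separable h"
proof -
  have "pi_poly h dvd h"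
    using pi_poly_spec[OF assms(1), of h] by simp
  then have "h dvd pi_poly h"
    using assms(2) by (metis dvd_mult_div_cancel dvd_refl mult_dvd_mono mult.right_neutral)
  then have dvd: "h dvd r" if "h dvd pderiv h * r" for r
    using that pi_poly_spec[OF assms(1)] dvd_trans by blast
  obtain c where c: "\<forall>i<(2::nat).
      (\<Sum>i<2::nat. c i * (if i = 0 then h else pderiv h)) dvd (if i = 0 then h else pderiv h)"
    using bezout_finite[of 2 "\<lambda>i. if i = 0 then h else pderiv h"] ..
  define e where "e = c 0 * h + c 1 * pderiv h"
  have e: "e dvd h" "e dvd pderiv h"
    using c[rule_format, of 0] c[rule_format, of 1] by (simp_all add: numeral_2_eq_2 e_def)
  obtain k l where kl: "h = e * k" "pderiv h = e * l"
    using e by (auto elim!: dvdE)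
  have "h dvd pderiv h * k"
    using kl by (metis dvd_triv_right mult.assoc mult.commute)
  then have "h dvd k" by (rule dvd)
  then have "e * k dvd 1 * k" "k \<noteq> 0"
    using kl(1) assms(1) by auto
  then have "e dvd 1"
    using dvd_times_right_cancel_iff by blast
  then obtain e' where "1 = e * e'" ..
  then have "(c 0 * e') * h + (c 1 * e') * pderiv h = 1"
    unfolding e_def by (simp add: algebra_simps)
  then show ?thesis
    unfolding separable_def by blast
qed

text \<open>Expand \<open>h dvd h' \<pi>\<close> for \<open>h = \<pi> g\<close>.  Thus \<open>\<pi> g' / g\<close> is a polynomial, which makes the
  commutators of \<open>w / g\<close> with the generators of \<open>A\<^sub>h\<close> polynomial as well.\<close>

lemma quotient_dvd_pi_pderiv:
  fixes h :: "'a::field poly"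
  assumes "h \<noteq> 0" and h: "h = pi_poly h * g"
  shows "g dvd pi_poly h * pderiv g"
proof -
  let ?q = "pi_poly h"
  have "h dvd pderiv h * ?q"
    using pi_poly_spec[OF assms(1), of ?q] by simp
  also have "pderiv h * ?q = (pderiv ?q) * (?q * g) + ?q * ?q * pderiv g"
    by (subst h) (simp add: pderiv_mult algebra_simps)
  finally have "?q * g dvd (pderiv ?q) * (?q * g) + ?q * ?q * pderiv g"
    using h by simp
  then have "?q * g dvd ?q * (?q * pderiv g)"
    by (simp add: dvd_add_right_iff mult.assoc)
  then show ?thesis
    using h assms(1) by (metis dvd_mult_cancel_left mult_eq_0_iff)
qed

context
  assumes char_pos: "CHAR('a::field) > 0"
begin

lemma of_nat_zero_iff: "(of_nat n :: 'a) = 0 \<longleftrightarrow> CHAR('a) dvd n"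
  by (rule of_nat_eq_0_iff_char_dvd)

lemma fact_nonzero: "(of_nat (fact (CHAR('a) - 1)) :: 'a) \<noteq> 0"
proof -
  have "\<not> CHAR('a) dvd fact (CHAR('a) - 1)"
    using prime_dvd_fact_iff[OF prime_CHAR_semidom[OF char_pos]] char_pos by auto
  then show ?thesis
    by (simp only: of_nat_zero_iff not_False_eq_True)
qed

lemma pochhammer_one: "(pochhammer 1 m :: 'a) = of_nat (fact m)"
  using pochhammer_of_nat[of 1 m, where ?'a = 'a] pochhammer_fact[of m, where ?'a = nat] by simp

lemma pderiv_power_char: "CHAR('a) dvd i \<Longrightarrow> pderiv ((f :: 'a poly) ^ i) = 0"
  by (cases i) (simp_all add: pderiv_power_Suc of_nat_zero_iff del: of_nat_Suc power_Suc)

lemma higher_pderiv_mult_const: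
  "pderiv (f :: 'a poly) = 0 \<Longrightarrow> (pderiv ^^ n) (f * g) = f * (pderiv ^^ n) g"
  by (induction n) (simp_all add: pderiv_mult)

text \<open>One of the factors \<open>n + 1, \<dots>, n + m\<close> is \<open>n + i\<close>, a multiple of the characteristic.\<close>

lemma pochhammer_char_zero:
  assumes "CHAR('a) dvd n + i" "0 < i" "i \<le> m"
  shows "(pochhammer (of_nat (Suc n)) m :: 'a) = 0"
proof -
  have "(of_nat (Suc n) :: 'a) + of_nat (i - 1) = of_nat (n + i)"
    using assms(2) by (simp flip: of_nat_add)
  also have "\<dots> = 0" using assms(1) by (simp only: of_nat_zero_iff)
  finally show ?thesis
    unfolding pochhammer_prod using assms(2,3)
    by (intro prod_zero bexI[of _ "i - 1"]) (auto simp: add_ac)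
qed

lemma pderiv_iterate_char: "(pderiv ^^ CHAR('a)) (f :: 'a poly) = 0"
proof (rule poly_eqI)
  fix n
  let ?i = "CHAR('a) - n mod CHAR('a)"
  have "n mod CHAR('a) < CHAR('a)" using char_pos by simp
  moreover have "n + ?i = n div CHAR('a) * CHAR('a) + CHAR('a)"
    using div_mult_mod_eq[of n "CHAR('a)"] calculation by linarith
  then have "CHAR('a) dvd n + ?i"
    by simp
  ultimately have "(pochhammer (of_nat (Suc n)) CHAR('a) :: 'a) = 0"
    by (intro pochhammer_char_zero[of n ?i]) auto
  then show "coeff ((pderiv ^^ CHAR('a)) f) n = coeff 0 n"
    by (simp add: coeff_higher_pderiv del: of_nat_Suc)
qed

lemma pderiv_iterate_pderiv: "(pderiv ^^ (CHAR('a) - 1)) (pderiv (f :: 'a poly)) = 0"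
  using pderiv_iterate_char[of f] char_pos
  by (metis Suc_pred' funpow_Suc_right comp_apply)

lemma pderiv_iterate_const: "pderiv ((pderiv ^^ (CHAR('a) - 1)) (f :: 'a poly)) = 0"
  using pderiv_iterate_char[of f] char_pos
  by (metis Suc_pred' funpow.simps(2) comp_apply)

text \<open>A polynomial fails to be a derivative exactly by its coefficients at \<open>x\<^sup>m\<close> with \<open>p dvd m + 1\<close>,
  and these are the ones that survive \<open>p - 1\<close> differentiations, with the factor \<open>(p - 1)!\<close>.\<close>

lemma antiderivative:
  assumes "(pderiv ^^ (CHAR('a) - 1)) (r :: 'a poly) = 0"
  obtains g where "r = pderiv g"
proof -
  have zero: "coeff r m = 0" if m: "CHAR('a) dvd Suc m" for m
  proof -
    define n where "n = Suc m - CHAR('a)"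
    have n: "CHAR('a) dvd n" "n + (CHAR('a) - 1) = m"
      using m char_pos dvd_imp_le[OF m] by (auto simp: n_def)
    have "pochhammer (of_nat (Suc n)) (CHAR('a) - 1) * coeff r m = 0"
      using arg_cong[OF assms, of "\<lambda>f. coeff f n"] n by (simp add: coeff_higher_pderiv)
    moreover have "(of_nat (Suc n) :: 'a) = 1"
      using n(1) of_nat_zero_iff[of n] by simp
    moreover have "(pochhammer 1 (CHAR('a) - 1) :: 'a) \<noteq> 0"
      using fact_nonzero pochhammer_one by simp
    ultimately show ?thesis by simp
  qed
  define c where "c m = (if m = 0 then 0 else coeff r (m - 1) / of_nat m)" for m
  have "c m = 0" if "m > Suc (Polynomial.degree r)" for m
    using that coeff_eq_0[of r "m - 1"] by (auto simp: c_def)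
  then have c: "coeff (Abs_poly c) = c"
    by (intro coeff_Abs_poly[of "Suc (Polynomial.degree r)"]) auto
  have "coeff (pderiv (Abs_poly c)) m = coeff r m" for m
  proof (cases "CHAR('a) dvd Suc m")
    case True
    then show ?thesis
      using zero of_nat_zero_iff[of "Suc m"] by (simp add: coeff_pderiv c)
  next
    case False
    then have "(of_nat (Suc m) :: 'a) \<noteq> 0"
      using of_nat_zero_iff by blast
    then show ?thesis
      by (simp add: coeff_pderiv c c_def del: of_nat_Suc)
  qed
  then have "r = pderiv (Abs_poly c)"
    by (intro poly_eqI) simp
  then show thesis by (rule that)
qed

text \<open>In the Leibniz expansion only those terms are not divisible by \<open>h\<close> in which the \<open>m\<close>
  derivatives hit the \<open>m\<close> factors \<open>h\<close> once each.\<close>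

lemma higher_pderiv_mult_power:
  "\<exists>s. (pderiv ^^ m) (r * h ^ m) = of_nat (fact m) * r * pderiv h ^ m + (h :: 'a poly) * s"
proof (induction m arbitrary: r)
  case 0
  show ?case by (auto intro: exI[of _ 0])
next
  case (Suc m)
  let ?r = "pderiv r * h + of_nat (Suc m) * r * pderiv h"
  obtain s where s: "(pderiv ^^ m) (?r * h ^ m) = of_nat (fact m) * ?r * pderiv h ^ m + h * s"
    using Suc by blast
  have "pderiv (r * h ^ Suc m) = ?r * h ^ m"
    by (simp add: pderiv_mult pderiv_power_Suc algebra_simps of_nat_poly del: of_nat_Suc power_Suc)
       (simp add: algebra_simps)
  then have "(pderiv ^^ Suc m) (r * h ^ Suc m) = of_nat (fact m) * ?r * pderiv h ^ m + h * s"
    by (simp only: funpow_Suc_right comp_apply s)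
  also have "\<dots> = of_nat (fact (Suc m)) * r * pderiv h ^ Suc m + h * (of_nat (fact m) * pderiv r * pderiv h ^ m + s)"
    by (simp add: algebra_simps)
  finally show ?case by blast
qed

text \<open>The obstruction for \<open>r h\<^sup>p\<^sup>-\<^sup>1\<close> to be a derivative.  It is linear over \<open>F[x\<^sup>p]\<close> and equals, up
  to the unit \<open>(p - 1)!\<close>, the coefficient of \<open>x\<^sup>p\<^sup>-\<^sup>1\<close> of \<open>r h\<^sup>p\<^sup>-\<^sup>1\<close> over \<open>F[x\<^sup>p]\<close>.  It is also the
  value of \<open>D\<^sub>r\<close> at the central element \<open>h\<^sup>p y\<^sup>p\<close>, hence an invariant of \<open>D\<^sub>r\<close> modulo inner
  derivations.\<close>

definition trace_h :: "'a poly \<Rightarrow> 'a poly \<Rightarrow> 'a poly" where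
  "trace_h h r = (pderiv ^^ (CHAR('a) - 1)) (r * h ^ (CHAR('a) - 1))"

lemma trace_h_const: "pderiv (trace_h h r) = 0"
  unfolding trace_h_def by (rule pderiv_iterate_const)

lemma trace_h_linear: "pderiv u = 0 \<Longrightarrow> trace_h h (u * r) = u * trace_h h r"
  unfolding trace_h_def by (simp add: mult.assoc higher_pderiv_mult_const)

lemma trace_h_add: "trace_h h (r + s) = trace_h h r + trace_h h s"
  unfolding trace_h_def by (simp add: distrib_right higher_pderiv_add)

lemma trace_h_uminus: "trace_h h (- r) = - trace_h h r"
  using trace_h_linear[of "- 1" h r] by (simp add: pderiv_minus)

lemma trace_h_sum: "trace_h h (\<Sum>i\<in>A. f i) = (\<Sum>i\<in>A. trace_h h (f i))"
  unfolding trace_h_def by (simp only: sum_distrib_right higher_pderiv_sum)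

lemma trace_h_mult: "trace_h h (h * s) = h ^ CHAR('a) * (pderiv ^^ (CHAR('a) - 1)) s"
proof -
  have "h * s * h ^ (CHAR('a) - 1) = h ^ CHAR('a) * s"
    using power_minus_mult[OF char_pos, of h] by (simp add: mult_ac del: One_nat_def)
  then show ?thesis
    unfolding trace_h_def by (simp only: higher_pderiv_mult_const pderiv_power_char dvd_refl)
qed

lemma trace_h_mult_pderiv: "trace_h h (h * pderiv g) = 0"
  by (simp add: trace_h_mult pderiv_iterate_pderiv del: One_nat_def)

lemma separable_dvd_cancel:
  fixes h :: "'a poly"
  assumes "separable h" "h dvd r * pderiv h ^ m"
  shows "h dvd r"
  using assms(2)
proof (induction m)
  case (Suc m)
  obtain u v where uv: "u * h + v * pderiv h = 1"
    using assms(1) by (auto simp: separable_def)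
  have "r * pderiv h ^ m = (r * pderiv h ^ m) * (u * h + v * pderiv h)"
    using uv by simp
  also have "\<dots> = (r * pderiv h ^ m * u) * h + v * (r * pderiv h ^ Suc m)"
    by (simp add: algebra_simps)
  also have "h dvd \<dots>"
    using Suc.prems by (intro dvd_add) auto
  finally show ?case by (rule Suc.IH)
qed simp

lemma fact_poly_const: "(of_nat (fact (CHAR('a) - 1)) :: 'a poly) = [:of_nat (fact (CHAR('a) - 1)):]"
  by (simp add: of_nat_poly)

text \<open>The heart of the separable case: the polynomials of trace zero are exactly those \<open>r\<close> for
  which \<open>D\<^sub>r\<close> is inner.  Modulo \<open>h\<close> the trace is \<open>(p - 1)! r h'\<^sup>p\<^sup>-\<^sup>1\<close>, so \<open>h dvd r\<close> by
  separability; for \<open>r = h t\<close> the trace is \<open>h\<^sup>p\<close> times the \<open>(p - 1)\<close>-st derivative of \<open>t\<close>.\<close>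

lemma trace_h_zero_imp:
  fixes h :: "'a poly"
  assumes sep: "separable h" and "h \<noteq> 0" and zero: "trace_h h r = 0"
  obtains g where "r = h * pderiv g"
proof -
  let ?m = "CHAR('a) - 1"
  obtain s where "0 = of_nat (fact ?m) * r * pderiv h ^ ?m + h * s"
    using higher_pderiv_mult_power[of ?m r h] zero by (auto simp: trace_h_def)
  then have "of_nat (fact ?m) * r * pderiv h ^ ?m = h * (- s)"
    by (simp add: eq_neg_iff_add_eq_0)
  then have "h dvd of_nat (fact ?m) * (r * pderiv h ^ ?m)"
    by (metis dvd_triv_left mult.assoc)
  then have "h dvd r * pderiv h ^ ?m"
    by (simp add: fact_poly_const dvd_smult_iff fact_nonzero del: One_nat_def)
  then have "h dvd r" by (rule separable_dvd_cancel[OF sep])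
  then obtain t where t: "r = h * t" ..
  have "(pderiv ^^ ?m) t = 0"
    using zero assms(2) by (simp add: t trace_h_mult)
  then obtain g where "t = pderiv g" by (rule antiderivative)
  with t show thesis using that by blast
qed

text \<open>Such a \<open>d\<close> also divides the \<open>(p - 1)\<close>-st derivative of \<open>h\<^sup>p\<^sup>-\<^sup>1\<close>, which is
  \<open>(p - 1)! h'\<^sup>p\<^sup>-\<^sup>1\<close> modulo \<open>h\<close> and hence invertible modulo \<open>h\<close>.  This lowers the exponent in
  \<open>d dvd h\<^sup>j\<close> step by step to \<open>0\<close>.\<close>

lemma separable_const_dvd_power:
  fixes h :: "'a poly"
  assumes sep: "separable h" and d: "pderiv d = 0" "d dvd h ^ (CHAR('a) - 1)"
  shows "d dvd 1"
proof -
  let ?m = "CHAR('a) - 1"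
  obtain k where k: "h ^ ?m = d * k" using d(2) ..
  obtain s where "(pderiv ^^ ?m) (1 * h ^ ?m) = of_nat (fact ?m) * 1 * pderiv h ^ ?m + h * s"
    using higher_pderiv_mult_power by blast
  then have 1: "d dvd of_nat (fact ?m) * pderiv h ^ ?m + h * s"
    using higher_pderiv_mult_const[OF d(1), of ?m k] k by (metis dvd_triv_left mult_1 mult.right_neutral)
  obtain u v where uv: "u * h + v * pderiv h = 1"
    using sep by (auto simp: separable_def)
  have "d dvd h ^ j" if "j \<le> ?m" for j
    using that
  proof (induction j rule: inc_induct)
    case base
    show ?case by (rule d(2))
  next
    case (step j)
    have "d dvd h ^ j * (of_nat (fact ?m) * pderiv h ^ ?m + h * s)"
      using 1 by (rule dvd_mult)
    then have "d dvd h ^ j * (of_nat (fact ?m) * pderiv h ^ ?m) + h ^ Suc j * s"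
      by (simp add: algebra_simps)
    then have "d dvd of_nat (fact ?m) * (h ^ j * pderiv h ^ ?m)"
      using step.IH by (simp add: dvd_add_left_iff mult.left_commute)
    then have 2: "d dvd h ^ j * pderiv h ^ ?m"
      by (simp add: fact_poly_const dvd_smult_iff fact_nonzero del: One_nat_def)
    have "d dvd h ^ j * pderiv h ^ i" if "i \<le> ?m" for i
      using that
    proof (induction i rule: inc_induct)
      case base
      show ?case by (rule 2)
    next
      case (step i)
      have "h ^ j * pderiv h ^ i = h ^ j * pderiv h ^ i * (u * h + v * pderiv h)"
        using uv by simp
      also have "\<dots> = u * pderiv h ^ i * h ^ Suc j + v * (h ^ j * pderiv h ^ Suc i)"
        by (simp add: algebra_simps)
      also have "d dvd \<dots>"
        using dvd_mult[OF step.IH] dvd_mult[OF \<open>d dvd h ^ Suc j\<close>] by (rule dvd_add[rotated])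
      finally show ?case .
    qed
    from this[of 0] show ?case by simp
  qed
  from this[of 0] show ?thesis by simp
qed

lemma pderiv_Rp: "(f :: 'a poly) \<in> Rp \<Longrightarrow> pderiv f = 0"
  by (auto simp: Rp_def pderiv_pcompose pderiv_monom)

text \<open>A divisor of \<open>h\<close> with vanishing derivative divides \<open>h'\<close> too.\<close>

lemma rho_poly_separable:
  fixes h :: "'a poly"
  assumes "separable h"
  shows "rho_poly h = 1"
  unfolding rho_poly_def
proof (rule the_equality)
  have one: "(1 :: 'a poly) \<in> Rp"
    unfolding Rp_def by (rule range_eqI[of _ _ 1]) (simp add: one_pCons)
  have unit: "f dvd 1" if f: "f \<in> Rp" "f dvd h" for f
  proof -
    obtain k where "h = f * k" using f(2) ..
    then have "f dvd pderiv h"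
      using pderiv_Rp[OF f(1)] by (simp add: pderiv_mult)
    then show ?thesis
      using f(2) assms unfolding separable_def by (metis dvd_add dvd_mult)
  qed
  then show "lead_coeff 1 = 1 \<and> (1 :: 'a poly) \<in> Rp \<and> 1 dvd h \<and>
      (\<forall>f\<in>Rp. f dvd h \<longrightarrow> Polynomial.degree f \<le> Polynomial.degree 1)"
    using one by (auto elim!: is_unit_polyE dest!: unit)
  fix g
  assume g: "lead_coeff g = 1 \<and> g \<in> Rp \<and> g dvd h \<and>
      (\<forall>f\<in>Rp. f dvd h \<longrightarrow> Polynomial.degree f \<le> Polynomial.degree g)"
  then have "g dvd 1" using unit by blast
  then show "g = 1"
    using g monic_dvd_antisym[of g 1] by simp
qed

lemma monom_eq_power: "monom (1 :: 'a) n = [:0, 1:] ^ n"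
  by (simp add: monom_altdef)

text \<open>The monomials \<open>x\<^sup>p\<^sup>-\<^sup>1\<^sup>-\<^sup>i\<close> are dual to the \<open>x\<^sup>j\<close>, for \<open>i, j < p\<close>, with respect to the trace
  form.\<close>

lemma higher_pderiv_monomial:
  assumes "i < CHAR('a)" "j < CHAR('a)"
  shows "(pderiv ^^ (CHAR('a) - 1)) ([:0, 1:] ^ (CHAR('a) - 1 - i) * [:0, 1:] ^ j :: 'a poly) =
    (if i = j then of_nat (fact (CHAR('a) - 1)) else 0)"
proof -
  let ?m = "CHAR('a) - 1"
  define n where "n = ?m - i + j"
  have "[:0, 1:] ^ (?m - i) * [:0, 1:] ^ j = monom (1 :: 'a) n"
    by (simp add: n_def monom_eq_power power_add)
  moreover consider "n < ?m" | "n = ?m" | "n \<ge> CHAR('a)" "n - ?m < CHAR('a)"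
    using assms by (fastforce simp: n_def)
  then have "(pderiv ^^ ?m) (monom (1 :: 'a) n) = (if i = j then of_nat (fact ?m) else 0)"
  proof cases
    case 1
    then have "i \<noteq> j" using assms by (auto simp: n_def)
    with 1 show ?thesis
      by (intro poly_eqI) (simp add: coeff_higher_pderiv del: One_nat_def)
  next
    case 2
    then have "i = j" using assms by (auto simp: n_def)
    have "coeff ((pderiv ^^ ?m) (monom 1 n)) k = coeff [:of_nat (fact ?m) :: 'a:] k" for k
      using 2 by (cases k) (simp_all add: coeff_higher_pderiv pochhammer_one del: One_nat_def)
    with \<open>i = j\<close> show ?thesis
      by (simp add: fact_poly_const poly_eq_iff del: One_nat_def)
  next
    case 3
    then have ne: "i \<noteq> j" using assms by (auto simp: n_def)
    have "(pochhammer (of_nat (Suc k)) ?m :: 'a) = 0" if "n = k + ?m" for k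
      using 3 that by (intro pochhammer_char_zero[of _ "CHAR('a) - k"]) auto
    then show ?thesis
      using ne by (intro poly_eqI)
        (auto simp: coeff_higher_pderiv simp del: One_nat_def of_nat_Suc)
  qed
  ultimately show ?thesis by simp
qed

text \<open>By this duality the trace picks out of \<open>q h\<^sup>p\<^sup>-\<^sup>1\<close> the Bezout sum \<open>d\<close> of the coefficients of
  \<open>h\<^sup>p\<^sup>-\<^sup>1\<close>, and \<open>d\<close> is a constant because it divides \<open>h\<^sup>p\<^sup>-\<^sup>1\<close>.\<close>

lemma trace_h_q_breve:
  fixes h :: "'a poly"
  assumes sep: "separable h" and "h \<noteq> 0" and q: "is_q_breve h q"
  shows "trace_h h q dvd 1"
proof -
  let ?p = "CHAR('a)" and ?m = "CHAR('a) - 1"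
  from q obtain hs d qs where hs: "\<And>i. i < ?p \<Longrightarrow> hs i \<in> Rp"
    and hsum: "h ^ ?m = (\<Sum>i<?p. hs i * [:0, 1:] ^ i)"
    and gcd: "gcd_Rp (hs ` {..<?p}) d"
    and qs: "\<And>i. i < ?p \<Longrightarrow> qs i \<in> Rp"
    and d: "d = (\<Sum>i<?p. qs i * hs i)"
    and qsum: "q = - (\<Sum>i<?p. qs i * [:0, 1:] ^ (?m - i))"
    unfolding is_q_breve_def by blast
  have "trace_h h q = - (\<Sum>i<?p. trace_h h (qs i * [:0, 1:] ^ (?m - i)))"
    unfolding qsum trace_h_uminus trace_h_sum ..
  also have "\<dots> = - (\<Sum>i<?p. qs i * trace_h h ([:0, 1:] ^ (?m - i)))"
    by (simp add: trace_h_linear pderiv_Rp qs)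
  also have "\<dots> = - (\<Sum>i<?p. qs i * (\<Sum>j<?p. hs j * (if i = j then of_nat (fact ?m) else 0)))"
  proof -
    have "trace_h h ([:0, 1:] ^ (?m - i)) = (\<Sum>j<?p. hs j * (if i = j then of_nat (fact ?m) else 0))"
      if "i < ?p" for i
    proof -
      have "[:0, 1:] ^ (?m - i) * h ^ ?m = (\<Sum>j<?p. hs j * ([:0, 1:] ^ (?m - i) * [:0, 1:] ^ j))"
        by (simp only: hsum sum_distrib_left mult.left_commute)
      then have "trace_h h ([:0, 1:] ^ (?m - i)) =
          (\<Sum>j<?p. (pderiv ^^ ?m) (hs j * ([:0, 1:] ^ (?m - i) * [:0, 1:] ^ j)))"
        unfolding trace_h_def by (simp only: higher_pderiv_sum)
      also have "\<dots> = (\<Sum>j<?p. hs j * (if i = j then of_nat (fact ?m) else 0))"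
        using that hs by (intro sum.cong refl)
          (simp only: higher_pderiv_mult_const pderiv_Rp higher_pderiv_monomial lessThan_iff)
      finally show ?thesis .
    qed
    then show ?thesis by simp
  qed
  also have "\<dots> = - (of_nat (fact ?m) * d)"
    by (simp add: d sum_distrib_left if_distrib sum.delta mult_ac cong: if_cong)
  finally have tr: "trace_h h q = - (of_nat (fact ?m) * d)" .
  have "d dvd hs i" if "i < ?p" for i
  proof -
    have "dvd_Rp d (hs i)"
      using gcd that by (simp add: gcd_Rp_def)
    then show ?thesis by (auto simp: dvd_Rp_def)
  qed
  then have "d dvd h ^ ?m"
    unfolding hsum by (intro dvd_sum) auto
  moreover have "pderiv d = 0"
    using gcd by (simp add: pderiv_Rp gcd_Rp_def)
  ultimately have "d dvd 1"
    using separable_const_dvd_power[OF sep] by blast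
  moreover have "(of_nat (fact ?m) :: 'a poly) dvd 1"
    using fact_nonzero by (simp add: fact_poly_const is_unit_const_poly_iff dvd_field_iff del: One_nat_def)
  ultimately show ?thesis
    unfolding tr using is_unit_mult_iff by auto
qed

text \<open>Sort the terms of \<open>h\<^sup>p\<^sup>-\<^sup>1\<close> by their exponents modulo \<open>p\<close>, and transport a Bezout identity from
  \<open>F[x]\<close> to \<open>F[x\<^sup>p]\<close>.\<close>

lemma is_q_breve_exists: "\<exists>q. is_q_breve (h :: 'a poly) q"
proof -
  let ?p = "CHAR('a)" and ?m = "CHAR('a) - 1"
  let ?x = "monom 1 CHAR('a) :: 'a poly"
  define f where "f = h ^ ?m"
  define g where "g i = (\<Sum>k\<le>Polynomial.degree f. monom (coeff f (k * ?p + i)) k)" for i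
  define hs where "hs i = pcompose (g i) ?x" for i
  have monom_x: "pcompose (monom c k) ?x = monom c (k * ?p)" for c k
    by (induction k) (simp_all add: monom_0 monom_Suc[of c] pcompose_pCons mult_monom)
  have "(\<Sum>i<?p. hs i * [:0, 1:] ^ i) = (\<Sum>i<?p. \<Sum>k\<le>Polynomial.degree f. monom (coeff f (k * ?p + i)) (k * ?p + i))"
    unfolding hs_def g_def
    by (simp add: pcompose_sum monom_x sum_distrib_right mult_monom flip: monom_eq_power)
  also have "\<dots> = (\<Sum>(k, i)\<in>{..Polynomial.degree f} \<times> {..<?p}. monom (coeff f (k * ?p + i)) (k * ?p + i))"
    by (subst sum.swap) (simp add: sum.cartesian_product)
  also have "\<dots> = (\<Sum>n<Suc (Polynomial.degree f) * ?p. monom (coeff f n) n)"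
  proof (rule sum.reindex_bij_witness[where i = "\<lambda>n. (n div ?p, n mod ?p)" and j = "\<lambda>(k, i). k * ?p + i"])
    fix n assume "n \<in> {..<Suc (Polynomial.degree f) * ?p}"
    then have "n div ?p < Suc (Polynomial.degree f)"
      by (simp add: less_mult_imp_div_less)
    then show "(n div ?p, n mod ?p) \<in> {..Polynomial.degree f} \<times> {..<?p}"
      using char_pos by auto
  next
    fix a assume "a \<in> {..Polynomial.degree f} \<times> {..<?p}"
    then obtain k i where a: "a = (k, i)" "k \<le> Polynomial.degree f" "i < ?p" by auto
    then have "k * ?p + i < Suc k * ?p" by simp
    also have "\<dots> \<le> Suc (Polynomial.degree f) * ?p"
      using a(2) by (intro mult_le_mono1) simp
    finally show "(case a of (k, i) \<Rightarrow> k * ?p + i) \<in> {..<Suc (Polynomial.degree f) * ?p}"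
      by (simp add: a)
  qed auto
  also have "\<dots> = (\<Sum>n\<le>Polynomial.degree f. monom (coeff f n) n)"
  proof (rule sum.mono_neutral_right)
    have "Suc (Polynomial.degree f) * 1 \<le> Suc (Polynomial.degree f) * ?p"
      using char_pos by (intro mult_le_mono2) simp
    then show "{..Polynomial.degree f} \<subseteq> {..<Suc (Polynomial.degree f) * ?p}"
      by auto
  qed (auto simp: coeff_eq_0)
  also have "\<dots> = f" by (rule poly_as_sum_of_monoms)
  finally have hsum: "f = (\<Sum>i<?p. hs i * [:0, 1:] ^ i)" ..
  obtain c where "\<forall>i<?p. (\<Sum>i<?p. c i * g i) dvd g i"
    using bezout_finite by blast
  then obtain e where e: "e = (\<Sum>i<?p. c i * g i)" "\<And>i. i < ?p \<Longrightarrow> e dvd g i"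
    by blast
  define d where "d = pcompose e ?x"
  define qs where "qs i = pcompose (c i) ?x" for i
  have RpI: "pcompose k ?x \<in> Rp" for k
    unfolding Rp_def by blast
  have d: "d = (\<Sum>i<?p. qs i * hs i)"
    unfolding d_def e(1) qs_def hs_def by (simp add: pcompose_sum pcompose_mult)
  have "gcd_Rp (hs ` {..<?p}) d"
    unfolding gcd_Rp_def
  proof (intro conjI ballI impI)
    show "d \<in> Rp" by (simp add: d_def RpI)
    fix k assume "k \<in> hs ` {..<?p}"
    then obtain i where i: "i < ?p" "k = hs i" by auto
    obtain l where "g i = e * l" using e(2)[OF i(1)] ..
    then show "dvd_Rp d k"
      unfolding dvd_Rp_def i(2) hs_def d_def using RpI by (auto simp: pcompose_mult)
  next
    fix k assume k: "k \<in> Rp" "\<forall>g\<in>hs ` {..<?p}. dvd_Rp k g"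
    then have "\<forall>i\<in>{..<?p}. \<exists>l. hs i = k * pcompose l ?x"
      unfolding dvd_Rp_def Rp_def by blast
    then obtain l where l: "\<And>i. i < ?p \<Longrightarrow> hs i = k * pcompose (l i) ?x"
      by (metis lessThan_iff)
    have "d = k * pcompose (\<Sum>i<?p. c i * l i) ?x"
      by (simp add: d l qs_def pcompose_sum pcompose_mult sum_distrib_left mult.left_commute)
    then show "dvd_Rp k d"
      unfolding dvd_Rp_def using RpI by blast
  qed
  then have "is_q_breve h (- (\<Sum>i<?p. qs i * [:0, 1:] ^ (?m - i)))"
    unfolding is_q_breve_def using d hsum RpI
    by (intro exI[of _ hs] exI[of _ d] exI[of _ qs]) (simp add: f_def hs_def qs_def)
  then show ?thesis ..
qed

end

section \<open>Modules over the Weyl algebra\<close>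

lemma weyl_const_0 [simp]: "weyl_const 0 = (0 :: 'a::field weyl)"
  by transfer (simp add: weyl_rel_def weyl_ideal_def two_sided_ideal.zero)

lemma weyl_const_1 [simp]: "weyl_const 1 = (1 :: 'a::field weyl)"
  by transfer (simp add: weyl_rel_def weyl_ideal_def two_sided_ideal.zero)

lemma weyl_const_add: "weyl_const (c + d) = weyl_const c + (weyl_const d :: 'a::field weyl)"
  by transfer (simp add: weyl_rel_def weyl_ideal_def two_sided_ideal.zero single_add)

lemma weyl_const_mult: "weyl_const (c * d) = weyl_const c * (weyl_const d :: 'a::field weyl)"
  by transfer (simp add: weyl_rel_def weyl_ideal_def two_sided_ideal.zero mult_single)

lemma weyl_const_minus: "weyl_const (- c) = - (weyl_const c :: 'a::field weyl)"
  using weyl_const_add[of "- c" c] by (simp add: eq_neg_iff_add_eq_0)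

lemma weyl_rel_refl: "weyl_rel f f"
  by (simp add: weyl_rel_def weyl_ideal_def two_sided_ideal.zero)

lemma y_x_relation: "weyl_y * weyl_x = weyl_x * weyl_y + (1 :: 'a::field weyl)"
proof -
  have "weyl_rel (free_gen GY * free_gen GX) (free_gen GX * free_gen GY + (1 :: 'a weyl_free))"
    unfolding weyl_rel_def weyl_ideal_def
    by (rule two_sided_ideal.base) simp
  then show ?thesis
    by transfer
qed

lemma free_const_commute:
  fixes f :: "'a::field weyl_free"
  shows "Poly_Mapping.single 0 c * f = f * Poly_Mapping.single 0 c"
proof (induction f rule: weyl_free_induct)
  case (single w d)
  then show ?case by (simp add: mult_single mult.commute)
qed (simp_all add: algebra_simps)

lemma weyl_const_commute: "weyl_const c * a = a * weyl_const (c :: 'a::field)"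
  by transfer (simp add: free_const_commute weyl_rel_refl)

lemma weyl_const_left_commute: "a * (weyl_const c * b) = weyl_const c * (a * b)"
  by (metis mult.assoc weyl_const_commute)

lemma weyl_word: "abs_weyl (Poly_Mapping.single (Word (g # ws)) c) =
   (case g of GX \<Rightarrow> weyl_x | GY \<Rightarrow> weyl_y) * abs_weyl (Poly_Mapping.single (Word ws) (c :: 'a::field))"
proof -
  have "Poly_Mapping.single (Word (g # ws)) c = free_gen g * Poly_Mapping.single (Word ws) c"
    by (simp add: free_gen_def mult_single plus_free_monoid_def)
  then show ?thesis
    by (cases g) (simp_all add: weyl_x_def weyl_y_def times_weyl.abs_eq)
qed

lemma weyl_induct [case_names const x y add]:
  fixes a :: "'a::field weyl"
  assumes const: "\<And>c. P (weyl_const c)"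
    and x: "\<And>a. P a \<Longrightarrow> P (weyl_x * a)"
    and y: "\<And>a. P a \<Longrightarrow> P (weyl_y * a)"
    and add: "\<And>a b. P a \<Longrightarrow> P b \<Longrightarrow> P (a + b)"
  shows "P a"
proof (rule weyl.abs_induct)
  fix f :: "'a weyl_free"
  show "P (abs_weyl f)"
  proof (induction f rule: weyl_free_induct)
    case zero
    show ?case using const[of 0] by (simp add: zero_weyl_def)
  next
    case (single w c)
    show ?case
    proof (induction w)
      case (Word ws)
      show ?case
      proof (induction ws)
        case Nil
        then show ?case
          using const[of c] by (simp add: weyl_const_def zero_free_monoid_def)
      next
        case (Cons g ws)
        then show ?case
          by (cases g) (simp_all add: weyl_word x y)
      qed
    qed
  next
    case (add f g)
    then show ?case
      using assms(4) by (simp flip: plus_weyl.abs_eq)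
  qed
qed

text \<open>The universal property of \<open>A\<^sub>1\<close> for representations.  It is used twice: a faithful module
  gives the normal form, and modules over the dual numbers give derivations.\<close>

locale weyl_module = vector_space sc
  for sc :: "'a::field \<Rightarrow> 'm::ab_group_add \<Rightarrow> 'm" +
  fixes X Y :: "'m \<Rightarrow> 'm"
  assumes X_add: "X (m + n) = X m + X n" and X_sc: "X (sc c m) = sc c (X m)"
    and Y_add: "Y (m + n) = Y m + Y n" and Y_sc: "Y (sc c m) = sc c (Y m)"
    and rel: "Y (X m) = X (Y m) + m"
begin

definition gen :: "weyl_gen \<Rightarrow> 'm \<Rightarrow> 'm" where
  "gen g = (case g of GX \<Rightarrow> X | GY \<Rightarrow> Y)"

definition wact :: "'a weyl_free \<Rightarrow> 'm \<Rightarrow> 'm" where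
  "wact f m = (\<Sum>w\<in>Poly_Mapping.keys f. sc (Poly_Mapping.lookup f w) (foldr gen (letters w) m))"

lemma word_add: "foldr gen ws (m + n) = foldr gen ws m + foldr gen ws n"
  by (induction ws) (simp_all add: gen_def X_add Y_add split: weyl_gen.splits)

lemma word_sc: "foldr gen ws (sc c m) = sc c (foldr gen ws m)"
  by (induction ws) (simp_all add: gen_def X_sc Y_sc split: weyl_gen.splits)

lemma wact_superset:
  assumes "finite S" "Poly_Mapping.keys f \<subseteq> S"
  shows "wact f m = (\<Sum>w\<in>S. sc (Poly_Mapping.lookup f w) (foldr gen (letters w) m))"
  unfolding wact_def using assms
  by (intro sum.mono_neutral_left) (auto simp: in_keys_iff)

lemma wact_add: "wact (f + g) m = wact f m + wact g m"
proof -
  let ?S = "Poly_Mapping.keys f \<union> Poly_Mapping.keys g"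
  have "Poly_Mapping.keys (f + g) \<subseteq> ?S"
    by (rule Poly_Mapping.keys_add)
  then show ?thesis
    by (simp add: wact_superset[of ?S] lookup_add scale_left_distrib sum.distrib)
qed

lemma wact_zero [simp]: "wact 0 m = 0"
  by (simp add: wact_def)

lemma wact_diff: "wact (f - g) m = wact f m - wact g m"
  using wact_add[of "f - g" g m] by simp

lemma wact_single: "wact (Poly_Mapping.single w c) m = sc c (foldr gen (letters w) m)"
  by (simp add: wact_superset[of "{w}"])

lemma wact_add_right: "wact f (m + n) = wact f m + wact f n"
  by (simp add: wact_def word_add scale_right_distrib sum.distrib)

lemma wact_zero_right [simp]: "wact f 0 = 0"
  using wact_add_right[of f 0 0] by simp

lemma wact_mult: "wact (f * g) m = wact f (wact g m)"
proof (induction f rule: weyl_free_induct)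
  case (single w c)
  show ?case
  proof (induction g rule: weyl_free_induct)
    case (single v d)
    show ?case
      by (simp add: mult_single wact_single word_sc)
  next
    case (add f g)
    then show ?case
      by (simp add: distrib_left wact_add wact_add_right)
  qed simp
next
  case (add f g)
  then show ?case
    by (simp add: distrib_right wact_add)
qed simp

lemma wact_gen: "wact (free_gen g) m = gen g m"
  by (simp add: free_gen_def wact_single)

lemma wact_ideal: "f \<in> weyl_ideal \<Longrightarrow> wact f m = 0"
  unfolding weyl_ideal_def
proof (induction f arbitrary: m rule: two_sided_ideal.induct)
  case (base s)
  have "wact 1 m = m"
    using wact_single[of 0 1 m] by simp
  then show ?case
    using base by (simp add: wact_diff wact_mult wact_gen) (simp add: gen_def rel)
qed (simp_all add: wact_add wact_mult)

definition act :: "'a weyl \<Rightarrow> 'm \<Rightarrow> 'm" where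
  "act a = wact (rep_weyl a)"

lemma act_abs: "act (abs_weyl f) = wact f"
proof
  fix m
  have "weyl_rel (rep_weyl (abs_weyl f)) f"
    by (metis Quotient3_weyl Quotient3_rep_abs weyl_rel_refl)
  then show "act (abs_weyl f) m = wact f m"
    using wact_ideal wact_diff unfolding act_def weyl_rel_def by (metis eq_iff_diff_eq_0)
qed

lemma act_simps:
  "act (a + b) m = act a m + act b m" "act (a * b) m = act a (act b m)"
  "act (weyl_const c) m = sc c m" "act weyl_x m = X m" "act weyl_y m = Y m"
proof -
  obtain f g where ab: "a = abs_weyl f" "b = abs_weyl g"
    by (metis Quotient3_weyl Quotient3_abs_rep)
  show "act (a + b) m = act a m + act b m" "act (a * b) m = act a (act b m)"
    by (simp_all add: ab act_abs plus_weyl.abs_eq times_weyl.abs_eq wact_add wact_mult)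
  show "act (weyl_const c) m = sc c m"
    by (simp add: weyl_const_def act_abs wact_single)
  show "act weyl_x m = X m" "act weyl_y m = Y m"
    by (simp_all add: weyl_x_def weyl_y_def act_abs wact_gen gen_def)
qed

end

text \<open>Let \<open>x\<close> and \<open>y\<close> act on \<open>A\<^sub>1[\<epsilon>]\<close> with \<open>\<epsilon>\<^sup>2 = 0\<close> as \<open>x + \<epsilon>u\<close> and \<open>y + \<epsilon>v\<close>; the hypothesis says that
  this is a representation.  Then \<open>a\<close> acts as \<open>a + \<epsilon> E(a)\<close>, and multiplicativity of the action is
  the Leibniz rule.\<close>

lemma weyl_derivation_exists:
  fixes u v :: "'a::field weyl"
  assumes uv: "v * weyl_x - weyl_x * v + (weyl_y * u - u * weyl_y) = 0"
  obtains E where "E weyl_x = u" "E weyl_y = v" "\<And>c. E (weyl_const c) = 0"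
    "\<And>a b. E (a + b) = E a + E b" "\<And>a b. E (a * b) = E a * b + a * E b"
proof -
  interpret M: weyl_module "\<lambda>c m. (weyl_const c * fst m, weyl_const c * snd m)"
    "\<lambda>m. (weyl_x * fst m, weyl_x * snd m + u * fst m)"
    "\<lambda>m. (weyl_y * fst m, weyl_y * snd m + v * fst m)"
  proof unfold_locales
    fix m :: "'a weyl \<times> 'a weyl"
    have "weyl_y * (u * fst m) + v * (weyl_x * fst m) = weyl_x * (v * fst m) + u * (weyl_y * fst m)"
      using arg_cong[OF uv, of "\<lambda>t. t * fst m"] by (simp add: algebra_simps)
    then show "(weyl_y * fst (weyl_x * fst m, weyl_x * snd m + u * fst m),
        weyl_y * snd (weyl_x * fst m, weyl_x * snd m + u * fst m) +
          v * fst (weyl_x * fst m, weyl_x * snd m + u * fst m)) =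
      (weyl_x * fst (weyl_y * fst m, weyl_y * snd m + v * fst m),
        weyl_x * snd (weyl_y * fst m, weyl_y * snd m + v * fst m) +
          u * fst (weyl_y * fst m, weyl_y * snd m + v * fst m)) + m"
      by (cases m) (simp add: distrib_left distrib_right y_x_relation add_ac flip: mult.assoc)
  qed (auto simp: distrib_left distrib_right weyl_const_add weyl_const_mult mult.assoc
      weyl_const_left_commute[of weyl_x] weyl_const_left_commute[of weyl_y]
      weyl_const_left_commute[of u] weyl_const_left_commute[of v])
  define E where "E a = snd (M.act a (1, 0))" for a
  have fst: "fst (M.act a m) = a * fst m" for a m
    by (induction a arbitrary: m rule: weyl_induct)
       (simp_all add: M.act_simps distrib_right mult.assoc)
  have act: "snd (M.act a (b, c)) = a * c + E a * b" for a b c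
    unfolding E_def
    by (induction a rule: weyl_induct)
       (simp_all add: M.act_simps algebra_simps fst)
  show thesis
  proof (rule that[of E])
    fix a b
    show "E (a * b) = E a * b + a * E b"
      using act[of a "fst (M.act b (1, 0))" "snd (M.act b (1, 0))"]
      by (subst (asm) prod.collapse) (simp add: E_def M.act_simps fst add.commute)
  qed (simp_all add: E_def M.act_simps)
qed

section \<open>The embedding of polynomials\<close>

abbreviation PX :: "'a::field poly \<Rightarrow> 'a weyl" where
  "PX \<equiv> weyl_of_poly"

lemma PX_pCons: "PX (pCons c r) = weyl_const c + weyl_x * PX r"
proof -
  have sup: "PX r = (\<Sum>i\<le>n. weyl_const (coeff r i) * weyl_x ^ i)" if "Polynomial.degree r \<le> n" for n and r :: "'a poly"
    unfolding weyl_of_poly_def using that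
    by (intro sum.mono_neutral_left) (auto simp: coeff_eq_0)
  have "PX (pCons c r) = (\<Sum>i\<le>Suc (Polynomial.degree r). weyl_const (coeff (pCons c r) i) * weyl_x ^ i)"
    by (intro sup degree_pCons_le)
  also have "\<dots> = weyl_const c + weyl_x * PX r"
    by (subst sum.atMost_Suc_shift)
       (simp add: weyl_of_poly_def sum_distrib_left weyl_const_commute mult.assoc)
  finally show ?thesis .
qed

lemma PX_0 [simp]: "PX 0 = 0"
  by (simp add: weyl_of_poly_def)

lemma PX_const: "PX [:c:] = weyl_const c"
  by (simp add: PX_pCons)

lemma PX_1 [simp]: "PX 1 = 1"
  by (simp add: one_pCons PX_const)

lemma PX_x: "PX [:0, 1:] = weyl_x"
  by (simp add: PX_pCons)

lemma PX_add: "PX (r + s) = PX r + PX s"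
  by (induction r s rule: poly_induct2)
     (simp_all add: PX_pCons weyl_const_add distrib_left)

lemma PX_smult: "PX (Polynomial.smult c r) = weyl_const c * PX r"
  by (induction r)
     (simp_all add: PX_pCons distrib_left weyl_const_mult mult.assoc[symmetric] weyl_const_commute[of c weyl_x])

lemma PX_mult: "PX (r * s) = PX r * PX s"
  by (induction r) (simp_all add: PX_pCons PX_add PX_smult distrib_right mult.assoc)

lemma PX_commute: "PX r * PX s = PX s * PX r"
  by (metis PX_mult mult.commute)

lemma y_PX: "weyl_y * PX r = PX r * weyl_y + PX (pderiv r)"
proof (induction r)
  case (pCons c r)
  have "weyl_y * PX (pCons c r) = weyl_y * weyl_const c + (weyl_y * weyl_x) * PX r"
    by (simp add: PX_pCons distrib_left mult.assoc)
  also have "\<dots> = weyl_const c * weyl_y + weyl_x * (weyl_y * PX r) + PX r"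
    by (simp add: y_x_relation weyl_const_commute algebra_simps)
  also have "\<dots> = PX (pCons c r) * weyl_y + PX (pderiv (pCons c r))"
    by (simp add: pCons.IH PX_pCons pderiv_pCons PX_add algebra_simps)
  finally show ?case .
qed simp

lemma weyl_x_PX: "weyl_x * PX r = PX r * weyl_x"
  using PX_commute[of "[:0, 1:]" r] by (simp add: PX_x)

section \<open>Normal form in the Weyl algebra\<close>

definition coeff_pderiv_poly :: "'a::field poly poly \<Rightarrow> 'a poly poly" where
  "coeff_pderiv_poly Q = map_poly pderiv Q"

lemma coeff_coeff_pderiv_poly [simp]: "coeff (coeff_pderiv_poly Q) i = pderiv (coeff Q i)"
  by (simp add: coeff_pderiv_poly_def coeff_map_poly)

text \<open>The operators \<open>x\<close> and \<open>\<partial> + t\<close> on \<open>F[x][t]\<close>.  Unlike \<open>F[x]\<close> with \<open>x\<close> and \<open>\<partial>\<close>, this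
  representation is faithful in positive characteristic, where \<open>\<partial>\<close> is nilpotent.\<close>

interpretation nf: weyl_module "\<lambda>c. Polynomial.smult [:c:]" "Polynomial.smult [:0, 1:]"
  "\<lambda>Q. coeff_pderiv_poly Q + pCons 0 Q"
proof unfold_locales
qed (auto intro!: poly_eqI simp: coeff_pCons pderiv_add pderiv_smult pderiv_pCons algebra_simps
    smult_add_left smult_add_right split: nat.splits)

text \<open>As \<open>\<Sum> r\<^sub>i y\<^sup>i\<close> sends \<open>1\<close> to \<open>\<Sum> r\<^sub>i t\<^sup>i\<close>, the value at \<open>1\<close> reads off the coefficients with
  respect to the left \<open>F[x]\<close>-basis of powers of \<open>y\<close>.\<close>

definition nf :: "'a::field weyl \<Rightarrow> 'a poly poly" where
  "nf a = nf.act a 1"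

abbreviation co :: "'a::field weyl \<Rightarrow> nat \<Rightarrow> 'a poly" where
  "co a i \<equiv> coeff (nf a) i"

lemma nf_add: "nf (a + b) = nf a + nf b"
  by (simp add: nf_def nf.act_simps)

lemma nf_0 [simp]: "nf 0 = 0"
  by (metis nf_add add_cancel_right_right add.right_neutral)

lemma nf_minus: "nf (- a) = - nf a"
  using nf_add[of "- a" a] by (simp add: eq_neg_iff_add_eq_0)

lemma nf_diff: "nf (a - b) = nf a - nf b"
  using nf_add[of a "- b"] by (simp add: nf_minus)

lemma nf_y: "nf (weyl_y * a) = coeff_pderiv_poly (nf a) + pCons 0 (nf a)"
  by (simp add: nf_def nf.act_simps)

lemma nf_PX: "nf (PX r * a) = Polynomial.smult r (nf a)"
proof (induction r)
  case (pCons c r)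
  have "nf (weyl_const c * a) = Polynomial.smult [:c:] (nf a)"
    "nf (weyl_x * (PX r * a)) = Polynomial.smult [:0, 1:] (nf (PX r * a))"
    by (simp_all add: nf_def nf.act_simps)
  then show ?case
    using pCons.IH
    by (simp add: PX_pCons distrib_right nf_add mult.assoc flip: smult_add_left)
qed simp

lemma nf_1 [simp]: "nf 1 = 1"
  using nf.act_simps(3)[of 1 "1 :: 'a poly poly"] by (simp add: nf_def flip: one_pCons)

lemma nf_mult_y: "nf (a * weyl_y) = pCons 0 (nf a)"
proof (induction a rule: weyl_induct)
  case (const c)
  have "coeff_pderiv_poly (1 :: 'a poly poly) = 0"
    by (intro poly_eqI) simp
  then have "nf weyl_y = pCons 0 (1 :: 'a poly poly)"
    using nf_y[of "1 :: 'a weyl"] by simp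
  then show ?case
    using nf_PX[of "[:c:]" weyl_y] nf_PX[of "[:c:]" 1]
    by (simp add: PX_const)
next
  case (x a)
  then show ?case
    using nf_PX[of "[:0, 1:]" "a * weyl_y"] nf_PX[of "[:0, 1:]" a]
    by (simp add: PX_x mult.assoc)
next
  case (y a)
  then show ?case
    by (auto intro!: poly_eqI simp: nf_y mult.assoc coeff_pCons split: nat.splits)
next
  case (add a b)
  then show ?case
    by (simp add: distrib_right nf_add)
qed

lemma nf_mult_y_power: "nf (a * weyl_y ^ n) = monom 1 n * nf a"
proof (induction n)
  case (Suc n)
  have "nf (a * weyl_y ^ Suc n) = pCons 0 (nf (a * weyl_y ^ n))"
    by (simp only: power_Suc2 mult.assoc[symmetric] nf_mult_y)
  then show ?case
    by (simp add: Suc.IH monom_Suc)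
qed simp

lemma co_mult_y_power: "co (a * weyl_y ^ n) i = (if i < n then 0 else co a (i - n))"
  by (simp add: nf_mult_y_power coeff_monom_mult)

lemma co_y: "co (weyl_y * a) i = pderiv (co a i) + (if i = 0 then 0 else co a (i - 1))"
  by (simp add: nf_y coeff_pCons split: nat.splits)

lemma nf_sum: "nf (\<Sum>i\<in>A. f i) = (\<Sum>i\<in>A. nf (f i))"
  by (induction A rule: infinite_finite_induct) (simp_all add: nf_add)

definition from_nf :: "'a::field poly poly \<Rightarrow> 'a weyl" where
  "from_nf Q = (\<Sum>i\<le>Polynomial.degree Q. PX (coeff Q i) * weyl_y ^ i)"

lemma nf_from_nf: "nf (from_nf Q) = Q"
proof -
  have "nf (PX r * weyl_y ^ i) = monom r i" for r :: "'a poly" and i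
    using nf_mult_y_power[of "1 :: 'a weyl" i] by (simp add: nf_PX smult_monom)
  then show ?thesis
    by (simp add: from_nf_def nf_sum poly_as_sum_of_monoms)
qed

text \<open>The elements \<open>\<Sum> r\<^sub>i y\<^sup>i\<close> contain the constants and are stable under left multiplication by
  \<open>x\<close> and \<open>y\<close>, so they exhaust \<open>A\<^sub>1\<close>.\<close>

lemma from_nf_nf: "from_nf (nf a) = a"
proof -
  have sup: "from_nf Q = (\<Sum>i\<le>n. PX (coeff Q i) * weyl_y ^ i)" if "Polynomial.degree Q \<le> n"
    for n and Q :: "'a poly poly"
    unfolding from_nf_def using that
    by (intro sum.mono_neutral_left) (auto simp: coeff_eq_0)
  have add: "from_nf (P + Q) = from_nf P + from_nf Q" for P Q :: "'a poly poly"
  proof -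
    let ?n = "max (Polynomial.degree P) (Polynomial.degree Q)"
    show ?thesis
      using sup[of P ?n] sup[of Q ?n] sup[of "P + Q" ?n] degree_add_le_max[of P Q]
      by (simp add: PX_add distrib_right sum.distrib)
  qed
  have smult: "from_nf (Polynomial.smult r Q) = PX r * from_nf Q" for r and Q :: "'a poly poly"
    using sup[of "Polynomial.smult r Q" "Polynomial.degree Q"]
    by (simp add: from_nf_def degree_smult_le PX_mult sum_distrib_left mult.assoc)
  have pCons: "from_nf (pCons 0 Q) = from_nf Q * weyl_y" for Q :: "'a poly poly"
  proof -
    have "from_nf (pCons 0 Q) = (\<Sum>i\<le>Suc (Polynomial.degree Q). PX (coeff (pCons 0 Q) i) * weyl_y ^ i)"
      by (intro sup degree_pCons_le)
    then show ?thesis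
      by (subst (asm) sum.atMost_Suc_shift)
         (simp add: from_nf_def sum_distrib_right mult.assoc power_commutes)
  qed
  have deriv: "weyl_y * from_nf Q = from_nf (coeff_pderiv_poly Q) + from_nf Q * weyl_y" for Q :: "'a poly poly"
  proof -
    have "Polynomial.degree (coeff_pderiv_poly Q) \<le> Polynomial.degree Q"
      by (rule degree_le) (simp add: coeff_eq_0)
    then have "from_nf (coeff_pderiv_poly Q) + from_nf Q * weyl_y =
        (\<Sum>i\<le>Polynomial.degree Q. PX (pderiv (coeff Q i)) * weyl_y ^ i + PX (coeff Q i) * weyl_y ^ i * weyl_y)"
      using sup[of "coeff_pderiv_poly Q" "Polynomial.degree Q"]
      by (simp add: from_nf_def sum.distrib sum_distrib_right)
    also have "\<dots> = weyl_y * from_nf Q"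
      unfolding from_nf_def sum_distrib_left
      by (intro sum.cong refl) (simp add: y_PX distrib_right power_commutes flip: mult.assoc, simp add: mult.assoc power_commutes)
    finally show ?thesis ..
  qed
  show ?thesis
  proof (induction a rule: weyl_induct)
    case (const c)
    have "nf (weyl_const c) = [:[:c:]:]"
      using nf_PX[of "[:c:]" 1] by (simp add: PX_const one_pCons)
    then show ?case
      by (simp add: from_nf_def PX_const)
  next
    case (x a)
    then show ?case
      using nf_PX[of "[:0, 1:]" a] smult[of "[:0, 1:]" "nf a"] by (simp add: PX_x)
  next
    case (y a)
    show ?case
      unfolding nf_y add pCons y by (rule deriv[of "nf a", unfolded y, symmetric])
  next
    case (add a b)
    then show ?case by (simp add: nf_add \<open>\<And>P Q. from_nf (P + Q) = from_nf P + from_nf Q\<close>)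
  qed
qed

lemma weyl_eqI: "(\<And>i. co a i = co b i) \<Longrightarrow> a = b"
  by (metis from_nf_nf poly_eqI)

lemma weyl_coeffs_exist:
  assumes "\<And>i. i > n \<Longrightarrow> f i = 0"
  shows "\<exists>a :: 'a::field weyl. \<forall>i. co a i = f i"
proof -
  have "coeff (Abs_poly f) = f"
    using assms by (intro coeff_Abs_poly[of n]) auto
  then show ?thesis
    by (intro exI[of _ "from_nf (Abs_poly f)"]) (simp add: nf_from_nf)
qed

text \<open>In normal form, \<open>[-, x]\<close> is differentiation with respect to \<open>y\<close> and \<open>[y, -]\<close> is
  differentiation of the coefficients.  In characteristic \<open>p\<close> the first one therefore misses
  exactly the powers \<open>y\<^sup>j\<close> with \<open>p dvd j + 1\<close>.\<close>

lemma co_commutator_x: "co (a * weyl_x - weyl_x * a) i = of_nat (Suc i) * co a (Suc i)"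
proof (induction a arbitrary: i rule: weyl_induct)
  case (const c)
  then show ?case
    using nf_PX[of "[:c:]" 1] by (simp add: weyl_const_commute PX_const coeff_eq_0 one_pCons coeff_pCons)
next
  case (x a)
  have "weyl_x * a * weyl_x - weyl_x * (weyl_x * a) = PX [:0, 1:] * (a * weyl_x - weyl_x * a)"
    by (simp add: PX_x algebra_simps)
  moreover have "co (weyl_x * a) (Suc i) = [:0, 1:] * co a (Suc i)"
    using nf_PX[of "[:0, 1:]" a] by (simp add: PX_x)
  ultimately show ?case
    using x[of i] by (simp only: nf_PX coeff_smult mult.left_commute)
next
  case (y a)
  have "weyl_y * a * weyl_x - weyl_x * (weyl_y * a) =
      weyl_y * (a * weyl_x - weyl_x * a) + (weyl_y * weyl_x - weyl_x * weyl_y) * a"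
    by (simp add: algebra_simps)
  also have "\<dots> = weyl_y * (a * weyl_x - weyl_x * a) + a"
    by (simp add: y_x_relation)
  finally have "co (weyl_y * a * weyl_x - weyl_x * (weyl_y * a)) i =
    pderiv (co (a * weyl_x - weyl_x * a) i) +
      (if i = 0 then 0 else co (a * weyl_x - weyl_x * a) (i - 1)) + co a i"
    by (simp add: nf_add co_y)
  then show ?case
    unfolding co_y
    by (cases i) (simp_all add: y pderiv_mult algebra_simps del: of_nat_Suc mult_Suc,
       simp_all add: algebra_simps)
next
  case (add a b)
  have "(a + b) * weyl_x - weyl_x * (a + b) = (a * weyl_x - weyl_x * a) + (b * weyl_x - weyl_x * b)"
    by (simp add: algebra_simps)
  then show ?case
    by (simp only: nf_add coeff_add distrib_left add)
qed

lemma co_commutator_y: "co (weyl_y * a - a * weyl_y) i = pderiv (co a i)"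
  by (simp add: nf_diff nf_y nf_mult_y)

lemma nf_PX_1: "nf (PX r) = [:r:]"
  using nf_PX[of r 1] by (simp add: one_pCons)

lemma comm_y_iff: "a * weyl_y = weyl_y * a \<longleftrightarrow> (\<forall>i. pderiv (co a i) = 0)"
  using weyl_eqI[of "weyl_y * a - a * weyl_y" 0]
  by (metis co_commutator_y coeff_0 nf_0 right_minus_eq)

section \<open>The algebra \<open>A\<^sub>h\<close> and its center\<close>

lemma power_dvd_mult_pderiv:
  fixes f h :: "'a::field poly"
  assumes "h ^ n dvd f"
  shows "h ^ n dvd h * pderiv f"
proof -
  obtain k where k: "f = h ^ n * k" using assms ..
  have "h * pderiv (h ^ n) = h ^ n * Polynomial.smult (of_nat n) (pderiv h)"
  proof (cases n)
    case (Suc m)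
    then show ?thesis
      by (simp only: pderiv_power_Suc) (simp add: mult_ac)
  qed simp
  then have "h * pderiv f = h ^ n * (h * pderiv k + Polynomial.smult (of_nat n) (pderiv h) * k)"
    unfolding k pderiv_mult by (simp add: distrib_left mult_ac)
      (metis mult.assoc mult.commute mult_smult_right)
  then show ?thesis by simp
qed

lemma yhat_eq: "yhat h = PX h * weyl_y + PX (pderiv h)"
  by (simp add: yhat_def y_PX)

lemma yhat_relation: "yhat h * weyl_x - weyl_x * yhat h = PX h"
proof -
  have "yhat h * weyl_x = PX h * (weyl_y * weyl_x) + PX (pderiv h) * weyl_x"
    by (simp add: yhat_eq distrib_right mult.assoc)
  moreover have "weyl_x * yhat h = PX h * (weyl_x * weyl_y) + PX (pderiv h) * weyl_x"
    by (simp add: yhat_eq distrib_left weyl_x_PX flip: mult.assoc)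
  ultimately show ?thesis
    by (simp add: y_x_relation distrib_left)
qed

lemma Ah_gens: "weyl_x \<in> Ah h" "yhat h \<in> Ah h" "weyl_const c \<in> Ah h"
  by (auto simp: Ah_def intro: weyl_subalgebra.intros)

lemma Ah_add: "a \<in> Ah h \<Longrightarrow> b \<in> Ah h \<Longrightarrow> a + b \<in> Ah h"
  by (auto simp: Ah_def intro: weyl_subalgebra.intros)

lemma Ah_mult: "a \<in> Ah h \<Longrightarrow> b \<in> Ah h \<Longrightarrow> a * b \<in> Ah h"
  by (auto simp: Ah_def intro: weyl_subalgebra.intros)

lemma Ah_induct [consumes 1, case_names const x yhat add mult]:
  assumes "a \<in> Ah h"
    and "\<And>c. P (weyl_const c)" "P weyl_x" "P (yhat h)"
    and "\<And>a b. a \<in> Ah h \<Longrightarrow> b \<in> Ah h \<Longrightarrow> P a \<Longrightarrow> P b \<Longrightarrow> P (a + b)"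
    and "\<And>a b. a \<in> Ah h \<Longrightarrow> b \<in> Ah h \<Longrightarrow> P a \<Longrightarrow> P b \<Longrightarrow> P (a * b)"
  shows "P a"
  using assms(1) unfolding Ah_def
  by (induction a rule: weyl_subalgebra.induct) (use assms(2-) in \<open>auto simp: Ah_def\<close>)

lemma Ah_0: "0 \<in> Ah h" and Ah_1: "1 \<in> Ah h"
  using Ah_gens(3)[of 0 h] Ah_gens(3)[of 1 h] by simp_all

lemma Ah_minus: "a \<in> Ah h \<Longrightarrow> - a \<in> Ah h"
  using Ah_mult[OF Ah_gens(3)[of "- 1"], of a h] by (simp add: weyl_const_minus)

lemma Ah_diff: "a \<in> Ah h \<Longrightarrow> b \<in> Ah h \<Longrightarrow> a - b \<in> Ah h"
  using Ah_add[OF _ Ah_minus, of a h b] by simp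

lemma Ah_PX: "PX r \<in> Ah h"
  by (induction r) (simp_all add: Ah_0 PX_pCons Ah_add Ah_gens Ah_mult)

lemma Ah_sum: "(\<And>i. i \<in> I \<Longrightarrow> f i \<in> Ah h) \<Longrightarrow> (\<Sum>i\<in>I. f i) \<in> Ah h"
  by (induction I rule: infinite_finite_induct) (auto simp: Ah_0 Ah_add)

text \<open>As a left \<open>F[x]\<close>-module, \<open>A\<^sub>h\<close> has the basis \<open>h\<^sup>i y\<^sup>i\<close>.  The span of these elements is stable
  under left multiplication by the generators because \<open>h \<partial>\<close> preserves the ideal \<open>(h\<^sup>i)\<close>;
  conversely \<open>h\<^sup>i\<^sup>+\<^sup>1 y\<^sup>i\<^sup>+\<^sup>1\<close> is \<open>(h y) (h\<^sup>i y\<^sup>i)\<close> up to a polynomial multiple of \<open>h\<^sup>i y\<^sup>i\<close>.\<close>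

lemma Ah_iff:
  fixes h :: "'a::field poly"
  shows "a \<in> Ah h \<longleftrightarrow> (\<forall>i. h ^ i dvd co a i)"
proof
  let ?S = "{a. \<forall>i. h ^ i dvd co a i}"
  assume "a \<in> Ah h"
  then have "\<forall>s\<in>?S. a * s \<in> ?S"
  proof (induction a rule: Ah_induct)
    case (const c)
    then show ?case
      using nf_PX[of "[:c:]"] by (auto simp: PX_const dvd_smult)
  next
    case x
    then show ?case
      using nf_PX[of "[:0, 1:] :: 'a poly"] by (auto simp: PX_x simp del: smult_pCons mult_pCons_left)
  next
    case yhat
    show ?case
    proof
      fix s assume s: "s \<in> ?S"
      have "h ^ i dvd co (yhat h * s) i" for i
      proof -
        have "co (yhat h * s) i = pderiv (co (PX h * s) i) + (if i = 0 then 0 else co (PX h * s) (i - 1))"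
          by (simp add: yhat_def mult.assoc co_y)
        also have "\<dots> = pderiv h * co s i + h * pderiv (co s i) + (if i = 0 then 0 else h * co s (i - 1))"
          by (simp add: nf_PX pderiv_mult)
        also have "h ^ i dvd \<dots>"
        proof (intro dvd_add)
          show "h ^ i dvd pderiv h * co s i" using s by simp
          show "h ^ i dvd h * pderiv (co s i)" using s by (intro power_dvd_mult_pderiv) simp
          show "h ^ i dvd (if i = 0 then 0 else h * co s (i - 1))"
            using s by (cases i) (auto intro: mult_dvd_mono)
        qed
        finally show ?thesis .
      qed
      then show "yhat h * s \<in> ?S" by simp
    qed
  next
    case (add a b)
    then show ?case by (auto simp: distrib_right nf_add)
  next
    case (mult a b)
    then show ?case by (simp add: mult.assoc)
  qed
  moreover have "1 \<in> ?S"
    by (auto simp: coeff_1)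
  ultimately show "\<forall>i. h ^ i dvd co a i"
    by (metis (mono_tags, lifting) mem_Collect_eq mult.right_neutral)
next
  assume a: "\<forall>i. h ^ i dvd co a i"
  have hy: "PX h * weyl_y \<in> Ah h"
    using Ah_diff[OF Ah_gens(2) Ah_PX, of h "pderiv h"] by (simp add: yhat_eq)
  have pow: "PX (h ^ i) * weyl_y ^ i \<in> Ah h" for i
  proof (induction i)
    case 0
    then show ?case by (simp add: Ah_1)
  next
    case (Suc i)
    obtain k where k: "h * pderiv (h ^ i) = h ^ i * k"
      using power_dvd_mult_pderiv[of h i "h ^ i"] by auto
    have "(PX h * weyl_y) * (PX (h ^ i) * weyl_y ^ i) = PX h * (weyl_y * PX (h ^ i)) * weyl_y ^ i"
      by (simp add: mult.assoc)
    also have "\<dots> = PX (h ^ Suc i) * weyl_y ^ Suc i + PX (h * pderiv (h ^ i)) * weyl_y ^ i"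
      by (simp add: y_PX distrib_left distrib_right mult.assoc PX_mult)
    finally have "PX (h ^ Suc i) * weyl_y ^ Suc i =
        (PX h * weyl_y) * (PX (h ^ i) * weyl_y ^ i) - PX k * (PX (h ^ i) * weyl_y ^ i)"
      by (simp add: k PX_mult mult.assoc[symmetric] PX_commute)
    then show ?case
      using Ah_diff[OF Ah_mult[OF hy Suc] Ah_mult[OF Ah_PX Suc]] by simp
  qed
  have "PX (co a i) * weyl_y ^ i \<in> Ah h" for i
  proof -
    obtain k where "co a i = k * h ^ i" using a by (metis dvdE mult.commute)
    then show ?thesis
      using Ah_mult[OF Ah_PX pow, of k i] by (simp add: PX_mult mult.assoc)
  qed
  then have "from_nf (nf a) \<in> Ah h"
    unfolding from_nf_def by (intro Ah_sum)
  then show "a \<in> Ah h" by (simp add: from_nf_nf)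
qed

lemma PX_mult_cancel: "r \<noteq> 0 \<Longrightarrow> PX r * a = PX r * b \<Longrightarrow> a = b"
proof (rule weyl_eqI)
  fix i assume "r \<noteq> 0" "PX r * a = PX r * b"
  then have "r * co a i = r * co b i"
    by (metis coeff_smult nf_PX)
  then show "co a i = co b i" using \<open>r \<noteq> 0\<close> by simp
qed

lemma commute_all:
  fixes z :: "'a::field weyl"
  assumes "z * weyl_x = weyl_x * z" "z * weyl_y = weyl_y * z"
  shows "z * b = b * z"
proof (induction b rule: weyl_induct)
  case (const c)
  show ?case by (simp add: weyl_const_commute)
next
  case (x b)
  then show ?case using assms(1) by (metis mult.assoc)
next
  case (y b)
  then show ?case using assms(2) by (metis mult.assoc)
qed (simp add: distrib_left distrib_right)

lemma PX_central: "pderiv f = 0 \<Longrightarrow> PX f * b = b * PX f"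
  by (rule commute_all) (simp_all add: weyl_x_PX y_PX)

text \<open>The commutator of \<open>yhat\<close> with \<open>h\<close> is \<open>h h'\<close>, so \<open>h\<close> can be moved from the right of the
  generators to their left.\<close>

lemma normal_h: "b \<in> Ah h \<Longrightarrow> \<exists>c\<in>Ah h. b * PX h = PX h * c"
proof (induction b rule: Ah_induct)
  case (const c)
  show ?case by (intro bexI[of _ "weyl_const c"]) (auto simp: weyl_const_commute Ah_gens)
next
  case x
  show ?case by (intro bexI[of _ weyl_x]) (auto simp: weyl_x_PX Ah_gens)
next
  case yhat
  have "yhat h * PX h = PX h * (yhat h + PX (pderiv h))"
  proof -
    have "yhat h * PX h = PX h * weyl_y * PX h + PX (pderiv h) * PX h"
      by (simp add: yhat_eq distrib_right)
    also have "\<dots> = PX h * (weyl_y * PX h) + PX h * PX (pderiv h)"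
      by (simp add: mult.assoc PX_commute)
    finally show ?thesis by (simp add: yhat_def distrib_left)
  qed
  then show ?case by (intro bexI[of _ "yhat h + PX (pderiv h)"]) (auto intro: Ah_gens Ah_PX Ah_add)
next
  case (add a b)
  then obtain c d where "c \<in> Ah h" "d \<in> Ah h" "a * PX h = PX h * c" "b * PX h = PX h * d"
    by blast
  then show ?case
    by (intro bexI[of _ "c + d"]) (auto simp: distrib_left distrib_right Ah_add)
next
  case (mult a b)
  then obtain c d where "c \<in> Ah h" "d \<in> Ah h" "a * PX h = PX h * c" "b * PX h = PX h * d"
    by blast
  then have "a * b * PX h = PX h * (c * d)" by (metis mult.assoc)
  then show ?case using \<open>c \<in> Ah h\<close> \<open>d \<in> Ah h\<close> Ah_mult by blast
qed

definition hAh :: "'a::field poly \<Rightarrow> 'a weyl set" where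
  "hAh h = (\<lambda>a. PX h * a) ` Ah h"

lemma hAh_closed:
  shows hAh_add: "a \<in> hAh h \<Longrightarrow> b \<in> hAh h \<Longrightarrow> a + b \<in> hAh h"
    and hAh_right: "a \<in> hAh h \<Longrightarrow> c \<in> Ah h \<Longrightarrow> a * c \<in> hAh h"
    and hAh_left: "c \<in> Ah h \<Longrightarrow> a \<in> hAh h \<Longrightarrow> c * a \<in> hAh h"
    and hAh_diff: "a \<in> hAh h \<Longrightarrow> b \<in> hAh h \<Longrightarrow> a - b \<in> hAh h"
    and hAh_0: "0 \<in> hAh h"
proof -
  show "a \<in> hAh h \<Longrightarrow> b \<in> hAh h \<Longrightarrow> a + b \<in> hAh h"
    unfolding hAh_def by (auto simp flip: distrib_left intro: Ah_add)
  show "a \<in> hAh h \<Longrightarrow> b \<in> hAh h \<Longrightarrow> a - b \<in> hAh h"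
    unfolding hAh_def by (auto simp flip: right_diff_distrib intro: Ah_diff)
  show "a \<in> hAh h \<Longrightarrow> c \<in> Ah h \<Longrightarrow> a * c \<in> hAh h"
    unfolding hAh_def by (auto simp: mult.assoc intro: Ah_mult)
  show "0 \<in> hAh h"
    unfolding hAh_def using Ah_0[of h] by (auto intro: image_eqI[of _ _ 0])
  show "c * a \<in> hAh h" if c: "c \<in> Ah h" and "a \<in> hAh h"
  proof -
    from that obtain a' where a': "a' \<in> Ah h" "a = PX h * a'" by (auto simp: hAh_def)
    obtain c' where "c' \<in> Ah h" "c * PX h = PX h * c'" using normal_h[OF c] by blast
    then have "c * a = PX h * (c' * a')" using a'(2) by (metis mult.assoc)
    then show ?thesis unfolding hAh_def using Ah_mult \<open>c' \<in> Ah h\<close> a'(1) by blast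
  qed
qed

text \<open>\<open>A\<^sub>h / (h)\<close> is commutative, as the commutator of its two generators is \<open>h\<close>.\<close>

lemma commutator_hAh:
  assumes "a \<in> Ah h" "b \<in> Ah h"
  shows "a * b - b * a \<in> hAh h"
proof -
  have step: "a * b - b * a \<in> hAh h" if b: "b \<in> Ah h" and a: "a \<in> Ah h"
    and x: "weyl_x * b - b * weyl_x \<in> hAh h" and y: "yhat h * b - b * yhat h \<in> hAh h" for a b
    using a
  proof (induction a rule: Ah_induct)
    case (const c)
    show ?case by (simp add: weyl_const_commute hAh_0)
  next
    case (add a c)
    have "(a + c) * b - b * (a + c) = (a * b - b * a) + (c * b - b * c)"
      by (simp add: algebra_simps)
    then show ?case using add hAh_add by metis
  next
    case (mult a c)
    have "a * c * b - b * (a * c) = a * (c * b - b * c) + (a * b - b * a) * c"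
      by (simp add: algebra_simps)
    then show ?case using mult hAh_add hAh_left hAh_right by metis
  qed (rule x y)+
  have "yhat h * weyl_x - weyl_x * yhat h = PX h * 1"
    by (simp add: yhat_relation)
  then have xy: "yhat h * weyl_x - weyl_x * yhat h \<in> hAh h"
    unfolding hAh_def using Ah_1 by blast
  then have "weyl_x * yhat h - yhat h * weyl_x \<in> hAh h"
    using hAh_diff[OF hAh_0 xy] by simp
  have x: "c * weyl_x - weyl_x * c \<in> hAh h" if "c \<in> Ah h" for c
    using step[OF Ah_gens(1) that] xy hAh_0[of h] by simp
  have y: "c * yhat h - yhat h * c \<in> hAh h" if "c \<in> Ah h" for c
    using step[OF Ah_gens(2) that] \<open>weyl_x * yhat h - yhat h * weyl_x \<in> hAh h\<close> hAh_0[of h] by simp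
  show ?thesis
    using step[OF assms(2,1)] hAh_diff[OF hAh_0 x[OF assms(2)]] hAh_diff[OF hAh_0 y[OF assms(2)]] by simp
qed

lemma hAh_iff:
  assumes "h \<noteq> 0"
  shows "a \<in> hAh h \<longleftrightarrow> (\<forall>i. h ^ Suc i dvd co a i)"
proof
  assume "a \<in> hAh h"
  then obtain b where "b \<in> Ah h" "a = PX h * b" by (auto simp: hAh_def)
  then show "\<forall>i. h ^ Suc i dvd co a i"
    by (auto simp: nf_PX Ah_iff intro: mult_dvd_mono)
next
  assume a: "\<forall>i. h ^ Suc i dvd co a i"
  have "\<exists>b. \<forall>i. co b i = co a i div h"
    by (rule weyl_coeffs_exist[of "Polynomial.degree (nf a)"]) (auto simp: coeff_eq_0)
  then obtain b where b: "\<And>i. co b i = co a i div h" by blast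
  have eq: "co a i = h * co b i" for i
    using a[rule_format, of i] unfolding b by (metis dvd_mult_div_cancel dvd_mult_left power_Suc)
  then have "a = PX h * b"
    by (intro weyl_eqI) (simp add: nf_PX)
  moreover have "b \<in> Ah h"
    using a assms unfolding Ah_iff by (simp add: eq)
  ultimately show "a \<in> hAh h" by (auto simp: hAh_def)
qed

context
  assumes char_pos: "CHAR('a::field) > 0"
begin

lemma comm_x_iff:
  "(a :: 'a weyl) * weyl_x = weyl_x * a \<longleftrightarrow> (\<forall>i. \<not> CHAR('a) dvd i \<longrightarrow> co a i = 0)"
proof -
  have "a * weyl_x = weyl_x * a \<longleftrightarrow> a * weyl_x - weyl_x * a = 0"
    by simp
  also have "\<dots> \<longleftrightarrow> (\<forall>i. of_nat (Suc i) * co a (Suc i) = 0)"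
    using weyl_eqI[of "a * weyl_x - weyl_x * a" 0] by (metis co_commutator_x coeff_0 nf_0)
  also have "\<dots> \<longleftrightarrow> (\<forall>i. CHAR('a) dvd Suc i \<or> co a (Suc i) = 0)"
    by (simp only: mult_eq_0_iff of_nat_eq_0_iff_char_dvd semiring_char_poly)
  also have "\<dots> \<longleftrightarrow> (\<forall>i. \<not> CHAR('a) dvd i \<longrightarrow> co a i = 0)"
    by (metis dvd_0_right not0_implies_Suc)
  finally show ?thesis .
qed

lemma y_power_central: "CHAR('a) dvd i \<Longrightarrow> (weyl_y :: 'a weyl) ^ i * b = b * weyl_y ^ i"
proof (rule commute_all)
  assume i: "CHAR('a) dvd i"
  have "co (weyl_y ^ i :: 'a weyl) j = (if j = i then 1 else 0)" for j
    using co_mult_y_power[of "1 :: 'a weyl" i j] by (auto simp: coeff_1)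
  then show "(weyl_y :: 'a weyl) ^ i * weyl_x = weyl_x * weyl_y ^ i"
    using i by (simp add: comm_x_iff)
  show "(weyl_y :: 'a weyl) ^ i * weyl_y = weyl_y * weyl_y ^ i"
    by (rule power_commutes)
qed

text \<open>The centralizer of \<open>x\<close> is \<open>F[x][y\<^sup>p]\<close>.  As \<open>y\<^sup>p\<close> is central, its elements multiply like
  commuting polynomials.\<close>

lemma nf_mult_comm_x:
  assumes "(a :: 'a weyl) * weyl_x = weyl_x * a"
  shows "nf (a * b) = nf a * nf b"
proof -
  let ?n = "Polynomial.degree (nf a)"
  have summand: "nf (PX (co a i) * weyl_y ^ i * b) = monom (co a i) i * nf b" for i
  proof (cases "CHAR('a) dvd i")
    case True
    then have "PX (co a i) * weyl_y ^ i * b = PX (co a i) * (b * weyl_y ^ i)"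
      by (simp add: mult.assoc y_power_central)
    then show ?thesis
      by (simp add: nf_PX nf_mult_y_power smult_monom flip: mult_smult_left)
  next
    case False
    then show ?thesis using assms comm_x_iff by simp
  qed
  have "nf (a * b) = nf (from_nf (nf a) * b)"
    by (simp add: from_nf_nf)
  also have "\<dots> = (\<Sum>i\<le>?n. monom (co a i) i) * nf b"
    unfolding from_nf_def sum_distrib_right nf_sum by (simp add: summand)
  also have "\<dots> = nf a * nf b"
    by (simp add: poly_as_sum_of_monoms)
  finally show ?thesis .
qed

lemma comm_x_PX:
  assumes "(a :: 'a weyl) * weyl_x = weyl_x * a"
  shows "a * PX r = PX r * a"
proof -
  have "nf (a * PX r) = nf (PX r * a)"
    by (simp add: nf_mult_comm_x[OF assms] nf_PX nf_PX_1)
  then show ?thesis by (metis from_nf_nf)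
qed

lemma comm_y_comm_x:
  assumes "(a :: 'a weyl) * weyl_x = weyl_x * a"
  shows "(weyl_y * a - a * weyl_y) * weyl_x = weyl_x * (weyl_y * a - a * weyl_y)"
  using assms by (simp add: comm_x_iff co_commutator_y)

lemma commutator_yhat:
  assumes "(a :: 'a weyl) * weyl_x = weyl_x * a"
  shows "co (yhat h * a - a * yhat h) i = h * pderiv (co a i)"
proof -
  have "yhat h * a - a * yhat h = (weyl_y * a - a * weyl_y) * PX h"
    by (simp add: yhat_def left_diff_distrib mult.assoc comm_x_PX[OF assms])
  also have "\<dots> = PX h * (weyl_y * a - a * weyl_y)"
    by (rule comm_x_PX[OF comm_y_comm_x[OF assms]])
  finally show ?thesis by (simp add: nf_PX co_commutator_y)
qed

text \<open>An element commuting with \<open>x\<close> and with \<open>yhat = y h\<close> commutes with \<open>y\<close>, since \<open>h\<close> can be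
  cancelled in \<open>[yhat, z] = h [y, z]\<close>.  The center of \<open>A\<^sub>h\<close> is thus central in \<open>A\<^sub>1\<close>.\<close>

lemma center_Ah_iff:
  fixes h :: "'a poly"
  assumes "h \<noteq> 0"
  shows "z \<in> center (Ah h) \<longleftrightarrow> z \<in> Ah h \<and> z * weyl_x = weyl_x * z \<and> z * weyl_y = weyl_y * z"
proof
  assume z: "z \<in> center (Ah h)"
  then have x: "z * weyl_x = weyl_x * z" and y: "z * yhat h = yhat h * z" and "z \<in> Ah h"
    using Ah_gens(1,2)[of h] by (auto simp: center_def)
  have "h * pderiv (co z i) = 0" for i
    using commutator_yhat[OF x, of h i] y by simp
  then show "z \<in> Ah h \<and> z * weyl_x = weyl_x * z \<and> z * weyl_y = weyl_y * z"
    using assms x \<open>z \<in> Ah h\<close> by (simp add: comm_y_iff)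
next
  assume "z \<in> Ah h \<and> z * weyl_x = weyl_x * z \<and> z * weyl_y = weyl_y * z"
  then show "z \<in> center (Ah h)"
    using commute_all by (auto simp: center_def)
qed

lemma center_commute:
  "h \<noteq> 0 \<Longrightarrow> (z :: 'a weyl) \<in> center (Ah h) \<Longrightarrow> z * b = b * z"
  using center_Ah_iff commute_all by blast

lemma center_Ah_coeffs:
  fixes h :: "'a poly"
  assumes "h \<noteq> 0"
  shows "z \<in> center (Ah h) \<longleftrightarrow> (\<forall>i. h ^ i dvd co z i \<and> pderiv (co z i) = 0 \<and>
    (\<not> CHAR('a) dvd i \<longrightarrow> co z i = 0))"
  unfolding center_Ah_iff[OF assms] comm_x_iff comm_y_iff Ah_iff by blast

end

section \<open>Derivations of \<open>A\<^sub>h\<close>\<close>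

definition derivation :: "('a::field weyl \<Rightarrow> 'a weyl) \<Rightarrow> bool" where
  "derivation E \<longleftrightarrow> (\<forall>a b. E (a + b) = E a + E b) \<and> (\<forall>a b. E (a * b) = E a * b + a * E b) \<and>
     (\<forall>c. E (weyl_const c) = 0)"

lemma derivation_0: "derivation E \<Longrightarrow> E 0 = 0"
  by (metis derivation_def weyl_const_0)

lemma derivation_diff: "derivation E \<Longrightarrow> E (a - b) = E a - E b"
  by (metis add_diff_cancel derivation_def diff_add_cancel)

lemma derivation_PX: "derivation E \<Longrightarrow> E weyl_x = 0 \<Longrightarrow> E (PX r) = 0"
  by (induction r) (simp_all add: derivation_0 PX_pCons, simp_all add: derivation_def)

lemma DerI:
  assumes "\<And>a. a \<in> Ah h \<Longrightarrow> D a \<in> Ah h"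
    and "\<And>a b. a \<in> Ah h \<Longrightarrow> b \<in> Ah h \<Longrightarrow> D (a + b) = D a + D b"
    and "\<And>c a. a \<in> Ah h \<Longrightarrow> D (weyl_const c * a) = weyl_const c * D a"
    and "\<And>a b. a \<in> Ah h \<Longrightarrow> b \<in> Ah h \<Longrightarrow> D (a * b) = D a * b + a * D b"
  shows "restrict D (Ah h) \<in> Der (Ah h)"
  unfolding Der_def using assms by (auto simp: Ah_add Ah_mult Ah_gens)

lemma Der_closed: "D \<in> Der B \<Longrightarrow> a \<in> B \<Longrightarrow> D a \<in> B"
  by (auto simp: Der_def)

lemma Der_add: "D \<in> Der B \<Longrightarrow> a \<in> B \<Longrightarrow> b \<in> B \<Longrightarrow> D (a + b) = D a + D b"
  by (auto simp: Der_def)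

lemma Der_mult: "D \<in> Der B \<Longrightarrow> a \<in> B \<Longrightarrow> b \<in> B \<Longrightarrow> D (a * b) = D a * b + a * D b"
  by (auto simp: Der_def)

lemma Der_const_mult: "D \<in> Der B \<Longrightarrow> a \<in> B \<Longrightarrow> D (weyl_const c * a) = weyl_const c * D a"
  by (auto simp: Der_def)

lemma Der_const: "D \<in> Der B \<Longrightarrow> 1 \<in> B \<Longrightarrow> D (weyl_const c) = 0"
  using Der_mult[of D B 1 1] Der_const_mult[of D B 1 c] by simp

lemma Der_diff: "D \<in> Der (Ah h) \<Longrightarrow> a \<in> Ah h \<Longrightarrow> b \<in> Ah h \<Longrightarrow> D (a - b) = D a - D b"
  using Der_add[of D "Ah h" "a - b" b] Ah_diff[of a h b] by simp

lemma Der_eqI: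
  assumes "D \<in> Der (Ah h)" "E \<in> Der (Ah h)" "D weyl_x = E weyl_x" "D (yhat h) = E (yhat h)"
  shows "D = E"
proof
  fix a
  have "D a = E a" if "a \<in> Ah h"
    using that
    by (induction a rule: Ah_induct)
       (use assms in \<open>simp_all add: Der_const Ah_1 Der_add Der_mult\<close>)
  moreover have "D a = E a" if "a \<notin> Ah h"
    using assms(1,2) that by (auto simp: Der_def PiE_def extensional_def)
  ultimately show "D a = E a" by blast
qed

lemma Der_add_closed:
  assumes "D \<in> Der (Ah h)" "E \<in> Der (Ah h)"
  shows "(\<lambda>a\<in>Ah h. D a + E a) \<in> Der (Ah h)"
  using assms
  by (intro DerI) (auto simp: Der_closed Ah_add Der_add Der_mult Der_const_mult algebra_simps)

lemma inner_Der:
  assumes "b \<in> Ah h"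
  shows "(\<lambda>a\<in>Ah h. b * a - a * b) \<in> Der (Ah h)"
proof (intro DerI)
  fix c a
  show "b * (weyl_const c * a) - weyl_const c * a * b = weyl_const c * (b * a - a * b)"
    by (simp only: weyl_const_left_commute right_diff_distrib mult.assoc)
qed (use assms in \<open>auto simp: Ah_diff Ah_mult algebra_simps\<close>)

text \<open>Dividing a derivation of \<open>A\<^sub>1\<close> by a central polynomial \<open>f\<close> is possible as soon as the two
  values on the generators of \<open>A\<^sub>h\<close> are divisible by \<open>f\<close> inside \<open>A\<^sub>h\<close>.\<close>

lemma divided_derivation:
  fixes h :: "'a::field poly"
  assumes E: "derivation E" and f: "pderiv f = 0" "f \<noteq> 0"
    and x: "E weyl_x = PX f * u" "u \<in> Ah h" and y: "E (yhat h) = PX f * v" "v \<in> Ah h"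
  obtains D where "D \<in> Der (Ah h)" "\<And>a. a \<in> Ah h \<Longrightarrow> PX f * D a = E a"
    "D weyl_x = u" "D (yhat h) = v"
proof -
  have E': "E (a + b) = E a + E b" "E (a * b) = E a * b + a * E b" "E (weyl_const c) = 0" for a b c
    using E by (auto simp: derivation_def)
  have left: "a * (PX f * b) = PX f * (a * b)" for a b
    using PX_central[OF f(1), of a] by (metis mult.assoc)
  have ex: "\<exists>d\<in>Ah h. PX f * d = E a" if "a \<in> Ah h" for a
    using that
  proof (induction a rule: Ah_induct)
    case (const c)
    show ?case by (intro bexI[of _ 0]) (auto simp: E' Ah_0)
  next
    case x
    then show ?case using assms by (intro bexI[of _ u]) auto
  next
    case yhat
    then show ?case using assms by (intro bexI[of _ v]) auto
  next
    case (add a b)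
    then obtain d e where "d \<in> Ah h" "PX f * d = E a" "e \<in> Ah h" "PX f * e = E b" by blast
    then show ?case by (intro bexI[of _ "d + e"]) (auto simp: E' Ah_add distrib_left)
  next
    case (mult a b)
    then obtain d e where "d \<in> Ah h" "PX f * d = E a" "e \<in> Ah h" "PX f * e = E b" by blast
    then have "PX f * (d * b) = E a * b" "PX f * (a * e) = a * E b"
      by (simp add: mult.assoc[symmetric], simp add: left[symmetric])
    then show ?case using mult.hyps \<open>d \<in> Ah h\<close> \<open>e \<in> Ah h\<close>
      by (intro bexI[of _ "d * b + a * e"]) (simp_all add: E' Ah_add Ah_mult distrib_left)
  qed
  then obtain D where D: "\<And>a. a \<in> Ah h \<Longrightarrow> D a \<in> Ah h" "\<And>a. a \<in> Ah h \<Longrightarrow> PX f * D a = E a"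
    by metis
  have eqI: "s = t" if "PX f * s = PX f * t" for s t
    using that PX_mult_cancel[OF f(2)] by blast
  have "restrict D (Ah h) \<in> Der (Ah h)"
  proof (intro DerI D(1))
    fix a b assume "a \<in> Ah h" "b \<in> Ah h"
    then show "D (a + b) = D a + D b"
      by - (rule eqI, simp add: distrib_left D Ah_add E')
    have "PX f * (D a * b) = E a * b" "PX f * (a * D b) = a * E b"
      using D(2)[OF \<open>a \<in> Ah h\<close>] D(2)[OF \<open>b \<in> Ah h\<close>]
      by (simp add: mult.assoc[symmetric], simp add: left[symmetric])
    then show "D (a * b) = D a * b + a * D b"
      using \<open>a \<in> Ah h\<close> \<open>b \<in> Ah h\<close> by - (rule eqI, simp add: distrib_left D Ah_mult E')
    fix c
    show "D (weyl_const c * a) = weyl_const c * D a"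
      using \<open>a \<in> Ah h\<close> by - (rule eqI, simp add: D Ah_mult Ah_gens E' left[of "weyl_const c", symmetric])
  qed
  moreover have "D weyl_x = u" "D (yhat h) = v"
    by (rule eqI, simp add: D Ah_gens x y)+
  ultimately show thesis
    using D by (intro that[of "restrict D (Ah h)"]) (auto simp: Ah_gens)
qed

lemma Der_PX_zero: "D \<in> Der (Ah h) \<Longrightarrow> D weyl_x = 0 \<Longrightarrow> D (PX r) = 0"
proof (induction r)
  case 0
  then show ?case using Der_const[of D "Ah h" 0] Ah_1[of h] by simp
next
  case (pCons c r)
  then show ?case
    by (simp add: PX_pCons Der_add Der_mult Der_const Ah_gens Ah_mult Ah_PX Ah_1)
qed

lemma Der_relation:
  assumes "D \<in> Der (Ah h)"
  shows "D (PX h) = (D (yhat h) * weyl_x - weyl_x * D (yhat h)) + (yhat h * D weyl_x - D weyl_x * yhat h)"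
proof -
  have "D (yhat h * weyl_x - weyl_x * yhat h) = D (yhat h) * weyl_x + yhat h * D weyl_x
      - (D weyl_x * yhat h + weyl_x * D (yhat h))"
    using assms by (simp add: Der_diff Der_mult Ah_gens Ah_mult)
  then show ?thesis
    by (simp add: yhat_relation algebra_simps)
qed

text \<open>Chain rule in the commutative ring \<open>A\<^sub>h / (h)\<close>.\<close>

lemma Der_PX_mod_h:
  assumes "D \<in> Der (Ah h)"
  shows "D (PX r) - PX (pderiv r) * D weyl_x \<in> hAh h"
proof (induction r)
  case 0
  then show ?case using Der_const[OF assms Ah_1, of 0] by (simp add: hAh_0)
next
  case (pCons c r)
  have "D (PX (pCons c r)) - PX (pderiv (pCons c r)) * D weyl_x =
      weyl_x * (D (PX r) - PX (pderiv r) * D weyl_x) + (D weyl_x * PX r - PX r * D weyl_x)"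
    using assms
    by (simp add: PX_pCons pderiv_pCons PX_add Der_add Der_mult Der_const Ah_gens Ah_mult Ah_PX Ah_1)
       (simp add: algebra_simps)
  then show ?case
    using pCons.IH assms
    by (simp add: hAh_add hAh_left commutator_hAh Der_closed Ah_gens Ah_PX)
qed

text \<open>Applying \<open>D\<close> to \<open>[yhat, x] = h\<close> gives \<open>h' D(x) = 0\<close> in \<open>A\<^sub>h / (h)\<close>, where \<open>h'\<close> is invertible.\<close>

lemma Der_x_in_hAh:
  assumes sep: "separable h" and D: "D \<in> Der (Ah h)"
  shows "D weyl_x \<in> hAh h"
proof -
  have Dx: "D weyl_x \<in> Ah h" "D (yhat h) \<in> Ah h"
    using Der_closed[OF D] Ah_gens by blast+
  obtain u v where uv: "u * h + v * pderiv h = 1"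
    using sep by (auto simp: separable_def)
  have "D (PX h) \<in> hAh h"
    unfolding Der_relation[OF D] by (intro hAh_add commutator_hAh Dx Ah_gens)
  then have "D (PX h) - (D (PX h) - PX (pderiv h) * D weyl_x) \<in> hAh h"
    by (intro hAh_diff Der_PX_mod_h[OF D])
  then have "PX v * (PX (pderiv h) * D weyl_x) \<in> hAh h"
    by - (rule hAh_left[OF Ah_PX], simp)
  moreover have "PX u * (PX h * D weyl_x) \<in> hAh h"
    using Dx by - (rule hAh_left[OF Ah_PX], simp add: hAh_def)
  ultimately have "PX (u * h + v * pderiv h) * D weyl_x \<in> hAh h"
    by (simp add: PX_add PX_mult distrib_right mult.assoc hAh_add)
  then show ?thesis by (simp add: uv)
qed

text \<open>The bound \<open>p\<close> on the degree in \<open>y\<close> of \<open>E\<^sub>x(x)\<close> and \<open>E\<^sub>x(yhat)\<close> is what makes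
  \<open>h\<^sup>p E\<^sub>x\<close> preserve \<open>A\<^sub>h\<close>.\<close>

definition y_degree_le :: "'a::field weyl \<Rightarrow> nat \<Rightarrow> bool" where
  "y_degree_le a n \<longleftrightarrow> (\<forall>i>n. co a i = 0)"

lemma y_degree_le_add: "y_degree_le a n \<Longrightarrow> y_degree_le b n \<Longrightarrow> y_degree_le (a + b) n"
  by (simp add: y_degree_le_def nf_add)

lemma y_degree_le_PX: "y_degree_le a n \<Longrightarrow> y_degree_le (PX r * a) n"
  by (simp add: y_degree_le_def nf_PX)

lemma y_degree_le_y: "y_degree_le a n \<Longrightarrow> y_degree_le (weyl_y * a) (Suc n)"
  by (simp add: y_degree_le_def co_y)

lemma y_degree_le_y_power_PX: "y_degree_le (weyl_y ^ n * PX r) n"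
proof (induction n)
  case 0
  then show ?case using nf_PX[of r 1] by (simp add: y_degree_le_def coeff_eq_0)
next
  case (Suc n)
  then show ?case using y_degree_le_y[OF Suc] by (simp add: mult.assoc)
qed

context
  assumes char_pos: "CHAR('a::field) > 0"
begin

lemma center_Der:
  fixes h :: "'a poly"
  assumes "h \<noteq> 0" "z \<in> center (Ah h)" "D \<in> Der (Ah h)"
  shows "(\<lambda>a\<in>Ah h. z * D a) \<in> Der (Ah h)"
proof -
  have z: "z \<in> Ah h" "\<And>b. b * z = z * b"
    using assms(2) center_commute[OF char_pos assms(1,2)] by (auto simp: center_def)
  have left: "a * (z * b) = z * (a * b)" for a b
    by (metis mult.assoc z(2))
  show ?thesis
    using assms(3) z(1)
    by (intro DerI)
       (auto simp: Der_closed Ah_mult Der_add Der_mult Der_const_mult distrib_left left mult.assoc)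
qed

text \<open>The derivation of \<open>A\<^sub>1\<close> with \<open>x \<mapsto> 0\<close> and \<open>y \<mapsto> r h\<^sup>p\<^sup>-\<^sup>1\<close> sends \<open>yhat = y h\<close> to \<open>h\<^sup>p r\<close>; dividing
  it by the central element \<open>h\<^sup>p\<close> gives \<open>D\<^sub>r\<close>.\<close>

lemma D_poly_spec:
  fixes h :: "'a poly"
  assumes "h \<noteq> 0"
  shows "D_poly h r \<in> Der (Ah h)" "D_poly h r weyl_x = 0" "D_poly h r (yhat h) = PX r"
proof -
  let ?f = "h ^ CHAR('a)"
  have "PX (r * h ^ (CHAR('a) - 1)) * weyl_x - weyl_x * PX (r * h ^ (CHAR('a) - 1)) +
      (weyl_y * 0 - 0 * weyl_y) = 0"
    by (simp add: weyl_x_PX)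
  then obtain E where E: "E weyl_x = 0" "E weyl_y = PX (r * h ^ (CHAR('a) - 1))"
      "\<And>c. E (weyl_const c) = 0" "\<And>a b. E (a + b) = E a + E b" "\<And>a b. E (a * b) = E a * b + a * E b"
    using weyl_derivation_exists[of "PX (r * h ^ (CHAR('a) - 1))" 0] by metis
  have der: "derivation E" using E by (simp add: derivation_def)
  have "E (yhat h) = PX (r * h ^ (CHAR('a) - 1)) * PX h"
    unfolding yhat_def by (simp only: E derivation_PX[OF der E(1)]) simp
  also have "\<dots> = PX ?f * PX r"
    by (simp only: PX_mult[symmetric] mult.assoc power_minus_mult[OF char_pos] mult.commute[of ?f])
  finally have y: "E (yhat h) = PX ?f * PX r" .
  have "E weyl_x = PX ?f * 0" by (simp add: E)
  then obtain D where D: "D \<in> Der (Ah h)" "D weyl_x = 0" "D (yhat h) = PX r"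
    using divided_derivation[OF der _ _ _ Ah_0 y Ah_PX] pderiv_power_char[OF char_pos] assms
    by (metis dvd_refl power_not_zero)
  have "D_poly h r = D"
    unfolding D_poly_def using D by (intro the_equality) (auto intro: Der_eqI)
  then show "D_poly h r \<in> Der (Ah h)" "D_poly h r weyl_x = 0" "D_poly h r (yhat h) = PX r"
    using D by simp_all
qed

lemma E_x_spec:
  shows "derivation (E_x :: 'a weyl \<Rightarrow> _)" "E_x (weyl_x :: 'a weyl) = weyl_y ^ (CHAR('a) - 1)"
    "E_x (weyl_y :: 'a weyl) = 0"
proof -
  let ?u = "weyl_y ^ (CHAR('a) - 1) :: 'a weyl"
  have "0 * weyl_x - weyl_x * 0 + (weyl_y * ?u - ?u * weyl_y) = 0"
    by (simp add: power_commutes)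
  then obtain E where E: "E weyl_x = ?u" "E weyl_y = 0"
      "\<And>c. E (weyl_const c) = 0" "\<And>a b. E (a + b) = E a + E b" "\<And>a b. E (a * b) = E a * b + a * E b"
    using weyl_derivation_exists[of 0 ?u] by metis
  have "E_x = E"
    unfolding E_x_def
  proof (rule the_equality)
    show "E \<in> Der UNIV \<and> E weyl_x = ?u \<and> E weyl_y = 0"
      using E by (auto simp: Der_def)
    fix D assume D: "D \<in> Der UNIV \<and> D weyl_x = ?u \<and> D weyl_y = 0"
    have "D a = E a" for a
      by (induction a rule: weyl_induct)
         (use D in \<open>simp_all add: E Der_const[of _ UNIV] Der_add[of _ UNIV] Der_mult[of _ UNIV]\<close>)
    then show "D = E" by blast
  qed
  with E show "derivation (E_x :: 'a weyl \<Rightarrow> _)" "E_x (weyl_x :: 'a weyl) = ?u"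
    "E_x (weyl_y :: 'a weyl) = 0" by (simp_all add: derivation_def)
qed

lemma E_x_simps:
  fixes a b :: "'a weyl"
  shows "E_x (a + b) = E_x a + E_x b" "E_x (a * b) = E_x a * b + a * E_x b" "E_x (weyl_const c :: 'a weyl) = 0"
    "E_x (weyl_x :: 'a weyl) = weyl_y ^ (CHAR('a) - 1)" "E_x (weyl_y :: 'a weyl) = 0"
  using E_x_spec unfolding derivation_def by blast+

lemma E_x_PX_degree: "y_degree_le (E_x (PX (r :: 'a poly))) (CHAR('a) - 1)"
proof (induction r)
  case 0
  then show ?case using E_x_simps(3)[of 0] by (simp add: y_degree_le_def)
next
  case (pCons c r)
  have "E_x (PX (pCons c r)) = weyl_y ^ (CHAR('a) - 1) * PX r + PX [:0, 1:] * E_x (PX r)"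
    by (simp add: PX_pCons E_x_simps del: One_nat_def)
  then show ?case
    using pCons.IH by (simp only: y_degree_le_add y_degree_le_y_power_PX y_degree_le_PX)
qed

lemma h_power_in_Ah:
  fixes h :: "'a poly"
  assumes "y_degree_le a n"
  shows "PX (h ^ n) * a \<in> Ah h"
  unfolding Ah_iff
proof
  fix i
  show "h ^ i dvd co (PX (h ^ n) * a) i"
    using assms le_imp_power_dvd[of i n h] unfolding y_degree_le_def
    by (cases "i \<le> n") (auto simp: nf_PX)
qed

lemma z_elt_center:
  fixes h :: "'a poly"
  assumes "h \<noteq> 0"
  shows "z_elt h \<in> center (Ah h)"
proof -
  have "co (z_elt h) i = (if i = CHAR('a) then h ^ CHAR('a) else 0)" for i
    using co_mult_y_power[of "PX (h ^ CHAR('a))" "CHAR('a)" i]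
    by (auto simp: z_elt_def nf_PX_1 coeff_pCons split: nat.splits if_splits)
  then show ?thesis
    by (simp add: center_Ah_coeffs[OF char_pos assms] pderiv_power_char[OF char_pos])
qed

text \<open>As \<open>\<rho>\<close> is \<open>1\<close> here, \<open>F\<close> is the difference of two derivations of \<open>A\<^sub>h\<close>, a central multiple of
  \<open>D\<close> at \<open>h'\<close> and the restriction of \<open>h\<^sup>p E\<^sub>x\<close>.\<close>

lemma F_breve_spec:
  fixes h :: "'a poly"
  assumes "h \<noteq> 0" "separable h"
  shows "F_breve h \<in> Der (Ah h)"
    and "F_breve h weyl_x = - (PX (h ^ CHAR('a)) * weyl_y ^ (CHAR('a) - 1))"
proof -
  let ?p = "CHAR('a)"
  let ?P = "PX (h ^ ?p)"
  define E where "E a = ?P * E_x a" for a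
  have P: "a * (?P * b) = ?P * (a * b)" for a b
    using PX_central[OF pderiv_power_char[OF char_pos dvd_refl], of h a] by (metis mult.assoc)
  have der: "derivation E"
    unfolding derivation_def E_def by (simp add: E_x_simps distrib_left P mult.assoc)
  have x: "E weyl_x \<in> Ah h"
  proof -
    have "y_degree_le (weyl_y ^ (?p - 1) * PX 1 :: 'a weyl) (?p - 1)"
      by (rule y_degree_le_y_power_PX)
    then have "y_degree_le (weyl_y ^ (?p - 1) :: 'a weyl) ?p"
      by (simp add: y_degree_le_def)
    then show ?thesis
      unfolding E_def E_x_simps by (rule h_power_in_Ah)
  qed
  have y: "E (yhat h) \<in> Ah h"
  proof -
    have "E (yhat h) = ?P * (weyl_y * E_x (PX h))"
      by (simp add: E_def yhat_def E_x_simps)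
    moreover have "y_degree_le (weyl_y * E_x (PX h)) ?p"
      using y_degree_le_y[OF E_x_PX_degree[of h]] char_pos by simp
    ultimately show ?thesis using h_power_in_Ah by metis
  qed
  obtain D where D: "D \<in> Der (Ah h)" "\<And>a. a \<in> Ah h \<Longrightarrow> PX 1 * D a = E a"
    by (rule divided_derivation[OF der _ _ _ x _ y, where f = 1]) (auto simp: pderiv_1)
  have "(\<lambda>a\<in>Ah h. (- 1) * D a) \<in> Der (Ah h)"
  proof (rule center_Der[OF assms(1) _ D(1)])
    show "- 1 \<in> center (Ah h)"
      by (simp add: center_def Ah_minus Ah_1)
  qed
  then have "(\<lambda>a\<in>Ah h. (\<lambda>a\<in>Ah h. z_elt h * D_poly h (pderiv h) a) a + (\<lambda>a\<in>Ah h. (- 1) * D a) a) \<in> Der (Ah h)"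
    by (intro Der_add_closed center_Der[OF assms(1) z_elt_center[OF assms(1)]] D_poly_spec(1) assms)
  moreover have "F_breve h = (\<lambda>a\<in>Ah h. (\<lambda>a\<in>Ah h. z_elt h * D_poly h (pderiv h) a) a + (\<lambda>a\<in>Ah h. (- 1) * D a) a)"
    unfolding F_breve_def rho_poly_separable[OF char_pos assms(2)]
    using D(2) by (auto simp: E_def)
  ultimately show "F_breve h \<in> Der (Ah h)" by simp
  show "F_breve h weyl_x = - (?P * weyl_y ^ (?p - 1))"
    unfolding F_breve_def rho_poly_separable[OF char_pos assms(2)]
    by (simp add: Ah_gens D_poly_spec(2)[OF assms(1)] E_x_simps)
qed

end

section \<open>Decomposition of derivations for separable \<open>h\<close>\<close>

context
  assumes char_pos: "CHAR('a::field) > 0"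
begin

text \<open>Integration with respect to \<open>y\<close> is possible except at the powers \<open>y\<^sup>j\<close> with \<open>p dvd j + 1\<close>.  It
  raises the degree in \<open>y\<close> by one, and the additional factor \<open>h\<close> keeps the result in \<open>A\<^sub>h\<close>.\<close>

lemma inner_correction:
  fixes h :: "'a poly"
  assumes "h \<noteq> 0" "a \<in> hAh h"
  obtains c where "c \<in> Ah h"
    "\<And>j. co (a - (c * weyl_x - weyl_x * c)) j = (if CHAR('a) dvd Suc j then co a j else 0)"
proof -
  define f where "f i = (if CHAR('a) dvd i then 0 else Polynomial.smult (inverse (of_nat i)) (co a (i - 1)))" for i
  have "\<exists>c. \<forall>i. co c i = f i"
    by (rule weyl_coeffs_exist[of "Suc (Polynomial.degree (nf a))"]) (auto simp: f_def coeff_eq_0)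
  then obtain c where c: "\<And>i. co c i = f i" by blast
  have "h ^ i dvd f i" for i
  proof (cases i)
    case (Suc j)
    have "h ^ Suc j dvd co a j"
      using assms(2) hAh_iff[OF assms(1)] by blast
    then show ?thesis by (simp add: f_def Suc dvd_smult del: power_Suc)
  qed simp
  then have "c \<in> Ah h" by (simp add: Ah_iff c)
  moreover have "co (a - (c * weyl_x - weyl_x * c)) j = (if CHAR('a) dvd Suc j then co a j else 0)" for j
  proof (cases "CHAR('a) dvd Suc j")
    case True
    then have "(of_nat (Suc j) :: 'a poly) = 0"
      by (simp only: of_nat_eq_0_iff_char_dvd semiring_char_poly)
    then have "co (c * weyl_x - weyl_x * c) j = 0"
      by (simp only: co_commutator_x mult_zero_left)
    with True show ?thesis
      unfolding nf_diff[of a] by simp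
  next
    case False
    then have "(of_nat (Suc j) :: 'a) \<noteq> 0"
      by (simp only: of_nat_eq_0_iff_char_dvd not_False_eq_True)
    then have "Polynomial.smult (of_nat (Suc j)) (f (Suc j)) = co a j"
      using False by (simp add: f_def del: of_nat_Suc)
    then have "of_nat (Suc j) * f (Suc j) = co a j"
      by (simp add: of_nat_poly del: of_nat_Suc)
    with False show ?thesis
      unfolding nf_diff[of a] coeff_diff co_commutator_x c by (simp del: of_nat_Suc)
  qed
  ultimately show thesis by (rule that)
qed

text \<open>What integration leaves over is a multiple of \<open>h\<^sup>p y\<^sup>p\<^sup>-\<^sup>1 = - F(x)\<close>, but so far with a factor
  from the centralizer of \<open>x\<close> only.\<close>

lemma y_top_part:
  fixes h :: "'a poly"
  assumes "h \<noteq> 0" "a \<in> hAh h" and a: "\<And>j. \<not> CHAR('a) dvd Suc j \<Longrightarrow> co a j = 0"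
  obtains w where "w \<in> Ah h" "w * weyl_x = weyl_x * w"
    "a = w * (PX (h ^ CHAR('a)) * weyl_y ^ (CHAR('a) - 1))"
proof -
  let ?p = "CHAR('a)"
  define f where "f i = (if ?p dvd i then co a (i + (?p - 1)) div h ^ ?p else 0)" for i
  have "\<exists>c. \<forall>i. co c i = f i"
    by (rule weyl_coeffs_exist[of "Polynomial.degree (nf a)"]) (auto simp: f_def coeff_eq_0)
  then obtain w where w: "\<And>i. co w i = f i" by blast
  have dvd: "h ^ (i + ?p) dvd co a (i + (?p - 1))" for i
  proof -
    have "h ^ Suc (i + (?p - 1)) dvd co a (i + (?p - 1))"
      using assms(2) hAh_iff[OF assms(1)] by blast
    then show ?thesis using char_pos by simp
  qed
  have f: "?p dvd i \<Longrightarrow> h ^ ?p * f i = co a (i + (?p - 1))" for i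
    using dvd[of i] by (simp add: f_def power_add dvd_mult_right)
  have "h ^ i dvd f i" for i
  proof (cases "?p dvd i")
    case True
    then have "h ^ ?p * h ^ i dvd h ^ ?p * f i"
      using dvd[of i] f by (simp add: power_add mult.commute)
    then show ?thesis using assms(1) by simp
  qed (simp add: f_def)
  then have "w \<in> Ah h" by (simp add: Ah_iff w)
  moreover have wx: "w * weyl_x = weyl_x * w"
    by (simp add: comm_x_iff[OF char_pos] w f_def)
  moreover have "a = w * (PX (h ^ ?p) * weyl_y ^ (?p - 1))"
  proof (rule weyl_eqI)
    fix j
    have "w * (PX (h ^ ?p) * weyl_y ^ (?p - 1)) = (PX (h ^ ?p) * w) * weyl_y ^ (?p - 1)"
      using comm_x_PX[OF char_pos wx] by (metis mult.assoc)
    then have eq: "co (w * (PX (h ^ ?p) * weyl_y ^ (?p - 1))) j = (if j < ?p - 1 then 0 else h ^ ?p * f (j - (?p - 1)))"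
      by (simp only: co_mult_y_power nf_PX coeff_smult w)
    show "co a j = co (w * (PX (h ^ ?p) * weyl_y ^ (?p - 1))) j"
    proof (cases "j < ?p - 1")
      case True
      then have "\<not> ?p dvd Suc j" by (auto dest!: dvd_imp_le)
      with True show ?thesis using a eq by simp
    next
      case False
      define i where "i = j - (?p - 1)"
      have j: "j = i + (?p - 1)" "Suc j = i + ?p"
        using False char_pos by (auto simp: i_def)
      show ?thesis
      proof (cases "?p dvd i")
        case True
        then show ?thesis using eq f False by (simp add: j)
      next
        case False
        then have "\<not> ?p dvd Suc j" by (simp add: j(2))
        then have "co a j = 0" by (rule a)
        then show ?thesis
          using eq \<open>\<not> j < ?p - 1\<close> False by (simp add: f_def flip: i_def)
      qed
    qed
  qed
  ultimately show thesis by (rule that)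
qed

text \<open>Both sides satisfy the same Leibniz rule on \<open>F[x]\<close>, because \<open>w\<close> commutes with \<open>x\<close>.\<close>

lemma Der_PX_via_E_x:
  fixes h :: "'a poly"
  assumes D: "D \<in> Der (Ah h)" and w: "w * weyl_x = weyl_x * w"
    and x: "D weyl_x = w * weyl_y ^ (CHAR('a) - 1)"
  shows "D (PX r) = w * E_x (PX r)"
proof (induction r)
  case 0
  then show ?case using Der_const[OF D Ah_1, of 0] E_x_simps(3)[OF char_pos, of 0] by simp
next
  case (pCons c r)
  have "D (PX (pCons c r)) = D weyl_x * PX r + weyl_x * D (PX r)"
    using D by (simp add: PX_pCons Der_add Der_mult Der_const Ah_gens Ah_mult Ah_PX Ah_1)
  also have "\<dots> = w * weyl_y ^ (CHAR('a) - 1) * PX r + weyl_x * w * E_x (PX r)"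
    by (simp only: x pCons.IH mult.assoc)
  also have "\<dots> = w * E_x (PX (pCons c r))"
    by (simp add: PX_pCons E_x_simps[OF char_pos] distrib_left mult.assoc flip: w del: One_nat_def)
  finally show ?case .
qed

text \<open>The relation \<open>[yhat, x] = h\<close> forces the factor to be central.  Comparing what \<open>D\<close> and
  \<open>W E\<^sub>x\<close>, with \<open>W = w h\<^sup>p\<close>, make of this relation leaves \<open>[yhat, W] y\<^sup>p\<^sup>-\<^sup>1\<close> equal to a
  commutator with \<open>x\<close>.  Such a commutator has no terms in \<open>y\<^sup>j\<close> with \<open>p dvd j + 1\<close>, while
  \<open>[yhat, W] y\<^sup>p\<^sup>-\<^sup>1\<close> has no others; so \<open>[yhat, W] = 0\<close>, that is, the coefficients of \<open>w\<close> have
  derivative zero.\<close>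

lemma top_part_central:
  fixes h :: "'a poly"
  assumes h: "h \<noteq> 0" and D: "D \<in> Der (Ah h)" and w: "w \<in> Ah h" "w * weyl_x = weyl_x * w"
    and x: "D weyl_x = w * (PX (h ^ CHAR('a)) * weyl_y ^ (CHAR('a) - 1))"
  shows "w \<in> center (Ah h)"
proof -
  let ?p = "CHAR('a)"
  let ?P = "PX (h ^ ?p)" and ?y = "weyl_y ^ (?p - 1) :: 'a weyl"
  let ?K = "weyl_y * E_x (PX h)"
  have P: "?P * b = b * ?P" for b
    by (rule PX_central) (simp add: pderiv_power_char[OF char_pos])
  define W where "W = w * ?P"
  have W: "W * weyl_x = weyl_x * W"
    unfolding W_def using w(2) P by (metis mult.assoc)
  have Dx: "D weyl_x = W * ?y"
    by (simp add: W_def x mult.assoc)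
  have 1: "E_x (PX h) = (?K * weyl_x - weyl_x * ?K) + (yhat h * ?y - ?y * yhat h)"
  proof -
    have "E_x (yhat h * weyl_x - weyl_x * yhat h) = (?K * weyl_x - weyl_x * ?K) + (yhat h * ?y - ?y * yhat h)"
      by (simp add: derivation_diff[OF E_x_spec(1)[OF char_pos]] E_x_simps[OF char_pos] yhat_def algebra_simps
          del: One_nat_def)
    then show ?thesis by (simp only: yhat_relation)
  qed
  have 2: "W * E_x (PX h) = (D (yhat h) * weyl_x - weyl_x * D (yhat h)) + (yhat h * (W * ?y) - (W * ?y) * yhat h)"
    using Der_relation[OF D] Der_PX_via_E_x[OF D W Dx, of h] by (simp only: Dx)
  let ?L = "W * ?K - D (yhat h)"
  have "(yhat h * W - W * yhat h) * ?y = ?L * weyl_x - weyl_x * ?L"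
  proof -
    have "(yhat h * W - W * yhat h) * ?y = yhat h * (W * ?y) - (W * ?y) * yhat h - W * (yhat h * ?y - ?y * yhat h)"
      by (simp only: left_diff_distrib right_diff_distrib mult.assoc) simp
    also have "yhat h * ?y - ?y * yhat h = E_x (PX h) - (?K * weyl_x - weyl_x * ?K)"
      using 1 by (metis add_diff_cancel_left')
    also have "yhat h * (W * ?y) - (W * ?y) * yhat h = W * E_x (PX h) - (D (yhat h) * weyl_x - weyl_x * D (yhat h))"
      using 2 by (metis add_diff_cancel_left')
    also have "W * E_x (PX h) - (D (yhat h) * weyl_x - weyl_x * D (yhat h)) -
        W * (E_x (PX h) - (?K * weyl_x - weyl_x * ?K)) = ?L * weyl_x - weyl_x * ?L"
    proof -
      have "W * (weyl_x * ?K) = weyl_x * (W * ?K)" using W by (metis mult.assoc)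
      then show ?thesis by (simp add: left_diff_distrib right_diff_distrib mult.assoc)
    qed
    finally show ?thesis .
  qed
  then have zero: "co ((yhat h * W - W * yhat h) * ?y) j = 0" if "?p dvd Suc j" for j
  proof -
    have "(of_nat (Suc j) :: 'a poly) = 0"
      using that by (simp only: of_nat_eq_0_iff_char_dvd semiring_char_poly)
    then show ?thesis
      using \<open>(yhat h * W - W * yhat h) * ?y = ?L * weyl_x - weyl_x * ?L\<close>
      by (simp only: co_commutator_x) simp
  qed
  have "pderiv (co w i) = 0" if i: "?p dvd i" for i
  proof -
    have "co ((yhat h * W - W * yhat h) * ?y) (i + (?p - 1)) = h * pderiv (co W i)"
      by (simp add: co_mult_y_power commutator_yhat[OF char_pos W] del: One_nat_def)
    moreover have "?p dvd Suc (i + (?p - 1))" using i char_pos by simp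
    ultimately have "pderiv (co W i) = 0" using zero h by simp
    moreover have "co W i = h ^ ?p * co w i"
      unfolding W_def by (simp add: P[symmetric] nf_PX)
    ultimately show ?thesis
      using h by (simp add: pderiv_mult pderiv_power_char[OF char_pos])
  qed
  moreover have "co w i = 0" if "\<not> ?p dvd i" for i
    using w(2) that by (simp add: comm_x_iff[OF char_pos])
  ultimately show ?thesis
    using w(1) unfolding center_Ah_coeffs[OF char_pos h] Ah_iff by (metis pderiv_0)
qed

text \<open>Choose \<open>u\<close> in \<open>F[x\<^sup>p]\<close> such that \<open>r\<close> and \<open>u q\<close> have the same trace.\<close>

lemma poly_decomposition:
  fixes h :: "'a poly"
  assumes h: "h \<noteq> 0" and sep: "separable h" and q: "trace_h h q dvd 1"
  shows "\<exists>g u. r = h * pderiv g + u * q \<and> pderiv u = 0"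
proof -
  obtain e where e: "1 = trace_h h q * e" using q ..
  have "e dvd 1" using e by (metis dvd_triv_right)
  then obtain c where c: "e = [:c:]" by (rule is_unit_polyE)
  define u where "u = e * trace_h h r"
  have u: "pderiv u = 0"
    using trace_h_const[OF char_pos, of h r] by (simp add: u_def c pderiv_smult)
  have "trace_h h (r - u * q) = trace_h h r - u * trace_h h q"
    using trace_h_add[OF char_pos, of h r "- (u * q)"]
    by (simp add: trace_h_uminus[OF char_pos] trace_h_linear[OF char_pos u])
  also have "\<dots> = trace_h h r * (1 - trace_h h q * e)"
    by (simp add: u_def algebra_simps)
  finally have "trace_h h (r - u * q) = 0" using e by simp
  then obtain g where "r - u * q = h * pderiv g"
    using trace_h_zero_imp[OF char_pos sep h] by blast
  then show ?thesis using u by (metis diff_add_cancel)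
qed

text \<open>Such a \<open>G\<close> is determined by \<open>G(yhat)\<close>, which lies in \<open>F[x][y\<^sup>p]\<close>.  There \<open>[-, yhat]\<close> acts on
  coefficients as \<open>- h \<partial>\<close>, so the decomposition can be made coefficient by coefficient.\<close>

lemma Der_killing_x:
  fixes h :: "'a poly"
  assumes h: "h \<noteq> 0" and sep: "separable h" and q: "trace_h h q dvd 1"
    and G: "G \<in> Der (Ah h)" "G weyl_x = 0"
  shows "\<exists>a\<in>center (Ah h). \<exists>c\<in>Ah h. \<forall>u\<in>Ah h. G u = a * D_poly h q u + (c * u - u * c)"
proof -
  let ?p = "CHAR('a)"
  define b where "b = G (yhat h)"
  have b: "b \<in> Ah h" unfolding b_def by (intro Der_closed[OF G(1)] Ah_gens)
  have bx: "b * weyl_x = weyl_x * b"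
    using Der_relation[OF G(1)] Der_PX_zero[OF G, of h] G(2) by (simp add: b_def)
  \<comment> \<open>The clause for \<open>co b i = 0\<close> makes the families \<open>g\<close> and \<open>u\<close> finitely supported.\<close>
  have "\<exists>g u. co b i = h ^ i * (h * pderiv g + u * q) \<and> pderiv u = 0 \<and> (co b i = 0 \<longrightarrow> g = 0 \<and> u = 0)" for i
  proof (cases "co b i = 0")
    case False
    obtain r where "co b i = h ^ i * r" using b unfolding Ah_iff by blast
    then show ?thesis using poly_decomposition[OF h sep q, of r] False by metis
  qed auto
  then obtain g u where gu: "\<And>i. co b i = h ^ i * (h * pderiv (g i) + u i * q)" "\<And>i. pderiv (u i) = 0"
    "\<And>i. co b i = 0 \<Longrightarrow> g i = 0 \<and> u i = 0"
    by metis
  have "\<exists>a. \<forall>i. co a i = h ^ i * u i"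
    by (rule weyl_coeffs_exist[of "Polynomial.degree (nf b)"]) (auto simp: gu(3) coeff_eq_0)
  then obtain a where a: "\<And>i. co a i = h ^ i * u i" by blast
  have "\<exists>a. \<forall>i. co a i = - (h ^ i * g i)"
    by (rule weyl_coeffs_exist[of "Polynomial.degree (nf b)"]) (auto simp: gu(3) coeff_eq_0)
  then obtain c where c: "\<And>i. co c i = - (h ^ i * g i)" by blast
  have zero: "g i = 0 \<and> u i = 0" if "\<not> ?p dvd i" for i
    using bx that gu(3) by (simp add: comm_x_iff[OF char_pos])
  have hi: "pderiv (h ^ i) = 0" if "?p dvd i" for i
    by (rule pderiv_power_char[OF char_pos that])
  have ac: "a \<in> center (Ah h)"
    unfolding center_Ah_coeffs[OF char_pos h]
  proof (intro allI conjI impI)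
    fix i
    show "pderiv (co a i) = 0"
      using hi[of i] zero[of i] gu(2) by (cases "?p dvd i") (auto simp: a pderiv_mult)
  qed (auto simp: a zero)
  have cA: "c \<in> Ah h" by (simp add: Ah_iff c)
  have cx: "c * weyl_x = weyl_x * c"
    by (simp add: comm_x_iff[OF char_pos] c zero)
  let ?R = "\<lambda>v\<in>Ah h. (\<lambda>v\<in>Ah h. a * D_poly h q v) v + (\<lambda>v\<in>Ah h. c * v - v * c) v"
  have "G = ?R"
  proof (rule Der_eqI[OF G(1)])
    show "?R \<in> Der (Ah h)"
      by (intro Der_add_closed center_Der[OF char_pos h ac] D_poly_spec(1)[OF char_pos h] inner_Der cA)
    show "G weyl_x = ?R weyl_x"
      using G(2) cx by (simp add: Ah_gens D_poly_spec(2)[OF char_pos h])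
    have "b = a * PX q + (c * yhat h - yhat h * c)"
    proof (rule weyl_eqI)
      fix i
      have "a * PX q = PX q * a"
        using ac center_commute[OF char_pos h] by blast
      then have 1: "co (a * PX q) i = q * (h ^ i * u i)" by (simp add: nf_PX a)
      have 2: "co (c * yhat h - yhat h * c) i = h * pderiv (h ^ i * g i)"
        using commutator_yhat[OF char_pos cx, of h i]
        by (simp add: c nf_diff pderiv_minus algebra_simps)
      show "co b i = co (a * PX q + (c * yhat h - yhat h * c)) i"
        unfolding nf_add coeff_add 1 2 gu(1)[of i]
        using hi[of i] zero[of i] by (cases "?p dvd i") (auto simp: pderiv_mult algebra_simps)
    qed
    then show "G (yhat h) = ?R (yhat h)"
      by (simp add: Ah_gens D_poly_spec(3)[OF char_pos h] b_def)
  qed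
  then have "\<forall>u\<in>Ah h. G u = a * D_poly h q u + (c * u - u * c)"
    by (simp add: fun_eq_iff)
  then show ?thesis using ac cA by blast
qed

text \<open>First remove the value of \<open>D\<close> at \<open>x\<close>, by an inner derivation and a central multiple of \<open>F\<close>;
  what remains kills \<open>x\<close>.\<close>

lemma Der_decomposition:
  fixes h :: "'a poly"
  assumes h: "h \<noteq> 0" and sep: "separable h" and q: "trace_h h q dvd 1" and D: "D \<in> Der (Ah h)"
  shows "\<exists>a\<in>center (Ah h). \<exists>b\<in>center (Ah h). \<exists>c\<in>Ah h.
    \<forall>u\<in>Ah h. D u = a * D_poly h q u + b * F_breve h u + (c * u - u * c)"
proof -
  have Dx: "D weyl_x \<in> hAh h" by (rule Der_x_in_hAh[OF sep D])
  obtain c where c: "c \<in> Ah h"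
    "\<And>j. co (D weyl_x - (c * weyl_x - weyl_x * c)) j = (if CHAR('a) dvd Suc j then co (D weyl_x) j else 0)"
    using inner_correction[OF h Dx] by metis
  define E where "E = (\<lambda>u\<in>Ah h. D u + (\<lambda>u\<in>Ah h. (- c) * u - u * (- c)) u)"
  have E: "E \<in> Der (Ah h)"
    unfolding E_def by (intro Der_add_closed D inner_Der Ah_minus c(1))
  have "E weyl_x = D weyl_x - (c * weyl_x - weyl_x * c)"
    by (simp add: E_def Ah_gens)
  then have "E weyl_x \<in> hAh h" "\<And>j. \<not> CHAR('a) dvd Suc j \<Longrightarrow> co (E weyl_x) j = 0"
    using Dx commutator_hAh[OF c(1) Ah_gens(1)] c(2) hAh_diff by simp_all
  then obtain w where w: "w \<in> Ah h" "w * weyl_x = weyl_x * w"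
    "E weyl_x = w * (PX (h ^ CHAR('a)) * weyl_y ^ (CHAR('a) - 1))"
    using y_top_part[OF h] by blast
  have wc: "w \<in> center (Ah h)" by (rule top_part_central[OF h E w])
  define G where "G = (\<lambda>u\<in>Ah h. E u + (\<lambda>u\<in>Ah h. w * F_breve h u) u)"
  have G: "G \<in> Der (Ah h)"
    unfolding G_def by (intro Der_add_closed E center_Der[OF char_pos h wc] F_breve_spec[OF char_pos h sep])
  have "G weyl_x = 0"
    by (simp add: G_def Ah_gens w(3) F_breve_spec(2)[OF char_pos h sep])
  then obtain a d where ad: "a \<in> center (Ah h)" "d \<in> Ah h"
    "\<And>u. u \<in> Ah h \<Longrightarrow> G u = a * D_poly h q u + (d * u - u * d)"
    using Der_killing_x[OF h sep q G] by blast
  have "- w \<in> center (Ah h)"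
    using wc by (auto simp: center_def Ah_minus)
  moreover have "D u = a * D_poly h q u + (- w) * F_breve h u + ((c + d) * u - u * (c + d))" if "u \<in> Ah h" for u
    using ad(3)[OF that] that by (simp add: G_def E_def algebra_simps)
  ultimately show ?thesis using ad(1,2) c(1) Ah_add by blast
qed

text \<open>At \<open>x\<close>, the multiple of \<open>F\<close> has only terms in \<open>y\<^sup>j\<close> with \<open>p dvd j + 1\<close> and the inner
  derivation has none; so \<open>b = 0\<close>, and \<open>c\<close> commutes with \<open>x\<close>.  At \<open>yhat\<close>, the trace annihilates
  the inner part \<open>h \<partial>c\<close>, and the trace of \<open>q\<close> is a unit.\<close>

lemma Der_decomposition_unique:
  fixes h :: "'a poly"
  assumes h: "h \<noteq> 0" and sep: "separable h" and q: "trace_h h q dvd 1"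
    and a: "a \<in> center (Ah h)" and b: "b \<in> center (Ah h)" and c: "c \<in> Ah h"
    and zero: "\<And>u. u \<in> Ah h \<Longrightarrow> a * D_poly h q u + b * F_breve h u + (c * u - u * c) = 0"
  shows "a = 0" "b = 0"
proof -
  let ?p = "CHAR('a)"
  let ?P = "PX (h ^ ?p)"
  have eq: "c * weyl_x - weyl_x * c = ?P * b * weyl_y ^ (?p - 1)"
  proof -
    have "b * ?P = ?P * b" using b center_commute[OF char_pos h] by blast
    moreover have "c * weyl_x - weyl_x * c = b * (?P * weyl_y ^ (?p - 1))"
      using zero[OF Ah_gens(1)]
      by (simp add: D_poly_spec(2)[OF char_pos h] F_breve_spec(2)[OF char_pos h sep] del: One_nat_def)
    ultimately show ?thesis by (metis mult.assoc)
  qed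
  have "co b i = 0" for i
  proof (cases "?p dvd i")
    case True
    then have "?p dvd Suc (i + (?p - 1))" using char_pos by simp
    then have "(of_nat (Suc (i + (?p - 1))) :: 'a poly) = 0"
      by (simp only: of_nat_eq_0_iff_char_dvd semiring_char_poly)
    then have "co (c * weyl_x - weyl_x * c) (i + (?p - 1)) = 0"
      by (simp only: co_commutator_x) simp
    then show ?thesis
      unfolding eq co_mult_y_power using h by (simp add: nf_PX)
  next
    case False
    then show ?thesis using b by (simp add: center_Ah_coeffs[OF char_pos h])
  qed
  then show b0: "b = 0" by (intro weyl_eqI) simp
  then have cx: "c * weyl_x = weyl_x * c" using eq by simp
  have "co a i = 0" for i
  proof -
    have "a * PX q = yhat h * c - c * yhat h"
      using zero[OF Ah_gens(2)] b0 by (simp add: D_poly_spec(3)[OF char_pos h] algebra_simps eq_neg_iff_add_eq_0)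
    moreover have "a * PX q = PX q * a" using a center_commute[OF char_pos h] by blast
    ultimately have "co a i * q = h * pderiv (co c i)"
      using commutator_yhat[OF char_pos cx, of h i] by (metis coeff_smult mult.commute nf_PX)
    then have "trace_h h (co a i * q) = 0"
      by (simp add: trace_h_mult_pderiv[OF char_pos])
    moreover have "pderiv (co a i) = 0"
      using a by (simp add: center_Ah_coeffs[OF char_pos h])
    ultimately show ?thesis
      using q by (auto simp: trace_h_linear[OF char_pos])
  qed
  then show "a = 0" by (intro weyl_eqI) simp
qed

end

section \<open>Quotients, direct sums and bases of modules\<close>

text \<open>The union over the coset in the definition of the scalar multiplication does not depend on
  representatives, because \<open>N\<close> is stable under scalars.\<close>

lemma quotient_smult_class:
  assumes "module R M" "submodule N R M" "r \<in> carrier R" "x \<in> carrier M"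
  shows "r \<odot>\<^bsub>quotient_module M N\<^esub> (N +>\<^bsub>M\<^esub> x) = N +>\<^bsub>M\<^esub> (r \<odot>\<^bsub>M\<^esub> x)"
proof -
  interpret M: module R M by fact
  interpret N: submodule N R M by fact
  interpret S: abelian_subgroup N M
    by (intro abelian_subgroupI3 additive_subgroupI N.subgroup_axioms M.abelian_group_axioms)
  have "N +>\<^bsub>M\<^esub> (r \<odot>\<^bsub>M\<^esub> m) = N +>\<^bsub>M\<^esub> (r \<odot>\<^bsub>M\<^esub> x)" if m: "m \<in> N +>\<^bsub>M\<^esub> x" for m
  proof -
    from m obtain n where n: "n \<in> N" "m = n \<oplus>\<^bsub>M\<^esub> x"
      by (auto simp: a_r_coset_def')
    then have "r \<odot>\<^bsub>M\<^esub> m = r \<odot>\<^bsub>M\<^esub> n \<oplus>\<^bsub>M\<^esub> r \<odot>\<^bsub>M\<^esub> x"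
      using assms S.a_Hcarr by (simp add: M.smult_r_distr)
    then have "r \<odot>\<^bsub>M\<^esub> m \<in> N +>\<^bsub>M\<^esub> (r \<odot>\<^bsub>M\<^esub> x)"
      using n(1) assms(3) by (auto simp: a_r_coset_def')
    then show ?thesis
      using assms(3,4) by (metis M.smult_closed S.a_repr_independence')
  qed
  moreover have "x \<in> N +>\<^bsub>M\<^esub> x"
    using assms(4) by (rule S.a_rcos_self)
  ultimately have "(\<Union>m\<in>N +>\<^bsub>M\<^esub> x. N +>\<^bsub>M\<^esub> (r \<odot>\<^bsub>M\<^esub> m)) = N +>\<^bsub>M\<^esub> (r \<odot>\<^bsub>M\<^esub> x)"
    by blast
  then show ?thesis
    by (simp add: quotient_module_def)
qed

lemma quotient_add_class:
  assumes "module R M" "submodule N R M" "x \<in> carrier M" "y \<in> carrier M"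
  shows "(N +>\<^bsub>M\<^esub> x) \<oplus>\<^bsub>quotient_module M N\<^esub> (N +>\<^bsub>M\<^esub> y) = N +>\<^bsub>M\<^esub> (x \<oplus>\<^bsub>M\<^esub> y)"
proof -
  interpret M: module R M by fact
  interpret N: submodule N R M by fact
  interpret S: abelian_subgroup N M
    by (intro abelian_subgroupI3 additive_subgroupI N.subgroup_axioms M.abelian_group_axioms)
  show ?thesis
    using assms(3,4) by (simp add: quotient_module_def S.a_rcos_sum)
qed

lemma quotient_zero_iff:
  assumes "module R M" "submodule N R M" "x \<in> carrier M"
  shows "N +>\<^bsub>M\<^esub> x = \<zero>\<^bsub>quotient_module M N\<^esub> \<longleftrightarrow> x \<in> N"
proof -
  interpret M: module R M by fact
  interpret N: submodule N R M by fact
  interpret S: abelian_subgroup N M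
    by (intro abelian_subgroupI3 additive_subgroupI N.subgroup_axioms M.abelian_group_axioms)
  show ?thesis
    unfolding quotient_module_def
    using S.a_rcos_const S.a_rcos_self[OF assms(3)] by auto
qed

lemma quotient_carrier:
  "C \<in> carrier (quotient_module M N) \<longleftrightarrow> (\<exists>x\<in>carrier M. C = N +>\<^bsub>M\<^esub> x)"
  by (auto simp: quotient_module_def A_RCOSETS_def')

lemma quotient_module_is_module:
  assumes "module R M" "submodule N R M"
  shows "module R (quotient_module M N)"
proof -
  interpret M: module R M by fact
  interpret N: submodule N R M by fact
  let ?Q = "quotient_module M N"
  note qadd = quotient_add_class[OF assms]
  note qsmult = quotient_smult_class[OF assms]
  have zero: "\<zero>\<^bsub>?Q\<^esub> = N +>\<^bsub>M\<^esub> \<zero>\<^bsub>M\<^esub>"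
    using quotient_zero_iff[OF assms M.zero_closed] N.one_closed by simp
  have group: "abelian_group ?Q"
  proof (rule abelian_groupI)
    fix X Y assume "X \<in> carrier ?Q" "Y \<in> carrier ?Q"
    then obtain x y where xy: "x \<in> carrier M" "y \<in> carrier M" "X = N +>\<^bsub>M\<^esub> x" "Y = N +>\<^bsub>M\<^esub> y"
      by (auto simp: quotient_carrier)
    show "X \<oplus>\<^bsub>?Q\<^esub> Y \<in> carrier ?Q"
      using xy by (auto simp: qadd quotient_carrier)
    show "X \<oplus>\<^bsub>?Q\<^esub> Y = Y \<oplus>\<^bsub>?Q\<^esub> X"
      using xy by (simp add: qadd M.a_comm)
    fix Z assume "Z \<in> carrier ?Q"
    then obtain z where z: "z \<in> carrier M" "Z = N +>\<^bsub>M\<^esub> z"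
      by (auto simp: quotient_carrier)
    show "X \<oplus>\<^bsub>?Q\<^esub> Y \<oplus>\<^bsub>?Q\<^esub> Z = X \<oplus>\<^bsub>?Q\<^esub> (Y \<oplus>\<^bsub>?Q\<^esub> Z)"
      using xy z by (simp add: qadd M.a_assoc)
  next
    show "\<zero>\<^bsub>?Q\<^esub> \<in> carrier ?Q" by (auto simp: zero quotient_carrier)
  next
    fix X assume "X \<in> carrier ?Q"
    then obtain x where x: "x \<in> carrier M" "X = N +>\<^bsub>M\<^esub> x"
      by (auto simp: quotient_carrier)
    show "\<zero>\<^bsub>?Q\<^esub> \<oplus>\<^bsub>?Q\<^esub> X = X"
      using x by (simp add: zero qadd)
    show "\<exists>Y\<in>carrier ?Q. Y \<oplus>\<^bsub>?Q\<^esub> X = \<zero>\<^bsub>?Q\<^esub>"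
      using x by (intro bexI[of _ "N +>\<^bsub>M\<^esub> (\<ominus>\<^bsub>M\<^esub> x)"]) (auto simp: zero qadd quotient_carrier M.l_neg)
  qed
  show ?thesis
  proof (rule moduleI[OF M.R.is_cring group])
    fix a X assume a: "a \<in> carrier R" and "X \<in> carrier ?Q"
    then obtain x where x: "x \<in> carrier M" "X = N +>\<^bsub>M\<^esub> x"
      by (auto simp: quotient_carrier)
    show "a \<odot>\<^bsub>?Q\<^esub> X \<in> carrier ?Q"
      using a x by (auto simp: qsmult quotient_carrier)
    fix b assume b: "b \<in> carrier R"
    show "(a \<oplus>\<^bsub>R\<^esub> b) \<odot>\<^bsub>?Q\<^esub> X = a \<odot>\<^bsub>?Q\<^esub> X \<oplus>\<^bsub>?Q\<^esub> b \<odot>\<^bsub>?Q\<^esub> X"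
      using a b x by (simp add: qsmult qadd M.smult_l_distr)
    show "(a \<otimes>\<^bsub>R\<^esub> b) \<odot>\<^bsub>?Q\<^esub> X = a \<odot>\<^bsub>?Q\<^esub> (b \<odot>\<^bsub>?Q\<^esub> X)"
      using a b x by (simp add: qsmult M.smult_assoc1)
  next
    fix a X Y assume a: "a \<in> carrier R" and "X \<in> carrier ?Q" "Y \<in> carrier ?Q"
    then obtain x y where xy: "x \<in> carrier M" "y \<in> carrier M" "X = N +>\<^bsub>M\<^esub> x" "Y = N +>\<^bsub>M\<^esub> y"
      by (auto simp: quotient_carrier)
    show "a \<odot>\<^bsub>?Q\<^esub> (X \<oplus>\<^bsub>?Q\<^esub> Y) = a \<odot>\<^bsub>?Q\<^esub> X \<oplus>\<^bsub>?Q\<^esub> a \<odot>\<^bsub>?Q\<^esub> Y"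
      using a xy by (simp add: qsmult qadd M.smult_r_distr)
  next
    fix X assume "X \<in> carrier ?Q"
    then obtain x where x: "x \<in> carrier M" "X = N +>\<^bsub>M\<^esub> x"
      by (auto simp: quotient_carrier)
    show "\<one>\<^bsub>R\<^esub> \<odot>\<^bsub>?Q\<^esub> X = X"
      using x by (simp add: qsmult)
  qed
qed

text \<open>Independence is required for every subset of the basis; coefficients extended by zero reduce
  this to the full pair.\<close>

lemma module_basis_two:
  assumes "module R M" and A: "A \<in> carrier M" and B: "B \<in> carrier M" and "A \<noteq> B"
    and span: "\<And>m. m \<in> carrier M \<Longrightarrow> \<exists>r\<in>carrier R. \<exists>s\<in>carrier R. m = r \<odot>\<^bsub>M\<^esub> A \<oplus>\<^bsub>M\<^esub> s \<odot>\<^bsub>M\<^esub> B"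
    and indep: "\<And>r s. r \<in> carrier R \<Longrightarrow> s \<in> carrier R \<Longrightarrow>
      r \<odot>\<^bsub>M\<^esub> A \<oplus>\<^bsub>M\<^esub> s \<odot>\<^bsub>M\<^esub> B = \<zero>\<^bsub>M\<^esub> \<Longrightarrow> r = \<zero>\<^bsub>R\<^esub> \<and> s = \<zero>\<^bsub>R\<^esub>"
  shows "module_basis R M {A, B}"
proof -
  interpret M: module R M by fact
  have sum2: "(\<Oplus>\<^bsub>M\<^esub>b\<in>{A, B}. f b \<odot>\<^bsub>M\<^esub> b) = f A \<odot>\<^bsub>M\<^esub> A \<oplus>\<^bsub>M\<^esub> f B \<odot>\<^bsub>M\<^esub> B"
    if "f \<in> {A, B} \<rightarrow> carrier R" for f
    using that A B \<open>A \<noteq> B\<close> by (simp add: M.finsum_insert M.M.finsum_empty Pi_def)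
  show ?thesis
    unfolding module_basis_def
  proof (intro conjI ballI allI impI)
    show "{A, B} \<subseteq> carrier M" using A B by simp
  next
    fix m assume "m \<in> carrier M"
    then obtain r s where rs: "r \<in> carrier R" "s \<in> carrier R" "m = r \<odot>\<^bsub>M\<^esub> A \<oplus>\<^bsub>M\<^esub> s \<odot>\<^bsub>M\<^esub> B"
      using span by blast
    let ?f = "\<lambda>b. if b = A then r else s"
    have "?f \<in> {A, B} \<rightarrow> carrier R" using rs by auto
    moreover have "m = (\<Oplus>\<^bsub>M\<^esub>b\<in>{A, B}. ?f b \<odot>\<^bsub>M\<^esub> b)"
      using rs \<open>A \<noteq> B\<close> by (subst sum2) auto
    ultimately show "\<exists>S f. finite S \<and> S \<subseteq> {A, B} \<and> f \<in> S \<rightarrow> carrier R \<and> m = (\<Oplus>\<^bsub>M\<^esub>b\<in>S. f b \<odot>\<^bsub>M\<^esub> b)"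
      by (intro exI[of _ "{A, B}"] exI[of _ ?f]) simp
  next
    fix S f b
    assume S: "finite S \<and> S \<subseteq> {A, B} \<and> f \<in> S \<rightarrow> carrier R \<and> (\<Oplus>\<^bsub>M\<^esub>b\<in>S. f b \<odot>\<^bsub>M\<^esub> b) = \<zero>\<^bsub>M\<^esub>"
      and b: "b \<in> S"
    let ?f = "\<lambda>b. if b \<in> S then f b else \<zero>\<^bsub>R\<^esub>"
    have f: "?f \<in> {A, B} \<rightarrow> carrier R" using S by auto
    have "(\<Oplus>\<^bsub>M\<^esub>b\<in>{A, B}. ?f b \<odot>\<^bsub>M\<^esub> b) = (\<Oplus>\<^bsub>M\<^esub>b\<in>S. f b \<odot>\<^bsub>M\<^esub> b)"
      using S A B by (intro M.M.add.finprod_mono_neutral_cong_right) auto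
    then have "?f A \<odot>\<^bsub>M\<^esub> A \<oplus>\<^bsub>M\<^esub> ?f B \<odot>\<^bsub>M\<^esub> B = \<zero>\<^bsub>M\<^esub>"
      using sum2[OF f] S by simp
    then have "?f A = \<zero>\<^bsub>R\<^esub> \<and> ?f B = \<zero>\<^bsub>R\<^esub>"
      using f by (intro indep) auto
    then show "f b = \<zero>\<^bsub>R\<^esub>"
      using S b by (auto split: if_splits)
  qed
qed

text \<open>Multiplying an expansion of \<open>m\<close> by \<open>r\<close> gives an expansion of zero with coefficients \<open>r f(b)\<close>.\<close>

lemma basis_torsion_free:
  assumes "module R M" "module_basis R M X" and m: "m \<in> carrier M" and r: "r \<in> carrier R"
    and zero: "r \<odot>\<^bsub>M\<^esub> m = \<zero>\<^bsub>M\<^esub>"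
    and regular: "\<And>s. s \<in> carrier R \<Longrightarrow> r \<otimes>\<^bsub>R\<^esub> s = \<zero>\<^bsub>R\<^esub> \<Longrightarrow> s = \<zero>\<^bsub>R\<^esub>"
  shows "m = \<zero>\<^bsub>M\<^esub>"
proof -
  interpret M: module R M by fact
  obtain S f where S: "finite S" "S \<subseteq> X" and f: "f \<in> S \<rightarrow> carrier R"
    and m_eq: "m = (\<Oplus>\<^bsub>M\<^esub>b\<in>S. f b \<odot>\<^bsub>M\<^esub> b)"
    using assms(2)[unfolded module_basis_def, THEN conjunct2, THEN conjunct1, rule_format, OF m]
    by (elim exE conjE) (rule that)
  have X: "X \<subseteq> carrier M" using assms(2) by (simp add: module_basis_def)
  have "\<zero>\<^bsub>M\<^esub> = (\<Oplus>\<^bsub>M\<^esub>b\<in>S. r \<odot>\<^bsub>M\<^esub> (f b \<odot>\<^bsub>M\<^esub> b))"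
    unfolding zero[symmetric] m_eq using S X f r
    by (intro M.finsum_smult_ldistr) auto
  also have "\<dots> = (\<Oplus>\<^bsub>M\<^esub>b\<in>S. (r \<otimes>\<^bsub>R\<^esub> f b) \<odot>\<^bsub>M\<^esub> b)"
  proof (rule M.M.finsum_cong'[OF refl])
    have "\<And>b. b \<in> S \<Longrightarrow> f b \<in> carrier R \<and> b \<in> carrier M" using f S X by auto
    then show "(\<lambda>b. (r \<otimes>\<^bsub>R\<^esub> f b) \<odot>\<^bsub>M\<^esub> b) \<in> S \<rightarrow> carrier M"
      "\<And>b. b \<in> S \<Longrightarrow> r \<odot>\<^bsub>M\<^esub> (f b \<odot>\<^bsub>M\<^esub> b) = (r \<otimes>\<^bsub>R\<^esub> f b) \<odot>\<^bsub>M\<^esub> b"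
      using r by (simp_all add: M.smult_assoc1)
  qed
  finally have "(\<Oplus>\<^bsub>M\<^esub>b\<in>S. (r \<otimes>\<^bsub>R\<^esub> f b) \<odot>\<^bsub>M\<^esub> b) = \<zero>\<^bsub>M\<^esub>" by simp
  moreover have "(\<lambda>b. r \<otimes>\<^bsub>R\<^esub> f b) \<in> S \<rightarrow> carrier R" using f r by auto
  ultimately have "finite S \<and> S \<subseteq> X \<and> (\<lambda>b. r \<otimes>\<^bsub>R\<^esub> f b) \<in> S \<rightarrow> carrier R \<and>
      (\<Oplus>\<^bsub>M\<^esub>b\<in>S. (r \<otimes>\<^bsub>R\<^esub> f b) \<odot>\<^bsub>M\<^esub> b) = \<zero>\<^bsub>M\<^esub>"
    using S by (intro conjI)
  then have "\<forall>b\<in>S. r \<otimes>\<^bsub>R\<^esub> f b = \<zero>\<^bsub>R\<^esub>"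
    by (rule assms(2)[unfolded module_basis_def, THEN conjunct2, THEN conjunct2, THEN spec, THEN spec, THEN mp])
  then have "\<And>b. b \<in> S \<Longrightarrow> f b = \<zero>\<^bsub>R\<^esub>"
    using f regular by blast
  then have "m = (\<Oplus>\<^bsub>M\<^esub>b\<in>S. \<zero>\<^bsub>M\<^esub>)"
    unfolding m_eq using S X by - (rule M.M.finsum_cong'[OF refl], auto simp: subset_eq)
  then show ?thesis by (simp add: M.M.finsum_zero)
qed

lemma cyclic_submodule_is_submodule:
  assumes "module R M" "m \<in> carrier M"
  shows "submodule (cyclic_submodule R M m) R M"
proof -
  interpret M: module R M by fact
  show ?thesis
  proof (rule M.submoduleI)
    show "cyclic_submodule R M m \<subseteq> carrier M"
      using assms(2) by (auto simp: cyclic_submodule_def)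
    show "\<zero>\<^bsub>M\<^esub> \<in> cyclic_submodule R M m"
      unfolding cyclic_submodule_def using assms(2) by (intro image_eqI[of _ _ "\<zero>\<^bsub>R\<^esub>"]) auto
  next
    fix a assume "a \<in> cyclic_submodule R M m"
    then obtain r where r: "r \<in> carrier R" "a = r \<odot>\<^bsub>M\<^esub> m" by (auto simp: cyclic_submodule_def)
    show "\<ominus>\<^bsub>M\<^esub> a \<in> cyclic_submodule R M m"
      unfolding cyclic_submodule_def using r assms(2)
      by (intro image_eqI[of _ _ "\<ominus>\<^bsub>R\<^esub> r"]) (auto simp: M.smult_l_minus)
    fix b assume "b \<in> cyclic_submodule R M m"
    then obtain s where s: "s \<in> carrier R" "b = s \<odot>\<^bsub>M\<^esub> m" by (auto simp: cyclic_submodule_def)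
    show "a \<oplus>\<^bsub>M\<^esub> b \<in> cyclic_submodule R M m"
      unfolding cyclic_submodule_def using r s assms(2)
      by (intro image_eqI[of _ _ "r \<oplus>\<^bsub>R\<^esub> s"]) (auto simp: M.smult_l_distr)
  next
    fix r a assume r: "r \<in> carrier R" and "a \<in> cyclic_submodule R M m"
    then obtain s where s: "s \<in> carrier R" "a = s \<odot>\<^bsub>M\<^esub> m" by (auto simp: cyclic_submodule_def)
    show "r \<odot>\<^bsub>M\<^esub> a \<in> cyclic_submodule R M m"
      unfolding cyclic_submodule_def using r s assms(2)
      by (intro image_eqI[of _ _ "r \<otimes>\<^bsub>R\<^esub> s"]) (auto simp: M.smult_assoc1)
  qed
qed

section \<open>The module of derivations and its torsion\<close>

context
  fixes h :: "'a::field poly"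
  assumes char_pos: "CHAR('a) > 0" and h0: "h \<noteq> 0"
begin

abbreviation (input) "ZR \<equiv> center_ring (Ah h)"
abbreviation (input) "DM \<equiv> Der_module (Ah h)"

lemma centerI: "z \<in> Ah h \<Longrightarrow> (\<And>c. c \<in> Ah h \<Longrightarrow> z * c = c * z) \<Longrightarrow> z \<in> center (Ah h)"
  by (simp add: center_def)

lemma centerD: "z \<in> center (Ah h) \<Longrightarrow> z \<in> Ah h" "z \<in> center (Ah h) \<Longrightarrow> c \<in> Ah h \<Longrightarrow> z * c = c * z"
  by (simp_all add: center_def)

lemma center_closed:
  assumes a: "a \<in> center (Ah h)" and b: "b \<in> center (Ah h)"
  shows "a + b \<in> center (Ah h)" "a * b \<in> center (Ah h)"
proof -
  note ab = centerD(1)[OF a] centerD(1)[OF b] centerD(2)[OF a] centerD(2)[OF b]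
  show "a + b \<in> center (Ah h)"
    by (rule centerI) (simp_all only: ab Ah_add distrib_left distrib_right)
  show "a * b \<in> center (Ah h)"
  proof (rule centerI)
    fix c assume "c \<in> Ah h"
    then show "a * b * c = c * (a * b)"
      using ab(3,4)[of c] by (metis mult.assoc)
  qed (intro Ah_mult ab)
qed

lemma center_minus: "a \<in> center (Ah h) \<Longrightarrow> - a \<in> center (Ah h)"
  by (rule centerI) (simp_all add: Ah_minus centerD)

lemma center_0_1: "0 \<in> center (Ah h)" "1 \<in> center (Ah h)"
  by (auto simp: center_def Ah_0 Ah_1)

lemma center_ring_cring: "cring ZR"
proof (rule cringI)
  show "abelian_group ZR"
  proof (rule abelian_groupI)
    show "\<exists>y\<in>carrier ZR. y \<oplus>\<^bsub>ZR\<^esub> x = \<zero>\<^bsub>ZR\<^esub>" if "x \<in> carrier ZR" for x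
      using that by (intro bexI[of _ "- x"]) (auto simp: center_ring_def center_minus)
  qed (auto simp: center_ring_def center_closed center_0_1 add_ac)
  show "comm_monoid ZR"
  proof (rule comm_monoidI)
    show "x \<otimes>\<^bsub>ZR\<^esub> y = y \<otimes>\<^bsub>ZR\<^esub> x" if "x \<in> carrier ZR" "y \<in> carrier ZR" for x y
      using centerD(2)[of x y] centerD(1)[of y] that by (simp add: center_ring_def)
  qed (auto simp: center_ring_def center_closed center_0_1 mult.assoc)
qed (auto simp: center_ring_def distrib_right)

lemma Der_zero: "(\<lambda>a\<in>Ah h. 0) \<in> Der (Ah h)"
  by (rule DerI) (auto simp: Ah_0)

lemma Der_restrict: "D \<in> Der B \<Longrightarrow> restrict D B = D"
  by (auto simp: Der_def PiE_def extensional_restrict)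

lemma Der_module_module: "module ZR DM"
proof (rule moduleI[OF center_ring_cring])
  show "abelian_group DM"
  proof (rule abelian_groupI)
    fix D assume D: "D \<in> carrier DM"
    have "(\<lambda>a\<in>Ah h. (- 1) * D a) \<in> carrier DM"
      using center_Der[OF char_pos h0 center_minus[OF center_0_1(2)], of D] D
      by (simp add: Der_module_def)
    then show "\<exists>E\<in>carrier DM. E \<oplus>\<^bsub>DM\<^esub> D = \<zero>\<^bsub>DM\<^esub>"
      by (rule bexI[rotated]) (auto simp: Der_module_def intro!: restrict_ext)
    show "\<zero>\<^bsub>DM\<^esub> \<oplus>\<^bsub>DM\<^esub> D = D"
      using D Der_restrict[of D] by (simp add: Der_module_def cong: restrict_cong)
  qed (auto simp: Der_module_def Der_add_closed Der_zero add_ac intro!: restrict_ext)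
next
  show "a \<odot>\<^bsub>DM\<^esub> D \<in> carrier DM" if "a \<in> carrier ZR" "D \<in> carrier DM" for a D
    using that by (simp add: Der_module_def center_ring_def center_Der[OF char_pos h0])
  show "\<one>\<^bsub>ZR\<^esub> \<odot>\<^bsub>DM\<^esub> D = D" if "D \<in> carrier DM" for D
    using that Der_restrict[of D] by (simp add: Der_module_def center_ring_def)
qed (auto simp: Der_module_def center_ring_def algebra_simps intro!: restrict_ext)

lemma Inder_iff: "D \<in> Inder (Ah h) \<longleftrightarrow> (\<exists>b\<in>Ah h. D = (\<lambda>a\<in>Ah h. b * a - a * b))"
  by (auto simp: Inder_def)

lemma Inder_submodule: "submodule (Inder (Ah h)) ZR DM"
proof -
  interpret M: module ZR DM by (rule Der_module_module)
  have sub: "Inder (Ah h) \<subseteq> carrier DM"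
    by (auto simp: Inder_iff Der_module_def inner_Der)
  have smult: "z \<odot>\<^bsub>DM\<^esub> D \<in> Inder (Ah h)" if z: "z \<in> carrier ZR" and D: "D \<in> Inder (Ah h)" for z D
  proof -
    from D obtain b where b: "b \<in> Ah h" "D = (\<lambda>a\<in>Ah h. b * a - a * b)" by (auto simp: Inder_iff)
    have "z * (b * a - a * b) = z * b * a - a * (z * b)" for a
      using z center_commute[OF char_pos h0, of z a]
      by (simp add: center_ring_def right_diff_distrib mult.assoc[symmetric])
    moreover have "z * b \<in> Ah h" using z b(1) by (auto simp: center_ring_def center_def Ah_mult)
    ultimately show ?thesis
      unfolding Inder_iff by (intro bexI[of _ "z * b"]) (auto simp: Der_module_def b(2) intro!: restrict_ext)
  qed
  show ?thesis
  proof (rule M.submoduleI[OF sub])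
    show "\<zero>\<^bsub>DM\<^esub> \<in> Inder (Ah h)"
      unfolding Inder_iff by (intro bexI[of _ 0]) (auto simp: Der_module_def Ah_0 intro!: restrict_ext)
    fix D assume D: "D \<in> Inder (Ah h)"
    then have "D \<in> carrier DM" using sub by blast
    then have "\<ominus>\<^bsub>DM\<^esub> D = (\<ominus>\<^bsub>ZR\<^esub> \<one>\<^bsub>ZR\<^esub>) \<odot>\<^bsub>DM\<^esub> D"
      by (simp add: M.smult_l_minus)
    then show "\<ominus>\<^bsub>DM\<^esub> D \<in> Inder (Ah h)"
      using smult[OF _ D] by simp
    fix E assume "E \<in> Inder (Ah h)"
    then obtain b c where "b \<in> Ah h" "D = (\<lambda>a\<in>Ah h. b * a - a * b)" "c \<in> Ah h" "E = (\<lambda>a\<in>Ah h. c * a - a * c)"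
      using D by (auto simp: Inder_iff)
    then show "D \<oplus>\<^bsub>DM\<^esub> E \<in> Inder (Ah h)"
      unfolding Inder_iff
      by (intro bexI[of _ "b + c"]) (auto simp: Der_module_def Ah_add algebra_simps intro!: restrict_ext)
  qed (rule smult)
qed

lemma HH1_module: "module ZR (HH1 (Ah h))"
  unfolding HH1_def by (rule quotient_module_is_module[OF Der_module_module Inder_submodule])

text \<open>For \<open>s = \<pi> w' - w k\<close> one has \<open>s = h (w / g)'\<close>, so \<open>D\<^sub>s\<close> is \<open>- [w / g, -]\<close>: inner after
  inverting \<open>g\<close>, though not visibly so in \<open>A\<^sub>h\<close>.  The central factor \<open>g\<^sup>p\<close> clears the
  denominator, \<open>g\<^sup>p w / g = w g\<^sup>p\<^sup>-\<^sup>1\<close>.\<close>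

lemma torsion_derivation:
  assumes g: "h = pi_poly h * g" and k: "pi_poly h * pderiv g = g * k"
  shows "(\<lambda>a\<in>Ah h. PX (g ^ CHAR('a)) * D_poly h (pi_poly h * pderiv w - w * k) a) \<in> Inder (Ah h)"
proof -
  let ?p = "CHAR('a)" and ?s = "pi_poly h * pderiv w - w * k"
  define G where "G = g ^ (?p - 1)"
  have gG: "g ^ ?p = g * G"
    using char_pos by (simp add: G_def flip: power_Suc)
  \<comment> \<open>\<open>G\<close> plays the role of \<open>1 / g\<close>: the product \<open>g G = g\<^sup>p\<close> has derivative zero.\<close>
  have const: "pderiv (g ^ ?p) = 0" by (rule pderiv_power_char[OF char_pos dvd_refl])
  then have G': "g * pderiv G = - (pderiv g * G)"
    unfolding gG by (simp add: pderiv_mult eq_neg_iff_add_eq_0 mult.commute add.commute)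
  have "h * pderiv (w * G) = pi_poly h * g * pderiv w * G + w * pi_poly h * (g * pderiv G)"
    by (subst g) (simp add: pderiv_mult algebra_simps)
  also have "\<dots> = g * G * (pi_poly h * pderiv w) - w * G * (pi_poly h * pderiv g)"
    unfolding G' by (simp add: algebra_simps)
  also have "\<dots> = g ^ ?p * ?s"
    unfolding k gG by (simp add: algebra_simps)
  finally have deriv_wG: "h * pderiv (w * G) = g ^ ?p * ?s" .
  let ?b = "- PX (w * G)"
  have cen: "PX (g ^ ?p) \<in> center (Ah h)"
    unfolding center_def using PX_central[OF const] by (simp add: Ah_PX)
  have "(\<lambda>a\<in>Ah h. PX (g ^ ?p) * D_poly h ?s a) = (\<lambda>a\<in>Ah h. ?b * a - a * ?b)"
  proof (rule Der_eqI)
    show "(\<lambda>a\<in>Ah h. PX (g ^ ?p) * D_poly h ?s a) \<in> Der (Ah h)"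
      by (intro center_Der[OF char_pos h0 cen] D_poly_spec(1)[OF char_pos h0])
    show "(\<lambda>a\<in>Ah h. ?b * a - a * ?b) \<in> Der (Ah h)"
      by (intro inner_Der Ah_minus Ah_PX)
    show "(\<lambda>a\<in>Ah h. PX (g ^ ?p) * D_poly h ?s a) weyl_x = (\<lambda>a\<in>Ah h. ?b * a - a * ?b) weyl_x"
      by (simp add: Ah_gens D_poly_spec(2)[OF char_pos h0] weyl_x_PX)
    have "?b * yhat h - yhat h * ?b = yhat h * PX (w * G) - PX (w * G) * yhat h"
      by simp
    also have "\<dots> = (weyl_y * PX (w * G) - PX (w * G) * weyl_y) * PX h"
      by (simp add: yhat_def left_diff_distrib mult.assoc PX_commute[of h])
    also have "\<dots> = PX (g ^ ?p) * PX ?s"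
      by (simp add: y_PX flip: PX_mult deriv_wG, simp add: mult.commute)
    finally show "(\<lambda>a\<in>Ah h. PX (g ^ ?p) * D_poly h ?s a) (yhat h) = (\<lambda>a\<in>Ah h. ?b * a - a * ?b) (yhat h)"
      by (simp add: Ah_gens D_poly_spec(3)[OF char_pos h0])
  qed
  then show ?thesis
    unfolding Inder_iff using Ah_minus[OF Ah_PX] by blast
qed

text \<open>The value of an inner derivation at \<open>yhat\<close> lies in the ideal \<open>(h)\<close>.\<close>

lemma inner_D_poly_dvd:
  assumes "D_poly h s \<in> Inder (Ah h)"
  shows "h dvd s"
proof -
  obtain b where b: "b \<in> Ah h" "D_poly h s = (\<lambda>a\<in>Ah h. b * a - a * b)"
    using assms by (auto simp: Inder_iff)
  then have "PX s = b * yhat h - yhat h * b"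
    using D_poly_spec(3)[OF char_pos h0, of s] by (simp add: Ah_gens)
  then have "PX s \<in> hAh h"
    using commutator_hAh[OF b(1) Ah_gens(2)] by simp
  then have "h ^ Suc 0 dvd co (PX s) 0"
    using hAh_iff[OF h0] by blast
  then show ?thesis by (simp add: nf_PX_1)
qed

text \<open>In a free module the torsion classes of the derivations \<open>D\<^sub>s\<close> above vanish, so \<open>h\<close> divides
  every \<open>\<pi> w' - w k\<close>.  The choices \<open>w = 1\<close> and \<open>w = x\<close> give \<open>h dvd k\<close> and
  \<open>h dvd \<pi> - x k\<close>, hence \<open>h dvd \<pi>\<close>.\<close>

lemma free_imp_unit:
  assumes "free_module ZR (HH1 (Ah h))"
  shows "h div pi_poly h dvd 1"
proof -
  obtain X where X: "module_basis ZR (HH1 (Ah h)) X"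
    using assms by (auto simp: free_module_def)
  let ?q = "pi_poly h"
  define g where "g = h div ?q"
  have "?q dvd h" using pi_poly_spec[OF h0, of h] by simp
  then have g: "h = ?q * g" by (simp add: g_def)
  obtain k where k: "?q * pderiv g = g * k"
    using quotient_dvd_pi_pderiv[OF h0 g] ..
  have "g ^ CHAR('a) \<noteq> 0" using g h0 by auto
  let ?z = "PX (g ^ CHAR('a))"
  have z: "?z \<in> carrier ZR"
    using PX_central[OF pderiv_power_char[OF char_pos dvd_refl], of g]
    by (simp add: center_ring_def center_def Ah_PX)
  have dvd: "h dvd ?q * pderiv w - w * k" for w
  proof (rule inner_D_poly_dvd)
    let ?D = "D_poly h (?q * pderiv w - w * k)"
    have D: "?D \<in> carrier DM" by (simp add: Der_module_def D_poly_spec(1)[OF char_pos h0])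
    then have C: "Inder (Ah h) +>\<^bsub>DM\<^esub> ?D \<in> carrier (HH1 (Ah h))"
      by (auto simp: HH1_def quotient_carrier)
    have zD: "?z \<odot>\<^bsub>DM\<^esub> ?D \<in> Inder (Ah h)"
      using torsion_derivation[OF g k] by (simp add: Der_module_def)
    have "?z \<odot>\<^bsub>HH1 (Ah h)\<^esub> (Inder (Ah h) +>\<^bsub>DM\<^esub> ?D) = Inder (Ah h) +>\<^bsub>DM\<^esub> (?z \<odot>\<^bsub>DM\<^esub> ?D)"
      unfolding HH1_def by (rule quotient_smult_class[OF Der_module_module Inder_submodule z D])
    also have "\<dots> = \<zero>\<^bsub>HH1 (Ah h)\<^esub>"
      unfolding HH1_def
      using quotient_zero_iff[OF Der_module_module Inder_submodule] zD D
        module.smult_closed[OF Der_module_module z] by blast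
    finally have "Inder (Ah h) +>\<^bsub>DM\<^esub> ?D = \<zero>\<^bsub>HH1 (Ah h)\<^esub>"
    proof (rule basis_torsion_free[OF HH1_module X C z])
      fix s assume "s \<in> carrier ZR" "?z \<otimes>\<^bsub>ZR\<^esub> s = \<zero>\<^bsub>ZR\<^esub>"
      then show "s = \<zero>\<^bsub>ZR\<^esub>"
        using PX_mult_cancel[OF \<open>g ^ CHAR('a) \<noteq> 0\<close>, of s 0] by (simp add: center_ring_def)
    qed
    then show "?D \<in> Inder (Ah h)"
      unfolding HH1_def using quotient_zero_iff[OF Der_module_module Inder_submodule D] by blast
  qed
  have "h dvd - k" using dvd[of 1] by simp
  then have "h dvd [:0, 1:] * k" by (metis dvd_minus_iff dvd_mult)
  moreover have "h dvd ?q - [:0, 1:] * k" using dvd[of "[:0, 1:]"] by (simp add: pderiv_pCons)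
  ultimately have "h dvd ?q" by (metis diff_add_cancel dvd_add)
  then have "?q * g dvd ?q * 1" using g by simp
  moreover have "?q \<noteq> 0" using g h0 by auto
  ultimately have "g dvd 1" by (simp only: dvd_times_left_cancel_iff not_False_eq_True)
  then show ?thesis by (simp add: g_def)
qed

section \<open>Direct sum and basis for separable \<open>h\<close>\<close>

context
  fixes q :: "'a poly"
  assumes sep: "separable h" and q: "is_q_breve h q"
begin

lemma D_F_in_Der_module: "D_poly h q \<in> carrier DM" "F_breve h \<in> carrier DM"
  using D_poly_spec(1)[OF char_pos h0] F_breve_spec(1)[OF char_pos h0 sep] by (simp_all add: Der_module_def)

lemma trace_unit: "trace_h h q dvd 1"
  by (rule trace_h_q_breve[OF char_pos sep h0 q])

lemma Der_direct_sum:
  "direct_sum3 ZR DM (cyclic_submodule ZR DM (D_poly h q)) (cyclic_submodule ZR DM (F_breve h)) (Inder (Ah h))"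
  unfolding direct_sum3_def
proof (intro conjI ballI)
  show "submodule (cyclic_submodule ZR DM (D_poly h q)) ZR DM" "submodule (cyclic_submodule ZR DM (F_breve h)) ZR DM"
    by (intro cyclic_submodule_is_submodule Der_module_module D_F_in_Der_module)+
  show "submodule (Inder (Ah h)) ZR DM" by (rule Inder_submodule)
  fix D assume "D \<in> carrier DM"
  then have D: "D \<in> Der (Ah h)" by (simp add: Der_module_def)
  obtain a b c where abc: "a \<in> center (Ah h)" "b \<in> center (Ah h)" "c \<in> Ah h"
    "\<forall>u\<in>Ah h. D u = a * D_poly h q u + b * F_breve h u + (c * u - u * c)"
    using Der_decomposition[OF char_pos h0 sep trace_unit D] by (elim bexE) (rule that)
  let ?U = "cyclic_submodule ZR DM (D_poly h q) \<times> cyclic_submodule ZR DM (F_breve h) \<times> Inder (Ah h)"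
  let ?S = "\<lambda>t. case t of (u, v, w) \<Rightarrow> u \<oplus>\<^bsub>DM\<^esub> v \<oplus>\<^bsub>DM\<^esub> w"
  let ?t = "\<lambda>a b c. (a \<odot>\<^bsub>DM\<^esub> D_poly h q, b \<odot>\<^bsub>DM\<^esub> F_breve h, \<lambda>u\<in>Ah h. c * u - u * c)"
  have S: "?S (?t a b c) = (\<lambda>u\<in>Ah h. a * D_poly h q u + b * F_breve h u + (c * u - u * c))" for a b c
    by (auto simp: Der_module_def intro!: restrict_ext)
  have mem: "t \<in> ?U \<longleftrightarrow> (\<exists>a\<in>center (Ah h). \<exists>b\<in>center (Ah h). \<exists>c\<in>Ah h. t = ?t a b c)" for t
    by (cases t) (auto simp: cyclic_submodule_def Inder_iff center_ring_def)
  show "\<exists>!t. t \<in> ?U \<and> D = ?S t"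
  proof (rule ex1I[of _ "?t a b c"])
    have "D = ?S (?t a b c)"
      unfolding S using Der_restrict[OF D] abc(4) by (metis (no_types, lifting) restrict_ext)
    then show "?t a b c \<in> ?U \<and> D = ?S (?t a b c)"
      using abc mem by blast
  next
    fix t assume t: "t \<in> ?U \<and> D = ?S t"
    then obtain a' b' c' where t': "a' \<in> center (Ah h)" "b' \<in> center (Ah h)" "c' \<in> Ah h" "t = ?t a' b' c'"
      unfolding mem by blast
    have eq: "a' * D_poly h q u + b' * F_breve h u + (c' * u - u * c') =
        a * D_poly h q u + b * F_breve h u + (c * u - u * c)" if "u \<in> Ah h" for u
    proof -
      have "D u = ?S (?t a' b' c') u" using t t'(4) by simp
      then show ?thesis unfolding S using abc(4) that by simp
    qed
    have diff: "a' + - a \<in> center (Ah h)" "b' + - b \<in> center (Ah h)" "c' - c \<in> Ah h"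
      by (intro center_closed(1) center_minus Ah_diff t'(1-3) abc(1-3))+
    have zero: "(a' + - a) * D_poly h q u + (b' + - b) * F_breve h u + ((c' - c) * u - u * (c' - c)) = 0"
      if "u \<in> Ah h" for u
    proof -
      have "(a' + - a) * D_poly h q u + (b' + - b) * F_breve h u + ((c' - c) * u - u * (c' - c)) =
        (a' * D_poly h q u + b' * F_breve h u + (c' * u - u * c')) -
        (a * D_poly h q u + b * F_breve h u + (c * u - u * c))"
        by (simp only: algebra_simps) simp
      then show ?thesis using eq[OF that] by simp
    qed
    have "a' = a" "b' = b"
      using Der_decomposition_unique[OF char_pos h0 sep trace_unit diff zero] by simp_all
    moreover from this have "(\<lambda>u\<in>Ah h. c' * u - u * c') = (\<lambda>u\<in>Ah h. c * u - u * c)"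
      using eq by (intro restrict_ext) simp
    ultimately show "t = ?t a b c" using t'(4) by simp
  qed
qed

lemma combination_not_inner:
  assumes "a \<in> center (Ah h)" "b \<in> center (Ah h)"
    and "a \<odot>\<^bsub>DM\<^esub> D_poly h q \<oplus>\<^bsub>DM\<^esub> b \<odot>\<^bsub>DM\<^esub> F_breve h \<in> Inder (Ah h)"
  shows "a = 0" "b = 0"
proof -
  obtain c where c: "c \<in> Ah h"
    "a \<odot>\<^bsub>DM\<^esub> D_poly h q \<oplus>\<^bsub>DM\<^esub> b \<odot>\<^bsub>DM\<^esub> F_breve h = (\<lambda>u\<in>Ah h. c * u - u * c)"
    using assms(3) by (auto simp: Inder_iff)
  have "a * D_poly h q u + b * F_breve h u + ((- c) * u - u * (- c)) = 0" if "u \<in> Ah h" for u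
    using fun_cong[OF c(2), of u] that by (simp add: Der_module_def)
  then show "a = 0" "b = 0"
    using Der_decomposition_unique[OF char_pos h0 sep trace_unit assms(1,2) Ah_minus[OF c(1)]] by blast+
qed

lemma HH1_combination:
  assumes "a \<in> center (Ah h)" "b \<in> center (Ah h)"
  shows "a \<odot>\<^bsub>HH1 (Ah h)\<^esub> HH1_class (Ah h) (D_poly h q) \<oplus>\<^bsub>HH1 (Ah h)\<^esub> b \<odot>\<^bsub>HH1 (Ah h)\<^esub> HH1_class (Ah h) (F_breve h) =
    HH1_class (Ah h) (a \<odot>\<^bsub>DM\<^esub> D_poly h q \<oplus>\<^bsub>DM\<^esub> b \<odot>\<^bsub>DM\<^esub> F_breve h)"
proof -
  have ab: "a \<in> carrier ZR" "b \<in> carrier ZR" using assms by (simp_all add: center_ring_def)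
  note cl = module.smult_closed[OF Der_module_module ab(1) D_F_in_Der_module(1)] module.smult_closed[OF Der_module_module ab(2) D_F_in_Der_module(2)]
  show ?thesis
    unfolding HH1_def HH1_class_def
    by (simp only: quotient_smult_class[OF Der_module_module Inder_submodule] ab D_F_in_Der_module
        quotient_add_class[OF Der_module_module Inder_submodule] cl)
qed

text \<open>Equal classes would make \<open>D\<^sub>q - F\<close> inner, contrary to the independence over the center.\<close>

lemma HH1_classes_distinct: "HH1_class (Ah h) (D_poly h q) \<noteq> HH1_class (Ah h) (F_breve h)"
proof
  interpret M: module ZR DM by (rule Der_module_module)
  interpret N: submodule "Inder (Ah h)" ZR DM by (rule Inder_submodule)
  interpret S: abelian_subgroup "Inder (Ah h)" DM
    by (intro abelian_subgroupI3 additive_subgroupI N.subgroup_axioms M.abelian_group_axioms)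
  assume "HH1_class (Ah h) (D_poly h q) = HH1_class (Ah h) (F_breve h)"
  then have "D_poly h q \<in> Inder (Ah h) +>\<^bsub>DM\<^esub> F_breve h"
    unfolding HH1_class_def using S.a_rcos_self[OF D_F_in_Der_module(1)] by simp
  then obtain E where E: "E \<in> Inder (Ah h)" "D_poly h q = E \<oplus>\<^bsub>DM\<^esub> F_breve h"
    by (auto simp: a_r_coset_def')
  have "E \<in> Der (Ah h)" using E(1) S.a_Hcarr by (auto simp: Der_module_def)
  have "1 \<odot>\<^bsub>DM\<^esub> D_poly h q \<oplus>\<^bsub>DM\<^esub> (- 1) \<odot>\<^bsub>DM\<^esub> F_breve h = restrict E (Ah h)"
    by (subst E(2)) (auto simp: Der_module_def intro!: restrict_ext)
  also have "\<dots> = E" by (rule Der_restrict) fact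
  finally have "1 \<odot>\<^bsub>DM\<^esub> D_poly h q \<oplus>\<^bsub>DM\<^esub> (- 1) \<odot>\<^bsub>DM\<^esub> F_breve h \<in> Inder (Ah h)"
    using E(1) by simp
  from combination_not_inner(1)[OF _ _ this] show False
    using center_0_1 center_minus by simp
qed

lemma HH1_basis: "module_basis ZR (HH1 (Ah h)) {HH1_class (Ah h) (D_poly h q), HH1_class (Ah h) (F_breve h)}"
proof (rule module_basis_two[OF HH1_module _ _ HH1_classes_distinct])
  let ?H = "HH1 (Ah h)"
  have carrier: "m \<in> carrier ?H \<longleftrightarrow> (\<exists>D\<in>carrier DM. m = HH1_class (Ah h) D)" for m
    unfolding HH1_def HH1_class_def by (rule quotient_carrier)
  then show "HH1_class (Ah h) (D_poly h q) \<in> carrier ?H" "HH1_class (Ah h) (F_breve h) \<in> carrier ?H"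
    using D_F_in_Der_module by blast+
  interpret M: module ZR DM by (rule Der_module_module)
  interpret N: submodule "Inder (Ah h)" ZR DM by (rule Inder_submodule)
  interpret S: abelian_subgroup "Inder (Ah h)" DM
    by (intro abelian_subgroupI3 additive_subgroupI N.subgroup_axioms M.abelian_group_axioms)
  have closed: "a \<odot>\<^bsub>DM\<^esub> D_poly h q \<oplus>\<^bsub>DM\<^esub> b \<odot>\<^bsub>DM\<^esub> F_breve h \<in> carrier DM"
    if "a \<in> center (Ah h)" "b \<in> center (Ah h)" for a b
    using that D_F_in_Der_module by (intro M.a_closed M.smult_closed) (auto simp: center_ring_def)
  show "\<exists>r\<in>carrier ZR. \<exists>s\<in>carrier ZR. m = r \<odot>\<^bsub>?H\<^esub> HH1_class (Ah h) (D_poly h q) \<oplus>\<^bsub>?H\<^esub>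
      s \<odot>\<^bsub>?H\<^esub> HH1_class (Ah h) (F_breve h)" if m: "m \<in> carrier ?H" for m
  proof -
    obtain D where D: "D \<in> Der (Ah h)" "m = HH1_class (Ah h) D"
      using m unfolding carrier by (auto simp: Der_module_def)
    obtain a b c where abc: "a \<in> center (Ah h)" "b \<in> center (Ah h)" "c \<in> Ah h"
      "\<forall>u\<in>Ah h. D u = a * D_poly h q u + b * F_breve h u + (c * u - u * c)"
      using Der_decomposition[OF char_pos h0 sep trace_unit D(1)] by (elim bexE) (rule that)
    let ?C = "a \<odot>\<^bsub>DM\<^esub> D_poly h q \<oplus>\<^bsub>DM\<^esub> b \<odot>\<^bsub>DM\<^esub> F_breve h"
    have "restrict D (Ah h) = (\<lambda>u\<in>Ah h. c * u - u * c) \<oplus>\<^bsub>DM\<^esub> ?C"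
      by (auto simp: Der_module_def abc(4) add_ac intro!: restrict_ext)
    then have "D = (\<lambda>u\<in>Ah h. c * u - u * c) \<oplus>\<^bsub>DM\<^esub> ?C"
      by (simp only: Der_restrict[OF D(1)])
    moreover have "(\<lambda>u\<in>Ah h. c * u - u * c) \<in> Inder (Ah h)"
      using abc(3) Inder_iff by blast
    ultimately have "D \<in> Inder (Ah h) +>\<^bsub>DM\<^esub> ?C"
      unfolding a_r_coset_def' by blast
    then have "m = HH1_class (Ah h) ?C"
      unfolding D(2) HH1_class_def using closed[OF abc(1,2)] by (metis S.a_repr_independence')
    then show ?thesis
      using abc(1,2) HH1_combination[OF abc(1,2)] by (auto simp: center_ring_def)
  qed
  show "r = \<zero>\<^bsub>ZR\<^esub> \<and> s = \<zero>\<^bsub>ZR\<^esub>"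
    if rs: "r \<in> carrier ZR" "s \<in> carrier ZR"
      and zero: "r \<odot>\<^bsub>?H\<^esub> HH1_class (Ah h) (D_poly h q) \<oplus>\<^bsub>?H\<^esub>
        s \<odot>\<^bsub>?H\<^esub> HH1_class (Ah h) (F_breve h) = \<zero>\<^bsub>?H\<^esub>" for r s
  proof -
    have rs': "r \<in> center (Ah h)" "s \<in> center (Ah h)" using rs by (simp_all add: center_ring_def)
    have "r \<odot>\<^bsub>DM\<^esub> D_poly h q \<oplus>\<^bsub>DM\<^esub> s \<odot>\<^bsub>DM\<^esub> F_breve h \<in> Inder (Ah h)"
      using zero unfolding HH1_combination[OF rs']
      unfolding HH1_def HH1_class_def quotient_zero_iff[OF Der_module_module Inder_submodule closed[OF rs']] .
    then show ?thesis
      using combination_not_inner[OF rs'] by (simp add: center_ring_def)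
  qed
qed

end

end

theorem theorem6p29:
  fixes h :: "'a::field poly"
  assumes "CHAR('a) > 0" and "h \<noteq> 0"
  shows "(free_module (center_ring (Ah h)) (HH1 (Ah h)) \<longleftrightarrow>
           (\<exists>c. c \<noteq> 0 \<and> h div pi_poly h = [:c:])) \<and>
    ((\<exists>c. c \<noteq> 0 \<and> h div pi_poly h = [:c:]) \<longrightarrow>
      (\<forall>q. is_q_breve h q \<longrightarrow>
        direct_sum3 (center_ring (Ah h)) (Der_module (Ah h))
          (cyclic_submodule (center_ring (Ah h)) (Der_module (Ah h)) (D_poly h q))
          (cyclic_submodule (center_ring (Ah h)) (Der_module (Ah h)) (F_breve h))
          (Inder (Ah h)) \<and>
        module (center_ring (Ah h)) (HH1 (Ah h)) \<and>
        module_basis (center_ring (Ah h)) (HH1 (Ah h))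
          {HH1_class (Ah h) (D_poly h q), HH1_class (Ah h) (F_breve h)} \<and>
        card {HH1_class (Ah h) (D_poly h q), HH1_class (Ah h) (F_breve h)} = 2))"
proof -
  have sep: "separable h" if "\<exists>c. c \<noteq> 0 \<and> h div pi_poly h = [:c:]"
    using that separable_if_unit_quotient[OF assms(2)] unfolding nonzero_const_iff_dvd_one by blast
  show ?thesis
  proof (intro conjI impI iffI allI)
    assume "free_module (center_ring (Ah h)) (HH1 (Ah h))"
    then show "\<exists>c. c \<noteq> 0 \<and> h div pi_poly h = [:c:]"
      unfolding nonzero_const_iff_dvd_one by (rule free_imp_unit[OF assms])
  next
    assume "\<exists>c. c \<noteq> 0 \<and> h div pi_poly h = [:c:]"
    moreover obtain q where "is_q_breve h q"
      using is_q_breve_exists[OF assms(1)] by blast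
    ultimately show "free_module (center_ring (Ah h)) (HH1 (Ah h))"
      unfolding free_module_def using HH1_module[OF assms] HH1_basis[OF assms sep] by blast
  next
    fix q assume "\<exists>c. c \<noteq> 0 \<and> h div pi_poly h = [:c:]" and q: "is_q_breve h q"
    note h = assms sep[OF this(1)] q
    show "direct_sum3 (center_ring (Ah h)) (Der_module (Ah h))
          (cyclic_submodule (center_ring (Ah h)) (Der_module (Ah h)) (D_poly h q))
          (cyclic_submodule (center_ring (Ah h)) (Der_module (Ah h)) (F_breve h)) (Inder (Ah h))"
      by (rule Der_direct_sum[OF h])
    show "module (center_ring (Ah h)) (HH1 (Ah h))" by (rule HH1_module[OF assms])
    show "module_basis (center_ring (Ah h)) (HH1 (Ah h))
          {HH1_class (Ah h) (D_poly h q), HH1_class (Ah h) (F_breve h)}"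
      by (rule HH1_basis[OF h])
    show "card {HH1_class (Ah h) (D_poly h q), HH1_class (Ah h) (F_breve h)} = 2"
      using HH1_classes_distinct[OF h] by simp
  qed
qed

end
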